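(* Let $\mathbb{G}$ be a compact Hausdorff group acting continuously on a compact Hausdorff space $X$. The isotypic components $C(X)_{\alpha}$ are finitely generated as $C(X)^{\mathbb{G}}$-modules for all irreducible representations $\alpha$ of $\mathbb{G}$ if and only if the map $$X\ni x\longmapsto\mathbb{G}_x:=\{s\in\mathbb{G}: s\triangleright x=x\}$$ is continuous for the Vietoris topology on the set of closed subgroups of $\mathbb{G}$.
   Context: $C(X)$ is the $C^*$-algebra of complex-valued continuous functions on $X$, with $\mathbb{G}$ acting by $(s\triangleright f)(x)=f(s^{-1}\triangleright x)$; $C(X)^{\mathbb{G}}\cong C(X/\mathbb{G})$ is the subalgebra of $\mathbb{G}$-invariant functions. The $\alpha$-isotypic component is $C(X)_{\alpha}=\{f\in C(X): \operatorname{span}(\mathbb{G}f)\cong\alpha^{n}\text{ for some integer } n\ge 0\}$. Vietoris continuity of $x\mapsto\mathbb{G}_x$ means that for every $x\in X$: (upper semicontinuity) for every neighborhood $U\supseteq\mathbb{G}_x$ in $\mathbb{G}$, $\{x'\in X:\mathbb{G}_{x'}\subseteq U\}$ is a neighborhood of $x$; and (lower semicontinuity) for every open $U\subseteq\mathbb{G}$ with $\mathbb{G}_x\cap U\ne\emptyset$, $\{x'\in X:\mathbb{G}_{x'}\cap U\neq\emptyset\}$ is a neighborhood of $x$. *)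

theory Defs
  imports
    "HOL-Analysis.Analysis"
    "HOL-Algebra.Group_Action"
    "HOL-Library.Function_Algebras"
    "Jordan_Normal_Form.Matrix"
begin

section \<open>Topological groups and continuous actions\<close>

locale topological_group = group G for G (structure) +
  fixes T :: "'a topology"
  assumes topspace_eq: "topspace T = carrier G"
    and continuous_mult: "continuous_map (prod_topology T T) T (\<lambda>(s, t). s \<otimes> t)"
    and continuous_inv: "continuous_map T T (\<lambda>s. inv s)"

locale continuous_group_action =
  topological_group G TG + group_action G "topspace TX" act
  for G (structure) and TG :: "'a topology" and TX :: "'x topology"
    and act :: "'a \<Rightarrow> 'x \<Rightarrow> 'x" +
  assumes continuous_act: "continuous_map (prod_topology TG TX) TX (\<lambda>(s, x). act s x)"

section \<open>Continuous functions and the induced action\<close>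

text \<open>
  Functions on the space are represented by total functions vanishing off the underlying set,
  so that equality, sums and products of the HOL functions are those of functions on the space.
\<close>

definition cfun :: "'x topology \<Rightarrow> ('x \<Rightarrow> complex) set" where
  "cfun TX = {f. continuous_map TX euclidean f \<and> (\<forall>x. x \<notin> topspace TX \<longrightarrow> f x = 0)}"

definition fscale :: "complex \<Rightarrow> ('x \<Rightarrow> complex) \<Rightarrow> 'x \<Rightarrow> complex" where
  "fscale c f = (\<lambda>x. c * f x)"

global_interpretation fun_space: vector_space fscale
  by unfold_locales (auto simp: fscale_def fun_eq_iff algebra_simps)

definition translate ::
  "('a, 'b) monoid_scheme \<Rightarrow> 'x topology \<Rightarrow> ('a \<Rightarrow> 'x \<Rightarrow> 'x) \<Rightarrow> 'a \<Rightarrow> ('x \<Rightarrow> complex) \<Rightarrow> 'x \<Rightarrow> complex"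
  where "translate G TX act s f =
    (\<lambda>x. if x \<in> topspace TX then f (act (inv\<^bsub>G\<^esub> s) x) else 0)"

definition invariant_cfun ::
  "('a, 'b) monoid_scheme \<Rightarrow> 'x topology \<Rightarrow> ('a \<Rightarrow> 'x \<Rightarrow> 'x) \<Rightarrow> ('x \<Rightarrow> complex) set"
  where "invariant_cfun G TX act =
    {f \<in> cfun TX. \<forall>s\<in>carrier G. translate G TX act s f = f}"

definition orbit_span ::
  "('a, 'b) monoid_scheme \<Rightarrow> 'x topology \<Rightarrow> ('a \<Rightarrow> 'x \<Rightarrow> 'x) \<Rightarrow> ('x \<Rightarrow> complex) \<Rightarrow> ('x \<Rightarrow> complex) set"
  where "orbit_span G TX act f = fun_space.span ((\<lambda>s. translate G TX act s f) ` carrier G)"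

section \<open>Representations and isotypic components\<close>

text \<open>
  Irreducible representations of a compact group are finite-dimensional, so up to isomorphism
  they are continuous homomorphisms to some \<open>GL(d, \<complex>)\<close>; values lie in
  \<open>GL(d, \<complex>)\<close> because \<open>\<alpha> s\<close> and \<open>\<alpha> (inv s)\<close> are mutually inverse.
\<close>

definition representation ::
  "('a, 'b) monoid_scheme \<Rightarrow> 'a topology \<Rightarrow> nat \<Rightarrow> ('a \<Rightarrow> complex mat) \<Rightarrow> bool"
  where "representation G TG d \<alpha> \<longleftrightarrow>
    (\<forall>s\<in>carrier G. \<alpha> s \<in> carrier_mat d d) \<and>
    \<alpha> \<one>\<^bsub>G\<^esub> = 1\<^sub>m d \<and>
    (\<forall>s\<in>carrier G. \<forall>t\<in>carrier G. \<alpha> (s \<otimes>\<^bsub>G\<^esub> t) = \<alpha> s * \<alpha> t) \<and>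
    (\<forall>i<d. \<forall>j<d. continuous_map TG euclidean (\<lambda>s. \<alpha> s $$ (i, j)))"

definition linear_subspace :: "nat \<Rightarrow> complex vec set \<Rightarrow> bool" where
  "linear_subspace d W \<longleftrightarrow>
    W \<subseteq> carrier_vec d \<and> 0\<^sub>v d \<in> W \<and>
    (\<forall>v\<in>W. \<forall>w\<in>W. v + w \<in> W) \<and> (\<forall>c. \<forall>v\<in>W. c \<cdot>\<^sub>v v \<in> W)"

definition irreducible_representation ::
  "('a, 'b) monoid_scheme \<Rightarrow> 'a topology \<Rightarrow> nat \<Rightarrow> ('a \<Rightarrow> complex mat) \<Rightarrow> bool"
  where "irreducible_representation G TG d \<alpha> \<longleftrightarrow>
    representation G TG d \<alpha> \<and> d > 0 \<and>
    (\<forall>W. linear_subspace d W \<and> (\<forall>s\<in>carrier G. \<forall>v\<in>W. \<alpha> s *\<^sub>v v \<in> W)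
       \<longrightarrow> W = {0\<^sub>v d} \<or> W = carrier_vec d)"

definition rep_power :: "('a \<Rightarrow> complex mat) \<Rightarrow> nat \<Rightarrow> 'a \<Rightarrow> complex mat" where
  "rep_power \<alpha> n = (\<lambda>s. diag_block_mat (replicate n (\<alpha> s)))"

text \<open>
  \<open>V\<close> is meant to be a translation-invariant linear space of functions. No continuity is asked
  of the intertwiner \<open>\<Phi>\<close>: its domain is finite-dimensional.
\<close>

definition isomorphic_to_rep ::
  "('a, 'b) monoid_scheme \<Rightarrow> 'x topology \<Rightarrow> ('a \<Rightarrow> 'x \<Rightarrow> 'x) \<Rightarrow> ('x \<Rightarrow> complex) set
    \<Rightarrow> nat \<Rightarrow> ('a \<Rightarrow> complex mat) \<Rightarrow> bool"
  where "isomorphic_to_rep G TX act V m \<rho> \<longleftrightarrow>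
    (\<exists>\<Phi>. bij_betw \<Phi> (carrier_vec m) V \<and>
      (\<forall>v\<in>carrier_vec m. \<forall>w\<in>carrier_vec m. \<Phi> (v + w) = \<Phi> v + \<Phi> w) \<and>
      (\<forall>c. \<forall>v\<in>carrier_vec m. \<Phi> (c \<cdot>\<^sub>v v) = fscale c (\<Phi> v)) \<and>
      (\<forall>s\<in>carrier G. \<forall>v\<in>carrier_vec m. \<Phi> (\<rho> s *\<^sub>v v) = translate G TX act s (\<Phi> v)))"

definition isotypic_component ::
  "('a, 'b) monoid_scheme \<Rightarrow> 'x topology \<Rightarrow> ('a \<Rightarrow> 'x \<Rightarrow> 'x) \<Rightarrow> nat \<Rightarrow> ('a \<Rightarrow> complex mat)
    \<Rightarrow> ('x \<Rightarrow> complex) set"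
  where "isotypic_component G TX act d \<alpha> =
    {f \<in> cfun TX. \<exists>n. isomorphic_to_rep G TX act (orbit_span G TX act f) (n * d) (rep_power \<alpha> n)}"

definition finitely_generated_over ::
  "('x \<Rightarrow> complex) set \<Rightarrow> ('x \<Rightarrow> complex) set \<Rightarrow> bool"
  where "finitely_generated_over A M \<longleftrightarrow>
    (\<exists>S. finite S \<and> S \<subseteq> M \<and> M = {(\<Sum>h\<in>S. a h * h) | a. \<forall>h\<in>S. a h \<in> A})"

section \<open>Vietoris continuity\<close>

definition neighborhood_of :: "'a topology \<Rightarrow> 'a set \<Rightarrow> 'a set \<Rightarrow> bool" where
  "neighborhood_of T K N \<longleftrightarrow>
    N \<subseteq> topspace T \<and> (\<exists>O'. openin T O' \<and> K \<subseteq> O' \<and> O' \<subseteq> N)"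

definition upper_semicontinuous_map :: "'x topology \<Rightarrow> 'a topology \<Rightarrow> ('x \<Rightarrow> 'a set) \<Rightarrow> bool" where
  "upper_semicontinuous_map TX T F \<longleftrightarrow>
    (\<forall>x\<in>topspace TX. \<forall>U. neighborhood_of T (F x) U
      \<longrightarrow> neighborhood_of TX {x} {x' \<in> topspace TX. F x' \<subseteq> U})"

definition lower_semicontinuous_map :: "'x topology \<Rightarrow> 'a topology \<Rightarrow> ('x \<Rightarrow> 'a set) \<Rightarrow> bool" where
  "lower_semicontinuous_map TX T F \<longleftrightarrow>
    (\<forall>x\<in>topspace TX. \<forall>U. openin T U \<and> F x \<inter> U \<noteq> {}
      \<longrightarrow> neighborhood_of TX {x} {x' \<in> topspace TX. F x' \<inter> U \<noteq> {}})"

definition vietoris_continuous_map :: "'x topology \<Rightarrow> 'a topology \<Rightarrow> ('x \<Rightarrow> 'a set) \<Rightarrow> bool" where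
  "vietoris_continuous_map TX T F \<longleftrightarrow>
    upper_semicontinuous_map TX T F \<and> lower_semicontinuous_map TX T F"

end

theory Submission
  imports Defs
begin

text \<open>The invariant mean comes from Maak's marriage argument, and power iteration provides
  enough finite-dimensional convolution projections for the Peter--Weyl theorem.

  If all isotypic components are finitely generated and \<open>w\<close> is a finite combination of matrix
  coefficients, then \<open>|(w \<star> F) y - (w \<star> F) (s \<rhd> y)|\<close> is bounded by a constant depending on \<open>F\<close>
  times \<open>\<Sum>h. |h y - h (s \<rhd> y)|\<close> over finitely many generators \<open>h\<close>. Were there points \<open>y\<close>
  arbitrarily close to \<open>x\<close> whose stabilizers miss a neighbourhood of some \<open>s\<close> fixing \<open>x\<close>, a
  gliding hump would produce an \<open>F\<close> violating every such bound.

  Conversely, lower semicontinuity makes the set of pairs of a point \<open>x\<close> and a unit vector \<open>v\<close>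
  fixed by its stabilizer compact, so finitely many equivariant maps \<open>\<Psi> l\<close> satisfy
  \<open>\<Sum>l. |B v (\<Psi> l x)|\<^sup>2 \<ge> \<delta>\<close> on it. A Neumann series then writes every equivariant map as a
  combination of the \<open>\<Psi> l\<close> with invariant coefficients.\<close>

section \<open>The invariant mean of a compact group\<close>

text \<open>In the first direction the generators \<open>h\<close> depend on \<open>w\<close> alone,
  while the invariant coefficients of \<open>w \<star> F\<close>, and with them the constant, depend
  on \<open>F\<close> in an uncontrolled way. That is the obstacle: the contradiction has to come
  from one single \<open>F\<close>, summed up as a geometric series of test functions that refutes
  every candidate constant. Test functions exist because a kernel supported near the identity smears
  \<open>y\<close> and \<open>s \<rhd> y\<close> over disjoint compact sets as soon as no element
  near \<open>s\<close> fixes \<open>y\<close>; Peter--Weyl then replaces this kernel by a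
  combination of matrix coefficients. In the second direction the value at \<open>x\<close> of an
  equivariant map is fixed by the stabilizer of \<open>x\<close>, and averaging a bump function
  shows that such values span all fixed vectors. Compactness makes this spanning uniform in
  \<open>x\<close>, and it needs lower semicontinuity: a vector moved by some stabilizer element
  must still be moved at nearby points. The series inverts the frame operator of the values
  \<open>\<Psi> l x\<close> on the fixed vectors. Upper semicontinuity holds for every continuous
  action of a compact group on a compact Hausdorff space.\<close>

lemma marriage:
  assumes "finite A" and "\<And>a. a \<in> A \<Longrightarrow> finite (N a)"
    and "\<And>S. S \<subseteq> A \<Longrightarrow> card S \<le> card (\<Union>(N ` S))"
  shows "\<exists>\<sigma>. inj_on \<sigma> A \<and> (\<forall>a\<in>A. \<sigma> a \<in> N a)"
  using assms
proof (induction "card A" arbitrary: A N rule: less_induct)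
  case less
  note finA = less.prems(1) and finN = less.prems(2) and hall = less.prems(3)
  have finU: "finite (\<Union>(N ` S))" if "S \<subseteq> A" for S
    using that finA finN finite_subset by blast
  \<comment> \<open>Induction of Halmos and Vaughan: a proper nonempty tight subset is matched on
    its own, and the rest avoids its neighbours; if every proper nonempty subset has a surplus, one
    pair may be chosen freely, since removing one value costs each neighbourhood at most one
    element.\<close>
  consider "A = {}" | "A \<noteq> {}" "\<exists>S. S \<subset> A \<and> S \<noteq> {} \<and> card (\<Union>(N ` S)) \<le> card S"
    | "A \<noteq> {}" "\<forall>S. S \<subset> A \<longrightarrow> S \<noteq> {} \<longrightarrow> card S < card (\<Union>(N ` S))"
    by (metis not_le)
  then show ?case
  proof cases
    case 1
    then show ?thesis by auto
  next
    case 2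
    then obtain S where S: "S \<subset> A" "S \<noteq> {}" "card (\<Union>(N ` S)) \<le> card S" by blast
    have finS: "finite S" using S finA finite_subset by blast
    have "\<exists>\<sigma>. inj_on \<sigma> S \<and> (\<forall>a\<in>S. \<sigma> a \<in> N a)"
      by (rule less.hyps) (use S finA finS finN hall psubset_card_mono in auto)
    then obtain \<sigma> where \<sigma>: "inj_on \<sigma> S" "\<And>a. a \<in> S \<Longrightarrow> \<sigma> a \<in> N a" by blast
    define N' where "N' a = N a - \<Union>(N ` S)" for a
    have "\<exists>\<tau>. inj_on \<tau> (A - S) \<and> (\<forall>a\<in>A - S. \<tau> a \<in> N' a)"
    proof (rule less.hyps)
      show "card (A - S) < card A"
        using S finA by (intro psubset_card_mono) auto
      show "card R \<le> card (\<Union>(N' ` R))" if R: "R \<subseteq> A - S" for R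
      proof -
        \<comment> \<open>Hall's condition for the remaining elements comes from that of
          \<open>R \<union> S\<close>, because \<open>S\<close> has no more neighbours than
          elements.\<close>
        have "card R + card S = card (R \<union> S)"
          using R finS finA by (subst card_Un_disjoint) (auto intro: finite_subset)
        also have "\<dots> \<le> card (\<Union>(N ` (R \<union> S)))"
          using R S by (intro hall) auto
        also have "\<Union>(N ` (R \<union> S)) = \<Union>(N' ` R) \<union> \<Union>(N ` S)"
          by (auto simp: N'_def)
        also have "card \<dots> \<le> card (\<Union>(N' ` R)) + card (\<Union>(N ` S))"
          by (rule card_Un_le)
        finally show ?thesis using S(3) by linarith
      qed
    qed (use finA finN N'_def in auto)
    then obtain \<tau> where \<tau>: "inj_on \<tau> (A - S)" "\<And>a. a \<in> A - S \<Longrightarrow> \<tau> a \<in> N' a" by blast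
    define \<rho> where "\<rho> a = (if a \<in> S then \<sigma> a else \<tau> a)" for a
    have cross: "\<sigma> a \<noteq> \<tau> b" if "a \<in> S" "b \<in> A - S" for a b
      using \<sigma>(2)[OF that(1)] \<tau>(2)[OF that(2)] that(1) by (auto simp: N'_def)
    have "inj_on \<rho> A"
    proof (rule inj_onI)
      fix a b assume ab: "a \<in> A" "b \<in> A" "\<rho> a = \<rho> b"
      show "a = b"
        using ab cross[of a b] cross[of b a] inj_onD[OF \<sigma>(1), of a b] inj_onD[OF \<tau>(1), of a b]
        by (auto simp: \<rho>_def split: if_splits)
    qed
    moreover have "\<forall>a\<in>A. \<rho> a \<in> N a"
      using \<sigma>(2) \<tau>(2) by (auto simp: \<rho>_def N'_def)
    ultimately show ?thesis by blast
  next
    case 3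
    then obtain a where a: "a \<in> A" by blast
    have "card {a} \<le> card (\<Union>(N ` {a}))" using a by (intro hall) auto
    then obtain b where b: "b \<in> N a" by fastforce
    define N' where "N' x = N x - {b}" for x
    have "\<exists>\<tau>. inj_on \<tau> (A - {a}) \<and> (\<forall>x\<in>A - {a}. \<tau> x \<in> N' x)"
    proof (rule less.hyps)
      show "card (A - {a}) < card A" using a finA by (meson card_Diff1_less)
      show "card R \<le> card (\<Union>(N' ` R))" if R: "R \<subseteq> A - {a}" for R
      proof (cases "R = {}")
        case False
        have "card R < card (\<Union>(N ` R))" using R False a 3(2) by blast
        moreover have "\<Union>(N' ` R) = \<Union>(N ` R) - {b}" by (auto simp: N'_def)
        moreover have "card (\<Union>(N ` R)) \<le> Suc (card (\<Union>(N ` R) - {b}))"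
          using card_Diff1_le[of "\<Union>(N ` R)" b] card_Suc_Diff1[of "\<Union>(N ` R)" b] finU[of R] R
          by (cases "b \<in> \<Union>(N ` R)") auto
        ultimately show ?thesis by presburger
      qed auto
    qed (use finA finN N'_def in auto)
    then obtain \<tau> where \<tau>: "inj_on \<tau> (A - {a})" "\<And>x. x \<in> A - {a} \<Longrightarrow> \<tau> x \<in> N' x" by blast
    define \<rho> where "\<rho> x = (if x = a then b else \<tau> x)" for x
    have "inj_on \<rho> A"
    proof (rule inj_onI)
      fix x y assume xy: "x \<in> A" "y \<in> A" "\<rho> x = \<rho> y"
      show "x = y"
        using xy \<tau>(2)[of x] \<tau>(2)[of y] inj_onD[OF \<tau>(1), of x y]
        by (auto simp: \<rho>_def N'_def split: if_splits)
    qed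
    moreover have "\<forall>x\<in>A. \<rho> x \<in> N x"
      using b \<tau>(2) by (auto simp: \<rho>_def N'_def)
    ultimately show ?thesis by blast
  qed
qed

definition avg :: "'a set \<Rightarrow> ('a \<Rightarrow> complex) \<Rightarrow> complex" where
  "avg A f = (\<Sum>a\<in>A. f a) / of_nat (card A)"

lemma avg_add: "avg A (\<lambda>a. f a + g a) = avg A f + avg A g"
  by (simp add: avg_def sum.distrib add_divide_distrib)

lemma avg_cmult: "avg A (\<lambda>a. c * f a) = c * avg A f"
  by (simp add: avg_def sum_distrib_left)

lemma avg_cnj: "avg A (\<lambda>a. cnj (f a)) = cnj (avg A f)"
  by (simp add: avg_def)

lemma avg_const: "finite A \<Longrightarrow> A \<noteq> {} \<Longrightarrow> avg A (\<lambda>a. c) = c"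
  by (simp add: avg_def)

lemma avg_swap: "avg A (\<lambda>a. avg B (f a)) = avg B (\<lambda>b. avg A (\<lambda>a. f a b))"
  unfolding avg_def sum_divide_distrib[symmetric]
  by (subst sum.swap) (simp add: mult.commute)

lemma avg_cong: "(\<And>a. a \<in> A \<Longrightarrow> f a = g a) \<Longrightarrow> avg A f = avg A g"
  by (simp add: avg_def)

lemma norm_avg_le_Re:
  assumes "\<And>a. a \<in> A \<Longrightarrow> norm (f a) \<le> Re (g a)"
  shows "norm (avg A f) \<le> Re (avg A g)"
proof -
  have "norm (avg A f) = norm (\<Sum>a\<in>A. f a) / card A"
    by (simp add: avg_def norm_divide)
  also have "\<dots> \<le> (\<Sum>a\<in>A. Re (g a)) / card A"
    using assms by (intro divide_right_mono order_trans[OF norm_sum] sum_mono) auto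
  also have "\<dots> = Re (avg A g)"
    by (simp add: avg_def Re_divide_of_nat)
  finally show ?thesis .
qed

lemma norm_avg_diff_le:
  assumes "finite A" "A \<noteq> {}" "\<And>a. a \<in> A \<Longrightarrow> norm (f a - c) \<le> e"
  shows "norm (avg A f - c) \<le> e"
proof -
  have "avg A f - c = avg A (\<lambda>a. f a - c)"
    using assms by (simp add: avg_def sum_subtractf diff_divide_distrib)
  moreover have "norm (avg A (\<lambda>a. f a - c)) \<le> Re (avg A (\<lambda>a. of_real e))"
    by (rule norm_avg_le_Re) (use assms in auto)
  ultimately show ?thesis using assms by (simp add: avg_const)
qed

text \<open>Maak's argument: minimal covers by translates of a conjugation-invariant set are matched
  with each of their two-sided translates.\<close>

lemma (in group) mult_inv_cancel:
  "t \<in> carrier G \<Longrightarrow> x \<in> carrier G \<Longrightarrow> t \<otimes> (inv t \<otimes> x) = x"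
  "t \<in> carrier G \<Longrightarrow> x \<in> carrier G \<Longrightarrow> inv t \<otimes> (t \<otimes> x) = x"
  using m_assoc[of t "inv t" x] m_assoc[of "inv t" t x] by auto

lemma (in group) maak:
  assumes V: "V \<subseteq> carrier G" "\<And>v t. v \<in> V \<Longrightarrow> t \<in> carrier G \<Longrightarrow> inv t \<otimes> v \<otimes> t \<in> V"
    and cover: "\<exists>A. finite A \<and> A \<subseteq> carrier G \<and> (\<forall>x\<in>carrier G. \<exists>a\<in>A. \<exists>v\<in>V. x = a \<otimes> v)"
  shows "\<exists>A. finite A \<and> A \<noteq> {} \<and> A \<subseteq> carrier G \<and>
    (\<forall>s\<in>carrier G. \<forall>t\<in>carrier G. \<exists>\<sigma>. bij_betw \<sigma> A ((\<lambda>a. s \<otimes> a \<otimes> t) ` A) \<and>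
       (\<forall>a\<in>A. \<exists>u\<in>V. \<exists>v\<in>V. a \<otimes> u = \<sigma> a \<otimes> v))"
proof -
  define P where "P A \<longleftrightarrow> finite A \<and> A \<subseteq> carrier G \<and> (\<forall>x\<in>carrier G. \<exists>a\<in>A. \<exists>v\<in>V. x = a \<otimes> v)" for A
  obtain A where A: "P A" and min: "\<And>B. P B \<Longrightarrow> card A \<le> card B"
    using cover ex_has_least_nat[of P _ card] unfolding P_def[symmetric] by blast
  have finA: "finite A" and AG: "A \<subseteq> carrier G"
    and covA: "\<And>x. x \<in> carrier G \<Longrightarrow> \<exists>a\<in>A. \<exists>v\<in>V. x = a \<otimes> v"
    using A by (auto simp: P_def)
  have "A \<noteq> {}" using covA[of \<one>] by auto
  moreover have "\<exists>\<sigma>. bij_betw \<sigma> A ((\<lambda>a. s \<otimes> a \<otimes> t) ` A) \<and> (\<forall>a\<in>A. \<exists>u\<in>V. \<exists>v\<in>V. a \<otimes> u = \<sigma> a \<otimes> v)"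
    if s: "s \<in> carrier G" and t: "t \<in> carrier G" for s t
  proof -
    define B where "B = (\<lambda>a. s \<otimes> a \<otimes> t) ` A"
    have BG: "B \<subseteq> carrier G" using AG s t by (auto simp: B_def)
    have finB: "finite B" using finA by (simp add: B_def)
    \<comment> \<open>Conjugation invariance of \<open>V\<close> lets the right factor
      \<open>t\<close> pass through, so a two-sided translate of a cover is again a cover.\<close>
    have covB: "\<exists>b\<in>B. \<exists>v\<in>V. x = b \<otimes> v" if x: "x \<in> carrier G" for x
    proof -
      obtain a v where av: "a \<in> A" "v \<in> V" "inv s \<otimes> x \<otimes> inv t = a \<otimes> v"
        using covA[of "inv s \<otimes> x \<otimes> inv t"] s t x by auto
      have aG: "a \<in> carrier G" and vG: "v \<in> carrier G" using av AG V by auto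
      have "(s \<otimes> a \<otimes> t) \<otimes> (inv t \<otimes> v \<otimes> t) = s \<otimes> (a \<otimes> v) \<otimes> t"
        using aG vG s t by (simp add: m_assoc mult_inv_cancel)
      also have "\<dots> = x"
        using x s t by (simp add: av(3)[symmetric] m_assoc mult_inv_cancel)
      finally show ?thesis using av V(2)[OF av(2) t] unfolding B_def by (metis imageI)
    qed
    have PB: "P B" using finB BG covB by (simp add: P_def)
    have cardB: "card B = card A"
      using min[OF PB] card_image_le[OF finA, of "\<lambda>a. s \<otimes> a \<otimes> t"] unfolding B_def
      by (simp add: le_antisym)
    define N where "N a = {b\<in>B. \<exists>u\<in>V. \<exists>v\<in>V. a \<otimes> u = b \<otimes> v}" for a
    have "\<exists>\<sigma>. inj_on \<sigma> A \<and> (\<forall>a\<in>A. \<sigma> a \<in> N a)"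
    proof (rule marriage)
      fix S assume S: "S \<subseteq> A"
      \<comment> \<open>Exchanging \<open>S\<close> for its neighbours in \<open>B\<close> preserves
        the cover, since a point covered by some \<open>a\<close> in \<open>S\<close> is also
        covered by some \<open>b\<close> in \<open>B\<close>, which is then a neighbour of
        \<open>a\<close>. Minimality of \<open>A\<close> thus yields Hall's condition.\<close>
      have "P ((A - S) \<union> \<Union>(N ` S))"
        unfolding P_def
      proof (intro conjI ballI)
        have "finite (\<Union>(N ` S))" by (rule finite_subset[OF _ finB]) (auto simp: N_def)
        then show "finite ((A - S) \<union> \<Union>(N ` S))" using finA by simp
        show "(A - S) \<union> \<Union>(N ` S) \<subseteq> carrier G" using AG BG by (auto simp: N_def)
        fix x assume x: "x \<in> carrier G"
        obtain a u where au: "a \<in> A" "u \<in> V" "x = a \<otimes> u" using covA[OF x] by blast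
        obtain b v where bv: "b \<in> B" "v \<in> V" "x = b \<otimes> v" using covB[OF x] by blast
        show "\<exists>a\<in>A - S \<union> \<Union>(N ` S). \<exists>v\<in>V. x = a \<otimes> v"
        proof (cases "a \<in> S")
          case True
          then have "b \<in> N a" using au bv unfolding N_def by blast
          then have "b \<in> \<Union>(N ` S)" using True by blast
          then show ?thesis using bv by blast
        next
          case False
          then show ?thesis using au by blast
        qed
      qed
      then have "card A \<le> card ((A - S) \<union> \<Union>(N ` S))" by (rule min)
      also have "\<dots> \<le> card (A - S) + card (\<Union>(N ` S))" by (rule card_Un_le)
      also have "card (A - S) = card A - card S"
        using S finA finite_subset by (intro card_Diff_subset) auto
      finally show "card S \<le> card (\<Union>(N ` S))"
        using card_mono[OF finA S] by linarith
    qed (use finA finB N_def in auto)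
    then obtain \<sigma> where \<sigma>: "inj_on \<sigma> A" "\<And>a. a \<in> A \<Longrightarrow> \<sigma> a \<in> N a" by blast
    have "\<sigma> ` A = B"
      using \<sigma> finB cardB by (intro card_subset_eq) (auto simp: N_def card_image)
    then have "bij_betw \<sigma> A B" using \<sigma>(1) by (simp add: bij_betw_def)
    then show ?thesis using \<sigma>(2) unfolding B_def[symmetric] by (intro exI[of _ \<sigma>]) (auto simp: N_def)
  qed
  ultimately show ?thesis using finA AG by (intro exI[of _ A] conjI ballI)
qed

section \<open>Equicontinuity on the group and the two-sided invariant mean\<close>

locale compact_group = topological_group G T for G (structure) and T :: "'a topology" +
  assumes compact_T: "compact_space T" and hausdorff_T: "Hausdorff_space T"
begin

abbreviation cfunG :: "('a \<Rightarrow> complex) \<Rightarrow> bool" where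
  "cfunG f \<equiv> continuous_map T euclidean f"

text \<open>The small factor stands between two arbitrary ones so that the set of admissible factors
  is stable under conjugation, which Maak's argument asks for.\<close>

definition equi :: "('a \<Rightarrow> complex) set \<Rightarrow> bool" where
  "equi \<F> \<longleftrightarrow> (\<forall>e>0. \<exists>N. openin T N \<and> \<one> \<in> N \<and>
     (\<forall>f\<in>\<F>. \<forall>v\<in>N. \<forall>a\<in>carrier G. \<forall>b\<in>carrier G. norm (f (a \<otimes> v \<otimes> b) - f (a \<otimes> b)) < e))"

lemma equi_Un: "equi \<F> \<Longrightarrow> equi \<G> \<Longrightarrow> equi (\<F> \<union> \<G>)"
  unfolding equi_def
proof (intro allI impI)
  fix e :: real assume "e > 0"
    and F: "\<forall>e>0. \<exists>N. openin T N \<and> \<one> \<in> N \<and>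
     (\<forall>f\<in>\<F>. \<forall>v\<in>N. \<forall>a\<in>carrier G. \<forall>b\<in>carrier G. norm (f (a \<otimes> v \<otimes> b) - f (a \<otimes> b)) < e)"
    and G: "\<forall>e>0. \<exists>N. openin T N \<and> \<one> \<in> N \<and>
     (\<forall>f\<in>\<G>. \<forall>v\<in>N. \<forall>a\<in>carrier G. \<forall>b\<in>carrier G. norm (f (a \<otimes> v \<otimes> b) - f (a \<otimes> b)) < e)"
  obtain M where "openin T M" "\<one> \<in> M"
    "\<forall>f\<in>\<F>. \<forall>v\<in>M. \<forall>a\<in>carrier G. \<forall>b\<in>carrier G. norm (f (a \<otimes> v \<otimes> b) - f (a \<otimes> b)) < e"
    using F[rule_format, OF \<open>e > 0\<close>] by (elim exE conjE)
  moreover obtain N where "openin T N" "\<one> \<in> N"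
    "\<forall>f\<in>\<G>. \<forall>v\<in>N. \<forall>a\<in>carrier G. \<forall>b\<in>carrier G. norm (f (a \<otimes> v \<otimes> b) - f (a \<otimes> b)) < e"
    using G[rule_format, OF \<open>e > 0\<close>] by (elim exE conjE)
  ultimately show "\<exists>N. openin T N \<and> \<one> \<in> N \<and>
     (\<forall>f\<in>\<F> \<union> \<G>. \<forall>v\<in>N. \<forall>a\<in>carrier G. \<forall>b\<in>carrier G. norm (f (a \<otimes> v \<otimes> b) - f (a \<otimes> b)) < e)"
    by (intro exI[of _ "M \<inter> N"]) auto
qed

lemma continuous_mult':
  "continuous_map Z T f \<Longrightarrow> continuous_map Z T g \<Longrightarrow> continuous_map Z T (\<lambda>z. f z \<otimes> g z)"
  using continuous_map_compose[OF _ continuous_mult, of Z "\<lambda>z. (f z, g z)"]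
  by (simp add: o_def continuous_map_pairedI)

lemma continuous_inv': "continuous_map Z T f \<Longrightarrow> continuous_map Z T (\<lambda>z. inv (f z))"
  using continuous_map_compose[OF _ continuous_inv, of Z f] by (simp add: o_def)

text \<open>For \<open>v = \<one>\<close> the difference vanishes on the whole compact space of
  triples \<open>(z, a, b)\<close>; the tube lemma turns this into one neighbourhood of
  \<open>\<one>\<close> that serves all of them.\<close>

lemma equi_param:
  fixes Z :: "'z topology"
  assumes Z: "compact_space Z" and H: "continuous_map (prod_topology Z T) euclidean (\<lambda>(z, t). H z t)"
  shows "equi (H ` topspace Z)"
  unfolding equi_def
proof (intro allI impI)
  fix e :: real assume e: "e > 0"
  let ?Y = "prod_topology Z (prod_topology T T)"
  let ?D = "\<lambda>(v, z, a, b). norm (H z (a \<otimes> v \<otimes> b) - H z (a \<otimes> b))"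
  have H': "continuous_map W euclidean (\<lambda>w. H (f w) (g w))"
    if "continuous_map W Z f" "continuous_map W T g" for f g and W :: "('a \<times> 'z \<times> 'a \<times> 'a) topology"
    using continuous_map_compose[OF continuous_map_pairedI[OF that] H] by (simp add: o_def)
  have p: "continuous_map (prod_topology T ?Y) Z (\<lambda>w. fst (snd w))"
    "continuous_map (prod_topology T ?Y) T (\<lambda>w. fst (snd (snd w)))"
    "continuous_map (prod_topology T ?Y) T (\<lambda>w. snd (snd (snd w)))"
    by (rule continuous_map_compose[OF continuous_map_snd, unfolded o_def, rotated]
        continuous_map_fst continuous_map_snd)+
  have c: "continuous_map (prod_topology T ?Y) euclidean ?D"
    unfolding split_beta
    by (intro continuous_map_norm continuous_map_diff H' continuous_mult' p continuous_map_fst)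
  have cY: "compactin ?Y (topspace ?Y)"
    using Z compact_T by (metis compact_space_def compact_space_prod_topology)
  have "openin (prod_topology T ?Y) {w \<in> topspace (prod_topology T ?Y). ?D w \<in> {..<e}}"
    by (rule openin_continuous_map_preimage[OF c]) auto
  from tube_lemma_right[OF this cY] have tube: "\<one> \<in> topspace T \<Longrightarrow>
     {\<one>} \<times> topspace ?Y \<subseteq> {w \<in> topspace (prod_topology T ?Y). ?D w \<in> {..<e}} \<Longrightarrow>
     \<exists>U V. openin T U \<and> openin ?Y V \<and> \<one> \<in> U \<and> topspace ?Y \<subseteq> V \<and>
       U \<times> V \<subseteq> {w \<in> topspace (prod_topology T ?Y). ?D w \<in> {..<e}}" .
  have "{\<one>} \<times> topspace ?Y \<subseteq> {w \<in> topspace (prod_topology T ?Y). ?D w \<in> {..<e}}"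
    using e by (auto simp: topspace_eq)
  then obtain U V where UV: "openin T U" "\<one> \<in> U" "topspace ?Y \<subseteq> V"
    "U \<times> V \<subseteq> {w \<in> topspace (prod_topology T ?Y). ?D w \<in> {..<e}}"
    using tube topspace_eq by (elim exE conjE meta_impE) auto
  have "norm (H z (a \<otimes> v \<otimes> b) - H z (a \<otimes> b)) < e"
    if "z \<in> topspace Z" "v \<in> U" "a \<in> carrier G" "b \<in> carrier G" for z v a b
  proof -
    have "(v, z, a, b) \<in> U \<times> V" using that UV(3) by (auto simp: topspace_eq)
    then show ?thesis using UV(4) by auto
  qed
  then show "\<exists>N. openin T N \<and> \<one> \<in> N \<and> (\<forall>f\<in>H ` topspace Z. \<forall>v\<in>N. \<forall>a\<in>carrier G. \<forall>b\<in>carrier G.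
      norm (f (a \<otimes> v \<otimes> b) - f (a \<otimes> b)) < e)"
    using UV(1,2) by blast
qed

lemma equi_single: "cfunG f \<Longrightarrow> equi {f}"
proof -
  assume f: "cfunG f"
  have "continuous_map (prod_topology (discrete_topology {()}) T) euclidean (\<lambda>(z, t). f t)"
    using f continuous_map_compose[OF continuous_map_snd, of T euclidean f "discrete_topology {()}"]
    unfolding split_beta o_def by blast
  then have "equi ((\<lambda>_. f) ` topspace (discrete_topology {()}))"
    by (intro equi_param) (auto simp: compact_space_discrete_topology)
  then show ?thesis by simp
qed

lemma equi_finite: "finite \<F> \<Longrightarrow> (\<And>f. f \<in> \<F> \<Longrightarrow> cfunG f) \<Longrightarrow> equi \<F>"
proof (induction \<F> rule: finite_induct)
  case empty
  then show ?case by (auto simp: equi_def topspace_eq intro!: exI[of _ "topspace T"])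
next
  case (insert f \<F>)
  then show ?case using equi_Un[of "{f}" \<F>] equi_single by auto
qed

text \<open>The matching between \<open>A\<close> and its translate pairs \<open>a\<close> with
  \<open>\<sigma> a\<close> so that \<open>a \<otimes> u = \<sigma> a \<otimes> v\<close>. Each of
  \<open>u\<close> and \<open>v\<close> changes \<open>f\<close> by at most \<open>e/2\<close>, so
  the two averages differ by at most \<open>e\<close>.\<close>

lemma equi_avg:
  assumes "equi \<F>" and e: "e > 0"
  obtains A where "finite A" "A \<noteq> {}" "A \<subseteq> carrier G"
    "\<And>f s t. f \<in> \<F> \<Longrightarrow> s \<in> carrier G \<Longrightarrow> t \<in> carrier G \<Longrightarrow>
       norm (avg A (\<lambda>a. f (s \<otimes> a \<otimes> t)) - avg A f) \<le> e"
proof -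
  define V where "V = {v \<in> carrier G. \<forall>f\<in>\<F>. \<forall>a\<in>carrier G. \<forall>b\<in>carrier G. norm (f (a \<otimes> v \<otimes> b) - f (a \<otimes> b)) \<le> e/2}"
  obtain N where N: "openin T N" "\<one> \<in> N"
     "\<forall>f\<in>\<F>. \<forall>v\<in>N. \<forall>a\<in>carrier G. \<forall>b\<in>carrier G. norm (f (a \<otimes> v \<otimes> b) - f (a \<otimes> b)) < e/2"
    using assms unfolding equi_def by (meson half_gt_zero)
  have NV: "N \<subseteq> V" using N openin_subset[OF N(1)] by (fastforce simp: V_def topspace_eq less_imp_le)
  have VG: "V \<subseteq> carrier G" by (auto simp: V_def)
  have conj: "inv t \<otimes> v \<otimes> t \<in> V" if v: "v \<in> V" and t: "t \<in> carrier G" for v t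
    unfolding V_def mem_Collect_eq
  proof (intro conjI ballI)
    show "inv t \<otimes> v \<otimes> t \<in> carrier G" using v t VG by auto
    fix f a b assume f: "f \<in> \<F>" and a: "a \<in> carrier G" and b: "b \<in> carrier G"
    have vG: "v \<in> carrier G" using v VG by auto
    have "norm (f ((a \<otimes> inv t) \<otimes> v \<otimes> (t \<otimes> b)) - f ((a \<otimes> inv t) \<otimes> (t \<otimes> b))) \<le> e/2"
      using v f a b t by (auto simp: V_def)
    moreover have "(a \<otimes> inv t) \<otimes> v \<otimes> (t \<otimes> b) = a \<otimes> (inv t \<otimes> v \<otimes> t) \<otimes> b"
      using vG a b t by (simp add: m_assoc)
    moreover have "(a \<otimes> inv t) \<otimes> (t \<otimes> b) = a \<otimes> b"
      using vG a b t by (simp add: m_assoc mult_inv_cancel)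
    ultimately show "norm (f (a \<otimes> (inv t \<otimes> v \<otimes> t) \<otimes> b) - f (a \<otimes> b)) \<le> e/2"
      by simp
  qed
  have "\<exists>A. finite A \<and> A \<subseteq> carrier G \<and> (\<forall>x\<in>carrier G. \<exists>a\<in>A. \<exists>v\<in>V. x = a \<otimes> v)"
  proof -
    define W where "W a = {x \<in> topspace T. inv a \<otimes> x \<in> N}" for a
    have "openin T (W a)" if "a \<in> carrier G" for a
      unfolding W_def
      by (rule openin_continuous_map_preimage[OF continuous_mult' N(1)])
        (use that topspace_eq in auto)
    moreover have "topspace T \<subseteq> \<Union>(W ` carrier G)"
      using N(2) by (auto simp: W_def topspace_eq)
    ultimately obtain \<U> where U: "finite \<U>" "\<U> \<subseteq> W ` carrier G" "topspace T \<subseteq> \<Union>\<U>"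
      using compactinD[of T "topspace T" "W ` carrier G"] compact_T unfolding compact_space_def by auto
    then obtain A where A: "A \<subseteq> carrier G" "finite A" "\<U> = W ` A"
      by (meson finite_subset_image)
    have "\<exists>a\<in>A. \<exists>v\<in>V. x = a \<otimes> v" if x: "x \<in> carrier G" for x
    proof -
      obtain a where a: "a \<in> A" "x \<in> W a" using U(3) A(3) x topspace_eq by blast
      have "x = a \<otimes> (inv a \<otimes> x)" using a A(1) x mult_inv_cancel(1)[of a x] by auto
      then show ?thesis using a NV by (auto simp: W_def)
    qed
    then show ?thesis using A by blast
  qed
  from maak[OF VG conj this] obtain A where A: "finite A" "A \<noteq> {}" "A \<subseteq> carrier G"
    and \<sigma>: "\<And>s t. s \<in> carrier G \<Longrightarrow> t \<in> carrier G \<Longrightarrow> \<exists>\<sigma>. bij_betw \<sigma> A ((\<lambda>a. s \<otimes> a \<otimes> t) ` A) \<and>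
       (\<forall>a\<in>A. \<exists>u\<in>V. \<exists>v\<in>V. a \<otimes> u = \<sigma> a \<otimes> v)" by blast
  show ?thesis
  proof (rule that[OF A])
    fix f s t assume f: "f \<in> \<F>" and s: "s \<in> carrier G" and t: "t \<in> carrier G"
    obtain \<sigma> where bij: "bij_betw \<sigma> A ((\<lambda>a. s \<otimes> a \<otimes> t) ` A)"
       and cl: "\<And>a. a \<in> A \<Longrightarrow> \<exists>u\<in>V. \<exists>v\<in>V. a \<otimes> u = \<sigma> a \<otimes> v" using \<sigma>[OF s t] by blast
    have near: "norm (f (\<sigma> a) - f a) \<le> e" if a: "a \<in> A" for a
    proof -
      obtain u v where uv: "u \<in> V" "v \<in> V" "a \<otimes> u = \<sigma> a \<otimes> v" using cl[OF a] by blast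
      have "\<sigma> a \<in> (\<lambda>a. s \<otimes> a \<otimes> t) ` A" using bij a by (auto simp: bij_betw_def)
      then have G: "a \<in> carrier G" "\<sigma> a \<in> carrier G" "u \<in> carrier G" "v \<in> carrier G"
        using a A(3) s t uv VG by auto
      have "norm (f (a \<otimes> u \<otimes> \<one>) - f (a \<otimes> \<one>)) \<le> e/2" "norm (f (\<sigma> a \<otimes> v \<otimes> \<one>) - f (\<sigma> a \<otimes> \<one>)) \<le> e/2"
        using uv f G unfolding V_def by blast+
      then have "norm (f (a \<otimes> u) - f a) \<le> e/2" "norm (f (a \<otimes> u) - f (\<sigma> a)) \<le> e/2"
        using G uv by auto
      then show ?thesis
        using norm_triangle_ineq4[of "f (a \<otimes> u) - f a" "f (a \<otimes> u) - f (\<sigma> a)"] by simp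
    qed
    have inj: "inj_on (\<lambda>a. s \<otimes> a \<otimes> t) A"
      using A(3) s t by (intro inj_onI) (auto simp: subset_iff)
    have "(\<Sum>a\<in>A. f (s \<otimes> a \<otimes> t)) = (\<Sum>b\<in>(\<lambda>a. s \<otimes> a \<otimes> t) ` A. f b)"
      by (simp add: sum.reindex[OF inj])
    also have "\<dots> = (\<Sum>a\<in>A. f (\<sigma> a))"
      by (rule sum.reindex_bij_betw[OF bij, symmetric])
    finally have "avg A (\<lambda>a. f (s \<otimes> a \<otimes> t)) - avg A f = avg A (\<lambda>a. f (\<sigma> a) - f a)"
      by (simp add: avg_def sum_subtractf diff_divide_distrib)
    also have "norm \<dots> \<le> Re (avg A (\<lambda>a. of_real e))"
      by (rule norm_avg_le_Re) (use near in auto)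
    finally show "norm (avg A (\<lambda>a. f (s \<otimes> a \<otimes> t)) - avg A f) \<le> e"
      using A by (simp add: avg_const)
  qed
qed

text \<open>Approximation at all two-sided translates simultaneously builds invariance into the
  notion. It also gives uniqueness, since a set good for left translates can be played off against
  one good for right translates.\<close>

definition is_mean :: "('a \<Rightarrow> complex) \<Rightarrow> complex \<Rightarrow> bool" where
  "is_mean f c \<longleftrightarrow> (\<forall>e>0. \<exists>A. finite A \<and> A \<noteq> {} \<and> A \<subseteq> carrier G \<and>
     (\<forall>s\<in>carrier G. \<forall>t\<in>carrier G. norm (avg A (\<lambda>a. f (s \<otimes> a \<otimes> t)) - c) \<le> e))"

text \<open>The normalized Haar integral. The description is meaningful for those \<open>f\<close>
  that have a mean, in particular for continuous ones.\<close>

definition haar :: "('a \<Rightarrow> complex) \<Rightarrow> complex" where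
  "haar f = (THE c. is_mean f c)"

text \<open>The double average of \<open>f (a \<otimes> b)\<close> is within \<open>e\<close> of
  \<open>c\<close> when the inner average runs over \<open>A\<close>, and within \<open>e'\<close>
  of \<open>c'\<close> when it runs over \<open>B\<close>; the order of averaging does not change
  it.\<close>

lemma double_avg:
  assumes A: "finite A" "A \<noteq> {}" "A \<subseteq> carrier G" and B: "finite B" "B \<noteq> {}" "B \<subseteq> carrier G"
    and 1: "\<And>t. t \<in> carrier G \<Longrightarrow> norm (avg A (\<lambda>a. f (a \<otimes> t)) - c) \<le> e"
    and 2: "\<And>s. s \<in> carrier G \<Longrightarrow> norm (avg B (\<lambda>a. f (s \<otimes> a)) - c') \<le> e'"
  shows "norm (c - c') \<le> e + e'"
proof -
  let ?d = "avg A (\<lambda>a. avg B (\<lambda>b. f (a \<otimes> b)))"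
  have "norm (?d - c') \<le> e'"
    by (rule norm_avg_diff_le[OF A(1,2)]) (use A(3) 2 in auto)
  moreover have "norm (?d - c) \<le> e"
    unfolding avg_swap[of A B] by (rule norm_avg_diff_le[OF B(1,2)]) (use B(3) 1 in auto)
  ultimately show ?thesis
    using norm_triangle_ineq4[of "?d - c'" "?d - c"] by simp
qed

lemma is_mean_unique:
  assumes "is_mean f c" "is_mean f c'"
  shows "c = c'"
proof -
  have "norm (c - c') \<le> e" if e: "e > 0" for e
  proof -
    obtain A where A: "finite A" "A \<noteq> {}" "A \<subseteq> carrier G"
     "\<forall>s\<in>carrier G. \<forall>t\<in>carrier G. norm (avg A (\<lambda>a. f (s \<otimes> a \<otimes> t)) - c) \<le> e/2"
      using assms(1) e unfolding is_mean_def by (meson half_gt_zero)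
    obtain B where B: "finite B" "B \<noteq> {}" "B \<subseteq> carrier G"
     "\<forall>s\<in>carrier G. \<forall>t\<in>carrier G. norm (avg B (\<lambda>a. f (s \<otimes> a \<otimes> t)) - c') \<le> e/2"
      using assms(2) e unfolding is_mean_def by (meson half_gt_zero)
    have "norm (c - c') \<le> e/2 + e/2"
    proof (rule double_avg[OF A(1-3) B(1-3)])
      show "norm (avg A (\<lambda>a. f (a \<otimes> t)) - c) \<le> e/2" if "t \<in> carrier G" for t
      proof -
        have "avg A (\<lambda>a. f (a \<otimes> t)) = avg A (\<lambda>a. f (\<one> \<otimes> a \<otimes> t))"
          using A(3) by (intro avg_cong) auto
        then show ?thesis using A(4) that by auto
      qed
      show "norm (avg B (\<lambda>a. f (s \<otimes> a)) - c') \<le> e/2" if "s \<in> carrier G" for s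
      proof -
        have "avg B (\<lambda>a. f (s \<otimes> a)) = avg B (\<lambda>a. f (s \<otimes> a \<otimes> \<one>))"
          using B(3) that by (intro avg_cong) (auto simp: subset_iff)
        then show ?thesis using B(4) that by auto
      qed
    qed
    then show ?thesis by simp
  qed
  then show ?thesis by (metis dense_ge norm_le_zero_iff eq_iff_diff_eq_0)
qed

lemma haar_eqI: "is_mean f c \<Longrightarrow> haar f = c"
  unfolding haar_def using is_mean_unique by blast

text \<open>Sets that are invariant up to \<open>1 / (n + 1)\<close> have averages forming a Cauchy
  sequence, by \<open>double_avg\<close>; the limit inherits the translation bounds.\<close>

lemma is_mean_haar:
  assumes f: "cfunG f"
  shows "is_mean f (haar f)"
proof -
  have "\<exists>A. finite A \<and> A \<noteq> {} \<and> A \<subseteq> carrier G \<and>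
    (\<forall>s\<in>carrier G. \<forall>t\<in>carrier G. norm (avg A (\<lambda>a. f (s \<otimes> a \<otimes> t)) - avg A f) \<le> 1 / real (Suc n))" for n
  proof -
    have "1 / real (Suc n) > 0" by simp
    from equi_avg[OF equi_single[OF f] this] show ?thesis by (metis singletonI)
  qed
  then obtain A where A: "\<And>n. finite (A n)" "\<And>n. A n \<noteq> {}" "\<And>n. A n \<subseteq> carrier G"
    and st: "\<And>n s t. s \<in> carrier G \<Longrightarrow> t \<in> carrier G \<Longrightarrow>
       norm (avg (A n) (\<lambda>a. f (s \<otimes> a \<otimes> t)) - avg (A n) f) \<le> 1 / real (Suc n)" by metis
  have left: "norm (avg (A n) (\<lambda>a. f (s \<otimes> a)) - avg (A n) f) \<le> 1 / real (Suc n)" if "s \<in> carrier G" for n s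
  proof -
    have "avg (A n) (\<lambda>a. f (s \<otimes> a)) = avg (A n) (\<lambda>a. f (s \<otimes> a \<otimes> \<one>))"
      using A(3)[of n] that by (intro avg_cong) (auto simp: subset_iff)
    then show ?thesis using st[of s \<one> n] that by auto
  qed
  have right: "norm (avg (A n) (\<lambda>a. f (a \<otimes> t)) - avg (A n) f) \<le> 1 / real (Suc n)" if "t \<in> carrier G" for n t
  proof -
    have "avg (A n) (\<lambda>a. f (a \<otimes> t)) = avg (A n) (\<lambda>a. f (\<one> \<otimes> a \<otimes> t))"
      using A(3)[of n] that by (intro avg_cong) (auto simp: subset_iff)
    then show ?thesis using st[of \<one> t n] that by auto
  qed
  have d: "norm (avg (A m) f - avg (A n) f) \<le> 1 / real (Suc m) + 1 / real (Suc n)" for m n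
    by (rule double_avg[OF A A right left])
  have "Cauchy (\<lambda>n. avg (A n) f)"
    unfolding Cauchy_def
  proof (intro allI impI)
    fix e :: real assume e: "e > 0"
    obtain k where k: "1 / real (Suc k) < e/2" using e
      by (metis half_gt_zero nat_approx_posE)
    show "\<exists>M. \<forall>m\<ge>M. \<forall>n\<ge>M. dist (avg (A m) f) (avg (A n) f) < e"
    proof (intro exI[of _ k] allI impI)
      fix m n assume mn: "k \<le> m" "k \<le> n"
      have "1 / real (Suc m) \<le> 1 / real (Suc k)" "1 / real (Suc n) \<le> 1 / real (Suc k)"
        using mn by (auto intro!: divide_left_mono)
      then show "dist (avg (A m) f) (avg (A n) f) < e"
        using d[of m n] k by (simp add: dist_norm)
    qed
  qed
  then obtain c where c: "(\<lambda>n. avg (A n) f) \<longlonglongrightarrow> c"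
    using Cauchy_convergent convergent_def by blast
  have "is_mean f c"
    unfolding is_mean_def
  proof (intro allI impI)
    fix e :: real assume e: "e > 0"
    obtain M where M: "\<And>n. n \<ge> M \<Longrightarrow> norm (avg (A n) f - c) < e/2"
      using c e unfolding LIMSEQ_iff by (meson half_gt_zero)
    obtain k where k: "1 / real (Suc k) < e/2" using e
      by (metis half_gt_zero nat_approx_posE)
    define n where "n = max M k"
    have n: "norm (avg (A n) f - c) < e/2" using M n_def by simp
    have "1 / real (Suc n) \<le> 1 / real (Suc k)" by (auto intro!: divide_left_mono simp: n_def)
    then have n': "1 / real (Suc n) < e/2" using k by linarith
    have "norm (avg (A n) (\<lambda>a. f (s \<otimes> a \<otimes> t)) - c) \<le> e" if "s \<in> carrier G" "t \<in> carrier G" for s t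
      using st[OF that, of n] n n'
        norm_triangle_ineq[of "avg (A n) (\<lambda>a. f (s \<otimes> a \<otimes> t)) - avg (A n) f" "avg (A n) f - c"] by simp
    then show "\<exists>A. finite A \<and> A \<noteq> {} \<and> A \<subseteq> carrier G \<and>
     (\<forall>s\<in>carrier G. \<forall>t\<in>carrier G. norm (avg A (\<lambda>a. f (s \<otimes> a \<otimes> t)) - c) \<le> e)"
      using A(1)[of n] A(2)[of n] A(3)[of n] by (intro exI[of _ "A n"] conjI ballI)
  qed
  then show ?thesis using haar_eqI by simp
qed

text \<open>One finite set for the whole family is what transfers continuity in a parameter, and the
  interchange of two means, from finite averages to \<open>haar\<close>.\<close>

lemma haar_approx:
  assumes F: "equi \<F>" "\<And>f. f \<in> \<F> \<Longrightarrow> cfunG f" and e: "e > 0"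
  obtains A where "finite A" "A \<noteq> {}" "A \<subseteq> carrier G" "\<And>f. f \<in> \<F> \<Longrightarrow> norm (avg A f - haar f) \<le> e"
proof -
  obtain A where A: "finite A" "A \<noteq> {}" "A \<subseteq> carrier G"
    "\<And>f s t. f \<in> \<F> \<Longrightarrow> s \<in> carrier G \<Longrightarrow> t \<in> carrier G \<Longrightarrow>
       norm (avg A (\<lambda>a. f (s \<otimes> a \<otimes> t)) - avg A f) \<le> e/2"
    using equi_avg[OF F(1), of "e/2"] e by (metis half_gt_zero)
  have "norm (avg A f - haar f) \<le> e" if f: "f \<in> \<F>" for f
  proof -
    obtain B where B: "finite B" "B \<noteq> {}" "B \<subseteq> carrier G"
     "\<forall>s\<in>carrier G. \<forall>t\<in>carrier G. norm (avg B (\<lambda>a. f (s \<otimes> a \<otimes> t)) - haar f) \<le> e/2"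
      using is_mean_haar[OF F(2)[OF f]] e unfolding is_mean_def by (meson half_gt_zero)
    have "norm (avg A f - haar f) \<le> e/2 + e/2"
    proof (rule double_avg[OF A(1-3) B(1-3)])
      show "norm (avg A (\<lambda>a. f (a \<otimes> t)) - avg A f) \<le> e/2" if "t \<in> carrier G" for t
      proof -
        have "avg A (\<lambda>a. f (a \<otimes> t)) = avg A (\<lambda>a. f (\<one> \<otimes> a \<otimes> t))"
          using A(3) by (intro avg_cong) auto
        then show ?thesis using A(4)[OF f one_closed that] by auto
      qed
      show "norm (avg B (\<lambda>a. f (s \<otimes> a)) - haar f) \<le> e/2" if "s \<in> carrier G" for s
      proof -
        have "avg B (\<lambda>a. f (s \<otimes> a)) = avg B (\<lambda>a. f (s \<otimes> a \<otimes> \<one>))"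
          using B(3) that by (intro avg_cong) (auto simp: subset_iff)
        then show ?thesis using B(4) that by auto
      qed
    qed
    then show ?thesis by simp
  qed
  then show ?thesis using that A by blast
qed

end

lemma continuous_map_cmult [continuous_intros]:
  fixes f g :: "'z \<Rightarrow> complex"
  shows "continuous_map Z euclidean f \<Longrightarrow> continuous_map Z euclidean g \<Longrightarrow> continuous_map Z euclidean (\<lambda>z. f z * g z)"
  by (simp add: continuous_map_atin tendsto_mult)

lemma continuous_map_cnj [continuous_intros]:
  "continuous_map Z euclidean f \<Longrightarrow> continuous_map Z euclidean (\<lambda>z. cnj (f z))"
  by (simp add: continuous_map_atin tendsto_cnj)

lemma continuous_map_of_real [continuous_intros]:
  "continuous_map Z euclidean f \<Longrightarrow> continuous_map Z euclidean (\<lambda>z. complex_of_real (f z))"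
  by (simp add: continuous_map_atin tendsto_of_real)

lemma continuous_map_Re [continuous_intros]:
  "continuous_map Z euclidean f \<Longrightarrow> continuous_map Z euclidean (\<lambda>z. Re (f z))"
  by (simp add: continuous_map_atin tendsto_Re)

lemma continuous_map_uniform:
  fixes f :: "'z \<Rightarrow> complex"
  assumes "\<And>e. e > 0 \<Longrightarrow> \<exists>g. continuous_map Z euclidean g \<and> (\<forall>z\<in>topspace Z. norm (g z - f z) \<le> e)"
  shows "continuous_map Z euclidean f"
proof -
  have "\<exists>g. continuous_map Z euclidean g \<and> (\<forall>z\<in>topspace Z. norm (g z - f z) \<le> 1 / real (Suc n))" for n
    by (rule assms) simp
  then obtain g where g: "\<And>n. continuous_map Z euclidean (g n)"
    "\<And>n z. z \<in> topspace Z \<Longrightarrow> norm (g n z - f z) \<le> 1 / real (Suc n)" by metis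
  have "continuous_map Z Met_TC.mtopology f"
  proof (rule Met_TC.continuous_map_uniform_limit[where F = sequentially and f = g])
    show "\<forall>\<^sub>F n in sequentially. continuous_map Z Met_TC.mtopology (g n)"
      using g(1) by simp
    fix e :: real assume "e > 0"
    then obtain k where k: "1 / real (Suc k) < e" using nat_approx_posE by blast
    have "dist (g n z) (f z) < e" if "n \<ge> k" "z \<in> topspace Z" for n z
    proof -
      have "1 / real (Suc n) \<le> 1 / real (Suc k)" using that by (auto intro!: divide_left_mono)
      then show ?thesis using g(2)[OF that(2), of n] k by (simp add: dist_norm)
    qed
    then show "\<forall>\<^sub>F n in sequentially. \<forall>z\<in>topspace Z. f z \<in> UNIV \<and> dist (g n z) (f z) < e"
      unfolding eventually_sequentially by blast
  qed simp
  then show ?thesis by simp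
qed

lemma norm_le_all_imp_eq:
  fixes x y :: complex
  assumes "\<And>e. e > 0 \<Longrightarrow> norm (x - y) \<le> e"
  shows "x = y"
proof -
  have "norm (x - y) \<le> 0" using assms by (rule dense_ge)
  then show ?thesis by simp
qed

section \<open>Calculus of the mean: linearity, invariance, interchange, positivity\<close>

context compact_group
begin

lemma cfunG_left: "cfunG f \<Longrightarrow> s \<in> carrier G \<Longrightarrow> cfunG (\<lambda>t. f (s \<otimes> t))"
  using continuous_map_compose[of T T "\<lambda>t. s \<otimes> t" euclidean f] continuous_mult'[of T "\<lambda>_. s" "\<lambda>t. t"]
  by (simp add: o_def topspace_eq)

lemma cfunG_inv: "cfunG f \<Longrightarrow> cfunG (\<lambda>t. f (inv t))"
  using continuous_map_compose[OF continuous_inv] by (simp add: o_def)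

lemma haar_approx_finite:
  assumes "finite \<F>" "\<And>f. f \<in> \<F> \<Longrightarrow> cfunG f" "e > 0"
  obtains A where "finite A" "A \<noteq> {}" "A \<subseteq> carrier G" "\<And>f. f \<in> \<F> \<Longrightarrow> norm (avg A f - haar f) \<le> e"
  using haar_approx[OF equi_finite[OF assms(1,2)] assms(2,3)] that by blast

lemma haar_cong:
  assumes "\<And>t. t \<in> carrier G \<Longrightarrow> f t = g t"
  shows "haar f = haar g"
proof -
  have *: "avg A (\<lambda>a. f (s \<otimes> a \<otimes> t)) = avg A (\<lambda>a. g (s \<otimes> a \<otimes> t))"
    if "A \<subseteq> carrier G" "s \<in> carrier G" "t \<in> carrier G" for A s t
    using that assms by (intro avg_cong) auto
  have "is_mean f = is_mean g"
    by (simp add: is_mean_def fun_eq_iff * cong: conj_cong)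
  then show ?thesis by (simp add: haar_def)
qed

lemma haar_add:
  assumes f: "cfunG f" and g: "cfunG g"
  shows "haar (\<lambda>t. f t + g t) = haar f + haar g"
proof (rule norm_le_all_imp_eq)
  fix e :: real assume e: "e > 0"
  let ?h = "\<lambda>t. f t + g t"
  have h: "cfunG ?h" using f g by (intro continuous_intros)
  obtain A where A: "finite A" "A \<noteq> {}" "A \<subseteq> carrier G"
    "\<And>k. k \<in> {f, g, ?h} \<Longrightarrow> norm (avg A k - haar k) \<le> e/3"
    by (rule haar_approx_finite[of "{f, g, ?h}" "e/3"]) (use f g h e in auto)
  have "haar ?h - (haar f + haar g) = - (avg A ?h - haar ?h) + ((avg A f - haar f) + (avg A g - haar g))"
    by (simp add: avg_add)
  also have "norm \<dots> \<le> norm (avg A ?h - haar ?h) + (norm (avg A f - haar f) + norm (avg A g - haar g))"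
    using norm_triangle_ineq[of "- (avg A ?h - haar ?h)" "(avg A f - haar f) + (avg A g - haar g)"]
      norm_triangle_ineq[of "avg A f - haar f" "avg A g - haar g"]
    unfolding norm_minus_cancel by linarith
  also have "\<dots> \<le> e/3 + (e/3 + e/3)"
    by (intro add_mono A(4)) auto
  finally show "norm (haar ?h - (haar f + haar g)) \<le> e" by simp
qed

lemma haar_cmult:
  assumes f: "cfunG f"
  shows "haar (\<lambda>t. c * f t) = c * haar f"
proof (rule haar_eqI, unfold is_mean_def, intro allI impI)
  fix e :: real assume e: "e > 0"
  then have "e / (norm c + 1) > 0" by (simp add: add_nonneg_pos)
  then obtain A where A: "finite A" "A \<noteq> {}" "A \<subseteq> carrier G"
    "\<And>s t. s \<in> carrier G \<Longrightarrow> t \<in> carrier G \<Longrightarrow> norm (avg A (\<lambda>a. f (s \<otimes> a \<otimes> t)) - haar f) \<le> e / (norm c + 1)"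
    using is_mean_haar[OF f] unfolding is_mean_def by meson
  have "norm (avg A (\<lambda>a. c * f (s \<otimes> a \<otimes> t)) - c * haar f) \<le> e"
    if "s \<in> carrier G" "t \<in> carrier G" for s t
  proof -
    have "norm (avg A (\<lambda>a. c * f (s \<otimes> a \<otimes> t)) - c * haar f) = norm c * norm (avg A (\<lambda>a. f (s \<otimes> a \<otimes> t)) - haar f)"
      by (simp add: avg_cmult flip: norm_mult right_diff_distrib)
    also have "\<dots> \<le> norm c * (e / (norm c + 1))"
      using A(4)[OF that] by (intro mult_left_mono) auto
    also have "\<dots> \<le> e"
    proof -
      have "norm c / (norm c + 1) \<le> 1" by (simp add: divide_le_eq_1 add_nonneg_pos)
      then have "e * (norm c / (norm c + 1)) \<le> e" using e by (simp only: mult_left_le)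
      then show ?thesis by (simp add: mult.commute)
    qed
    finally show ?thesis .
  qed
  then show "\<exists>A. finite A \<and> A \<noteq> {} \<and> A \<subseteq> carrier G \<and>
     (\<forall>s\<in>carrier G. \<forall>t\<in>carrier G. norm (avg A (\<lambda>a. c * f (s \<otimes> a \<otimes> t)) - c * haar f) \<le> e)"
    using A(1,2,3) by (intro exI[of _ A] conjI ballI)
qed

lemma haar_mult_right: "cfunG f \<Longrightarrow> haar (\<lambda>t. f t * c) = haar f * c"
  using haar_cmult[of f c] by (simp add: mult.commute)

lemma haar_minus: "cfunG f \<Longrightarrow> haar (\<lambda>t. - f t) = - haar f"
  using haar_cmult[of f "-1"] by simp

lemma haar_diff: "cfunG f \<Longrightarrow> cfunG g \<Longrightarrow> haar (\<lambda>t. f t - g t) = haar f - haar g"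
  using haar_add[of f "\<lambda>t. - g t"] haar_minus[of g] by (simp add: continuous_map_minus)

lemma haar_const: "haar (\<lambda>t. c) = c"
proof (rule haar_eqI, unfold is_mean_def, intro allI impI)
  fix e :: real assume "e > 0"
  then show "\<exists>A. finite A \<and> A \<noteq> {} \<and> A \<subseteq> carrier G \<and>
     (\<forall>s\<in>carrier G. \<forall>t\<in>carrier G. norm (avg A (\<lambda>a. c) - c) \<le> e)"
    by (intro exI[of _ "{\<one>}"]) (auto simp: avg_def)
qed

lemma haar_sum:
  "finite I \<Longrightarrow> (\<And>i. i \<in> I \<Longrightarrow> cfunG (f i)) \<Longrightarrow> haar (\<lambda>t. \<Sum>i\<in>I. f i t) = (\<Sum>i\<in>I. haar (f i))"
proof (induction I rule: finite_induct)
  case empty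
  then show ?case by (simp add: haar_const)
next
  case (insert i I)
  have "cfunG (\<lambda>t. \<Sum>i\<in>I. f i t)" using insert by (intro continuous_map_sum) auto
  then show ?case using insert by (simp add: haar_add)
qed

lemma haar_norm_le:
  assumes f: "cfunG f" and g: "cfunG g" and le: "\<And>t. t \<in> carrier G \<Longrightarrow> norm (f t) \<le> Re (g t)"
  shows "norm (haar f) \<le> Re (haar g)"
proof (rule field_le_epsilon)
  fix e :: real assume e: "e > 0"
  obtain A where A: "finite A" "A \<noteq> {}" "A \<subseteq> carrier G"
    "\<And>k. k \<in> {f, g} \<Longrightarrow> norm (avg A k - haar k) \<le> e/2"
    by (rule haar_approx_finite[of "{f, g}" "e/2"]) (use f g e in auto)
  have "norm (avg A f) \<le> Re (avg A g)"
    using A(3) le by (intro norm_avg_le_Re) auto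
  moreover have "norm (haar f) \<le> norm (avg A f) + e/2"
    using norm_triangle_sub[of "haar f" "avg A f"] A(4)[of f] by (simp add: norm_minus_commute)
  moreover have "Re (avg A g) \<le> Re (haar g) + e/2"
    using abs_Re_le_cmod[of "avg A g - haar g"] A(4)[of g] by simp
  ultimately show "norm (haar f) \<le> Re (haar g) + e" by linarith
qed

lemma haar_cnj:
  assumes f: "cfunG f"
  shows "haar (\<lambda>t. cnj (f t)) = cnj (haar f)"
proof (rule haar_eqI, unfold is_mean_def, intro allI impI)
  fix e :: real assume "e > 0"
  then obtain A where A: "finite A" "A \<noteq> {}" "A \<subseteq> carrier G"
    "\<And>s t. s \<in> carrier G \<Longrightarrow> t \<in> carrier G \<Longrightarrow> norm (avg A (\<lambda>a. f (s \<otimes> a \<otimes> t)) - haar f) \<le> e"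
    using is_mean_haar[OF f] unfolding is_mean_def by meson
  have "norm (avg A (\<lambda>a. cnj (f (s \<otimes> a \<otimes> t))) - cnj (haar f)) \<le> e"
    if "s \<in> carrier G" "t \<in> carrier G" for s t
    using A(4)[OF that] by (metis avg_cnj complex_cnj_diff complex_mod_cnj)
  then show "\<exists>A. finite A \<and> A \<noteq> {} \<and> A \<subseteq> carrier G \<and>
     (\<forall>s\<in>carrier G. \<forall>t\<in>carrier G. norm (avg A (\<lambda>a. cnj (f (s \<otimes> a \<otimes> t))) - cnj (haar f)) \<le> e)"
    using A(1,2,3) by (intro exI[of _ A] conjI ballI)
qed

lemma haar_left:
  assumes f: "cfunG f" and r: "r \<in> carrier G"
  shows "haar (\<lambda>t. f (r \<otimes> t)) = haar f"
proof (rule haar_eqI, unfold is_mean_def, intro allI impI)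
  fix e :: real assume "e > 0"
  then obtain A where A: "finite A" "A \<noteq> {}" "A \<subseteq> carrier G"
    "\<And>s t. s \<in> carrier G \<Longrightarrow> t \<in> carrier G \<Longrightarrow> norm (avg A (\<lambda>a. f (s \<otimes> a \<otimes> t)) - haar f) \<le> e"
    using is_mean_haar[OF f] unfolding is_mean_def by meson
  have "norm (avg A (\<lambda>a. f (r \<otimes> (s \<otimes> a \<otimes> t))) - haar f) \<le> e"
    if "s \<in> carrier G" "t \<in> carrier G" for s t
  proof -
    have "avg A (\<lambda>a. f (r \<otimes> (s \<otimes> a \<otimes> t))) = avg A (\<lambda>a. f ((r \<otimes> s) \<otimes> a \<otimes> t))"
      using A(3) that r by (intro avg_cong) (auto simp: m_assoc subset_iff)
    then show ?thesis using A(4)[of "r \<otimes> s" t] that r by simp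
  qed
  then show "\<exists>A. finite A \<and> A \<noteq> {} \<and> A \<subseteq> carrier G \<and>
     (\<forall>s\<in>carrier G. \<forall>t\<in>carrier G. norm (avg A (\<lambda>a. f (r \<otimes> (s \<otimes> a \<otimes> t))) - haar f) \<le> e)"
    using A(1,2,3) by (intro exI[of _ A] conjI ballI)
qed

lemma haar_right:
  assumes f: "cfunG f" and r: "r \<in> carrier G"
  shows "haar (\<lambda>t. f (t \<otimes> r)) = haar f"
proof (rule haar_eqI, unfold is_mean_def, intro allI impI)
  fix e :: real assume "e > 0"
  then obtain A where A: "finite A" "A \<noteq> {}" "A \<subseteq> carrier G"
    "\<And>s t. s \<in> carrier G \<Longrightarrow> t \<in> carrier G \<Longrightarrow> norm (avg A (\<lambda>a. f (s \<otimes> a \<otimes> t)) - haar f) \<le> e"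
    using is_mean_haar[OF f] unfolding is_mean_def by meson
  have "norm (avg A (\<lambda>a. f (s \<otimes> a \<otimes> t \<otimes> r)) - haar f) \<le> e"
    if "s \<in> carrier G" "t \<in> carrier G" for s t
  proof -
    have "avg A (\<lambda>a. f (s \<otimes> a \<otimes> t \<otimes> r)) = avg A (\<lambda>a. f (s \<otimes> a \<otimes> (t \<otimes> r)))"
      using A(3) that r by (intro avg_cong) (auto simp: m_assoc subset_iff)
    then show ?thesis using A(4)[of s "t \<otimes> r"] that r by simp
  qed
  then show "\<exists>A. finite A \<and> A \<noteq> {} \<and> A \<subseteq> carrier G \<and>
     (\<forall>s\<in>carrier G. \<forall>t\<in>carrier G. norm (avg A (\<lambda>a. f (s \<otimes> a \<otimes> t \<otimes> r)) - haar f) \<le> e)"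
    using A(1,2,3) by (intro exI[of _ A] conjI ballI)
qed

lemma haar_inv:
  assumes f: "cfunG f"
  shows "haar (\<lambda>t. f (inv t)) = haar f"
proof (rule haar_eqI, unfold is_mean_def, intro allI impI)
  fix e :: real assume "e > 0"
  then obtain A where A: "finite A" "A \<noteq> {}" "A \<subseteq> carrier G"
    "\<And>s t. s \<in> carrier G \<Longrightarrow> t \<in> carrier G \<Longrightarrow> norm (avg A (\<lambda>a. f (s \<otimes> a \<otimes> t)) - haar f) \<le> e"
    using is_mean_haar[OF f] unfolding is_mean_def by meson
  define B where "B = (\<lambda>a. inv a) ` A"
  have inj: "inj_on (\<lambda>a. inv a) A"
    using A(3) by (intro inj_onI) (metis inv_inv subsetD)
  have "norm (avg B (\<lambda>a. f (inv (s \<otimes> a \<otimes> t))) - haar f) \<le> e"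
    if "s \<in> carrier G" "t \<in> carrier G" for s t
  proof -
    have "avg B (\<lambda>a. f (inv (s \<otimes> a \<otimes> t))) = avg A (\<lambda>a. f (inv (s \<otimes> inv a \<otimes> t)))"
      using inj by (simp add: avg_def B_def sum.reindex card_image)
    also have "\<dots> = avg A (\<lambda>a. f (inv t \<otimes> a \<otimes> inv s))"
      using A(3) that by (intro avg_cong) (auto simp: inv_mult_group m_assoc subset_iff)
    finally show ?thesis using A(4)[of "inv t" "inv s"] that by simp
  qed
  moreover have "finite B" "B \<noteq> {}" "B \<subseteq> carrier G" using A by (auto simp: B_def)
  ultimately show "\<exists>A. finite A \<and> A \<noteq> {} \<and> A \<subseteq> carrier G \<and>
     (\<forall>s\<in>carrier G. \<forall>t\<in>carrier G. norm (avg A (\<lambda>a. f (inv (s \<otimes> a \<otimes> t))) - haar f) \<le> e)"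
    by (intro exI[of _ B] conjI ballI)
qed

lemma cfunG_slice:
  "continuous_map (prod_topology Z T) euclidean (\<lambda>(z, t). H z t) \<Longrightarrow> z \<in> topspace Z \<Longrightarrow> cfunG (H z)"
  using continuous_map_compose[of T "prod_topology Z T" "\<lambda>t. (z, t)" euclidean "\<lambda>(z, t). H z t"]
  by (simp add: o_def continuous_map_pairedI)

lemma continuous_slice:
  "continuous_map (prod_topology Z T) euclidean (\<lambda>(z, t). H z t) \<Longrightarrow> t \<in> carrier G \<Longrightarrow> continuous_map Z euclidean (\<lambda>z. H z t)"
  using continuous_map_compose[of Z "prod_topology Z T" "\<lambda>z. (z, t)" euclidean "\<lambda>(z, t). H z t"]
  by (simp add: o_def continuous_map_pairedI topspace_eq)

lemma continuous_avg:
  "A \<subseteq> carrier G \<Longrightarrow> finite A \<Longrightarrow> (\<And>a. a \<in> A \<Longrightarrow> continuous_map Z euclidean (\<lambda>z. H z a)) \<Longrightarrow>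
   continuous_map Z euclidean (\<lambda>z. avg A (H z))"
  unfolding avg_def divide_inverse
  by (intro continuous_map_cmult continuous_map_sum continuous_map_canonical_const) auto

lemma haar_continuous:
  assumes Z: "compact_space Z" and H: "continuous_map (prod_topology Z T) euclidean (\<lambda>(z, t). H z t)"
  shows "continuous_map Z euclidean (\<lambda>z. haar (H z))"
proof (rule continuous_map_uniform)
  fix e :: real assume e: "e > 0"
  obtain A where A: "finite A" "A \<noteq> {}" "A \<subseteq> carrier G"
    "\<And>f. f \<in> H ` topspace Z \<Longrightarrow> norm (avg A f - haar f) \<le> e"
    by (rule haar_approx[OF equi_param[OF Z H] _ e]) (use cfunG_slice[OF H] in auto)
  have "continuous_map Z euclidean (\<lambda>z. avg A (H z))"
  proof (rule continuous_avg[OF A(3,1)])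
    fix a assume "a \<in> A"
    with A(3) have "a \<in> carrier G" by blast
    then show "continuous_map Z euclidean (\<lambda>z. H z a)" by (rule continuous_slice[OF H])
  qed
  moreover have "\<forall>z\<in>topspace Z. norm (avg A (H z) - haar (H z)) \<le> e"
    using A(4) by blast
  ultimately show "\<exists>g. continuous_map Z euclidean g \<and> (\<forall>z\<in>topspace Z. norm (g z - haar (H z)) \<le> e)"
    by (intro exI[of _ "\<lambda>z. avg A (H z)"] conjI)
qed

lemma continuous_swap:
  "continuous_map (prod_topology Z Y) W (\<lambda>(z, t). H z t) \<Longrightarrow> continuous_map (prod_topology Y Z) W (\<lambda>(t, z). H z t)"
  using continuous_map_compose[of "prod_topology Y Z" "prod_topology Z Y" "\<lambda>w. (snd w, fst w)" W "\<lambda>(z, t). H z t"]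
  by (simp add: o_def continuous_map_pairedI continuous_map_fst continuous_map_snd case_prod_unfold)

text \<open>The same finite set \<open>A\<close> approximates the inner means
  \<open>haar (H s)\<close> for all \<open>s\<close> and the outer mean of the other iterated
  integral. With a finite average inside, the interchange is mere linearity.\<close>

lemma haar_fubini:
  assumes H: "continuous_map (prod_topology T T) euclidean (\<lambda>(s, t). H s t)"
  shows "haar (\<lambda>s. haar (\<lambda>t. H s t)) = haar (\<lambda>t. haar (\<lambda>s. H s t))"
proof (rule norm_le_all_imp_eq)
  fix e :: real assume e: "e > 0"
  let ?k = "\<lambda>t. haar (\<lambda>s. H s t)"
  have c1: "cfunG ?k" by (rule haar_continuous[OF compact_T continuous_swap[OF H]])
  have c2: "cfunG (\<lambda>s. haar (H s))" by (rule haar_continuous[OF compact_T H])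
  have eq: "equi (H ` topspace T \<union> {?k})"
    using equi_Un[OF equi_param[OF compact_T H] equi_single[OF c1]] .
  obtain A where A: "finite A" "A \<noteq> {}" "A \<subseteq> carrier G"
    "\<And>f. f \<in> H ` topspace T \<union> {?k} \<Longrightarrow> norm (avg A f - haar f) \<le> e/2"
    by (rule haar_approx[OF eq, of "e/2"]) (use e c1 cfunG_slice[OF H] in auto)
  have ca: "cfunG (\<lambda>s. H s a)" if "a \<in> A" for a using continuous_slice[OF H] A(3) that by auto
  have cA: "cfunG (\<lambda>s. avg A (H s))"
    using A ca by (intro continuous_avg) auto
  have "haar (\<lambda>s. avg A (H s)) = avg A ?k"
    unfolding avg_def divide_inverse using ca A(1)
    by (subst haar_mult_right) (auto simp: haar_sum intro!: continuous_map_sum)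
  moreover have "norm (haar (\<lambda>s. avg A (H s) - haar (H s))) \<le> Re (haar (\<lambda>t. of_real (e/2)))"
    using A(4) by (intro haar_norm_le continuous_intros cA c2) (auto simp: topspace_eq)
  ultimately have "norm (avg A ?k - haar (\<lambda>s. haar (H s))) \<le> e/2"
    by (simp add: haar_diff[OF cA c2] haar_const)
  moreover have "norm (avg A ?k - haar ?k) \<le> e/2" using A(4) by auto
  ultimately show "norm (haar (\<lambda>s. haar (H s)) - haar ?k) \<le> e"
    using norm_triangle_ineq4[of "avg A ?k - haar ?k" "avg A ?k - haar (\<lambda>s. haar (H s))"] by simp
qed

text \<open>By compactness the sum of finitely many left translates of \<open>f\<close> has real
  part at least \<open>c > 0\<close> everywhere, and all these translates share the mean of
  \<open>f\<close>.\<close>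

lemma haar_pos:
  assumes f: "cfunG f" and nonneg: "\<And>t. t \<in> carrier G \<Longrightarrow> 0 \<le> Re (f t)"
    and t0: "t0 \<in> carrier G" "Re (f t0) > 0"
  shows "Re (haar f) > 0"
proof -
  define c where "c = Re (f t0) / 2"
  have c: "c > 0" using t0 by (simp add: c_def)
  define W where "W a = {x \<in> topspace T. Re (f (a \<otimes> x)) \<in> {c<..}}" for a
  have "openin T (W a)" if "a \<in> carrier G" for a
    unfolding W_def
    by (rule openin_continuous_map_preimage[OF continuous_map_Re[OF cfunG_left[OF f that]]]) simp
  moreover have "topspace T \<subseteq> \<Union>(W ` carrier G)"
  proof
    fix x assume x: "x \<in> topspace T"
    have "(t0 \<otimes> inv x) \<otimes> x = t0" using x t0 by (simp add: topspace_eq m_assoc)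
    then have "x \<in> W (t0 \<otimes> inv x)" using t0 c x by (auto simp: W_def c_def)
    then show "x \<in> \<Union>(W ` carrier G)" using x t0 by (auto simp: topspace_eq)
  qed
  ultimately obtain \<U> where U: "finite \<U>" "\<U> \<subseteq> W ` carrier G" "topspace T \<subseteq> \<Union>\<U>"
    using compactinD[of T "topspace T" "W ` carrier G"] compact_T unfolding compact_space_def by auto
  then obtain A where A: "A \<subseteq> carrier G" "finite A" "\<U> = W ` A"
    by (meson finite_subset_image)
  have cA: "cfunG (\<lambda>t. f (a \<otimes> t))" if "a \<in> A" for a using cfunG_left[OF f] A(1) that by auto
  define g where "g t = (\<Sum>a\<in>A. f (a \<otimes> t))" for t
  have cg: "cfunG g" unfolding g_def using A cA by (intro continuous_map_sum) auto
  have gc: "c \<le> Re (g t)" if t: "t \<in> carrier G" for t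
  proof -
    obtain a where a: "a \<in> A" "t \<in> W a" using U(3) A(3) t topspace_eq by blast
    have "c \<le> Re (f (a \<otimes> t))" using a by (simp add: W_def)
    also have "\<dots> \<le> (\<Sum>a\<in>A. Re (f (a \<otimes> t)))"
      by (rule member_le_sum) (use a A t nonneg in auto)
    finally show ?thesis by (simp add: g_def)
  qed
  have "norm (haar (\<lambda>t. of_real c)) \<le> Re (haar g)"
    using gc c by (intro haar_norm_le cg continuous_intros) auto
  moreover have "haar g = of_nat (card A) * haar f"
    unfolding g_def using A cA by (subst haar_sum) (auto simp: haar_left[OF f] subset_iff)
  ultimately have "c \<le> real (card A) * Re (haar f)" using c by (simp add: haar_const)
  then show ?thesis using c by (meson less_le_trans of_nat_0_le_iff zero_less_mult_pos mult_nonneg_nonpos not_less)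
qed

end

section \<open>Continuous actions, translation of functions and convolution\<close>

locale compact_action = compact_group G T for G (structure) and T :: "'a topology" +
  fixes TX :: "'x topology" and act :: "'a \<Rightarrow> 'x \<Rightarrow> 'x"
  assumes compact_TX: "compact_space TX" and hausdorff_TX: "Hausdorff_space TX"
    and act_closed [simp]: "s \<in> carrier G \<Longrightarrow> x \<in> topspace TX \<Longrightarrow> act s x \<in> topspace TX"
    and act_one [simp]: "x \<in> topspace TX \<Longrightarrow> act \<one> x = x"
    and act_mult: "s \<in> carrier G \<Longrightarrow> t \<in> carrier G \<Longrightarrow> x \<in> topspace TX \<Longrightarrow> act (s \<otimes> t) x = act s (act t x)"
    and act_cont: "continuous_map (prod_topology T TX) TX (\<lambda>(s, x). act s x)"
begin

abbreviation trans :: "'a \<Rightarrow> ('x \<Rightarrow> complex) \<Rightarrow> 'x \<Rightarrow> complex" where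
  "trans \<equiv> translate G TX act"

text \<open>The mean of the translates of \<open>F\<close> weighted by \<open>w\<close>; for the
  group acting on itself this is the usual convolution.\<close>

definition conv :: "('a \<Rightarrow> complex) \<Rightarrow> ('x \<Rightarrow> complex) \<Rightarrow> 'x \<Rightarrow> complex" where
  "conv w F y = (if y \<in> topspace TX then haar (\<lambda>r. w r * F (act (inv r) y)) else 0)"

lemma act_cont':
  "continuous_map Z T f \<Longrightarrow> continuous_map Z TX g \<Longrightarrow> continuous_map Z TX (\<lambda>z. act (f z) (g z))"
  using continuous_map_compose[OF _ act_cont, of Z "\<lambda>z. (f z, g z)"]
  by (simp add: o_def continuous_map_pairedI)

lemma act_inv_cancel [simp]:
  "s \<in> carrier G \<Longrightarrow> x \<in> topspace TX \<Longrightarrow> act (inv s) (act s x) = x"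
  "s \<in> carrier G \<Longrightarrow> x \<in> topspace TX \<Longrightarrow> act s (act (inv s) x) = x"
  by (simp_all flip: act_mult)

lemma cfun_cont: "F \<in> cfun TX \<Longrightarrow> continuous_map TX euclidean F"
  by (simp add: cfun_def)

lemma cfun_zero: "F \<in> cfun TX \<Longrightarrow> x \<notin> topspace TX \<Longrightarrow> F x = 0"
  by (simp add: cfun_def)

lemma cfun_act_cont:
  "F \<in> cfun TX \<Longrightarrow> continuous_map Z T f \<Longrightarrow> continuous_map Z TX g \<Longrightarrow>
    continuous_map Z euclidean (\<lambda>z. F (act (f z) (g z)))"
  using continuous_map_compose[OF act_cont' cfun_cont] by (simp add: o_def)

lemma trans_apply: "x \<in> topspace TX \<Longrightarrow> trans s f x = f (act (inv s) x)"
  by (simp add: translate_def)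

lemma trans_cfun: "s \<in> carrier G \<Longrightarrow> f \<in> cfun TX \<Longrightarrow> trans s f \<in> cfun TX"
proof -
  assume s: "s \<in> carrier G" and f: "f \<in> cfun TX"
  have "continuous_map TX euclidean (\<lambda>x. f (act (inv s) x))"
    by (rule cfun_act_cont[OF f]) (use s topspace_eq in auto)
  then have "continuous_map TX euclidean (trans s f)"
    by (rule continuous_map_eq) (simp add: trans_apply)
  then show ?thesis by (simp add: cfun_def translate_def)
qed

lemma trans_mult:
  "s \<in> carrier G \<Longrightarrow> t \<in> carrier G \<Longrightarrow> trans s (trans t f) = trans (s \<otimes> t) f"
  by (auto simp: translate_def fun_eq_iff inv_mult_group act_mult)

lemma trans_one: "f \<in> cfun TX \<Longrightarrow> trans \<one> f = f"
  by (auto simp: translate_def fun_eq_iff cfun_zero)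

lemma trans_add: "trans s (f + g) = trans s f + trans s g"
  by (auto simp: translate_def fun_eq_iff)

lemma trans_fscale: "trans s (fscale c f) = fscale c (trans s f)"
  by (auto simp: translate_def fun_eq_iff fscale_def)

lemma trans_sum: "trans s (\<Sum>i\<in>I. f i) = (\<Sum>i\<in>I. trans s (f i))"
proof (induction I rule: infinite_finite_induct)
  case (insert i I)
  then show ?case unfolding sum.insert[OF insert(1,2)] trans_add by simp
qed (auto simp: translate_def fun_eq_iff)

lemma subspace_cfun: "fun_space.subspace (cfun TX)"
  unfolding fun_space.subspace_def cfun_def fscale_def
  by (auto simp: plus_fun_def zero_fun_def intro!: continuous_intros)

lemma conv_cont_aux:
  assumes w: "cfunG w" and F: "F \<in> cfun TX"
  shows "continuous_map (prod_topology TX T) euclidean (\<lambda>(y, r). w r * F (act (inv r) y))"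
  unfolding split_beta
  by (intro continuous_map_cmult continuous_map_compose[OF continuous_map_snd w, unfolded o_def]
    cfun_act_cont[OF F] continuous_inv' continuous_map_snd continuous_map_fst)

lemma conv_cfunG: "cfunG w \<Longrightarrow> F \<in> cfun TX \<Longrightarrow> y \<in> topspace TX \<Longrightarrow> cfunG (\<lambda>r. w r * F (act (inv r) y))"
  using cfunG_slice[OF conv_cont_aux] by blast

lemma conv_cfun:
  assumes w: "cfunG w" and F: "F \<in> cfun TX"
  shows "conv w F \<in> cfun TX"
proof -
  have "continuous_map TX euclidean (\<lambda>y. haar (\<lambda>r. w r * F (act (inv r) y)))"
    by (rule haar_continuous[OF compact_TX conv_cont_aux[OF w F]])
  then have "continuous_map TX euclidean (conv w F)"
    by (rule continuous_map_eq) (simp add: conv_def)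
  then show ?thesis by (simp add: cfun_def conv_def)
qed

lemma conv_cong: "(\<And>r. r \<in> carrier G \<Longrightarrow> v r = w r) \<Longrightarrow> conv v F = conv w F"
  unfolding conv_def fun_eq_iff by (auto intro!: haar_cong)

lemma conv_add_left:
  assumes "cfunG v" "cfunG w" "F \<in> cfun TX"
  shows "conv (v + w) F = conv v F + conv w F"
  using assms by (auto simp: fun_eq_iff conv_def distrib_right haar_add conv_cfunG)

lemma conv_fscale_left:
  assumes "cfunG w" "F \<in> cfun TX"
  shows "conv (fscale c w) F = fscale c (conv w F)"
  using assms by (auto simp: fun_eq_iff conv_def fscale_def mult.assoc haar_cmult conv_cfunG)

lemma conv_add_right:
  assumes "cfunG w" "F \<in> cfun TX" "H \<in> cfun TX"
  shows "conv w (F + H) = conv w F + conv w H"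
  using assms by (auto simp: fun_eq_iff conv_def distrib_left haar_add conv_cfunG)

lemma conv_fscale_right:
  assumes "cfunG w" "F \<in> cfun TX"
  shows "conv w (fscale c F) = fscale c (conv w F)"
  using assms by (auto simp: fun_eq_iff conv_def fscale_def mult.left_commute[of _ c] haar_cmult conv_cfunG)

text \<open>Left invariance of the mean moves a translation from the result to the kernel.\<close>

lemma trans_conv:
  assumes w: "cfunG w" and F: "F \<in> cfun TX" and s: "s \<in> carrier G"
  shows "trans s (conv w F) = conv (\<lambda>r. w (inv s \<otimes> r)) F"
proof
  fix y
  show "trans s (conv w F) y = conv (\<lambda>r. w (inv s \<otimes> r)) F y"
  proof (cases "y \<in> topspace TX")
    case True
    have "haar (\<lambda>r. w r * F (act (inv r) (act (inv s) y))) =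
      haar (\<lambda>r. w (inv s \<otimes> r) * F (act (inv (inv s \<otimes> r)) (act (inv s) y)))"
      by (rule haar_left[OF conv_cfunG[OF w F], symmetric]) (use s True in auto)
    also have "\<dots> = haar (\<lambda>r. w (inv s \<otimes> r) * F (act (inv r) y))"
      using s True by (intro haar_cong) (simp add: inv_mult_group act_mult)
    finally show ?thesis using True s by (simp add: trans_apply conv_def)
  qed (simp add: translate_def conv_def)
qed

lemma norm_conv_le:
  assumes w: "cfunG w" and F: "F \<in> cfun TX" and M: "\<And>x. norm (F x) \<le> M" and y: "y \<in> topspace TX"
  shows "norm (conv w F y) \<le> M * Re (haar (\<lambda>r. of_real (norm (w r))))"
proof -
  have c: "cfunG (\<lambda>r. of_real (norm (w r)))"
    by (intro continuous_map_of_real continuous_map_norm w)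
  have "norm (haar (\<lambda>r. w r * F (act (inv r) y))) \<le> Re (haar (\<lambda>r. of_real M * of_real (norm (w r))))"
    by (intro haar_norm_le conv_cfunG w F y continuous_intros c)
       (use M in \<open>auto simp: norm_mult mult.commute[of M] intro!: mult_left_mono\<close>)
  then show ?thesis using y c by (simp add: conv_def haar_cmult)
qed

end

text \<open>Translation and convolution on the group become instances of the general ones. The laws
  of \<open>compact_action\<close> are pointwise, without extensionality off the space, so that
  \<open>(\<otimes>)\<close> satisfies them as it stands.\<close>

sublocale compact_group \<subseteq> self: compact_action G T T "(\<otimes>)"
  by unfold_locales (use compact_T hausdorff_T topspace_eq continuous_mult m_assoc in \<open>auto\<close>)

context compact_action
begin

lemma conv_assoc:
  assumes v: "cfunG v" and w: "w \<in> cfun T" and F: "F \<in> cfun TX"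
  shows "conv (self.conv v w) F = conv v (conv w F)"
proof
  fix y
  show "conv (self.conv v w) F y = conv v (conv w F) y"
  proof (cases "y \<in> topspace TX")
    case y: True
    have cw: "cfunG w" using w by (simp add: cfun_def)
    let ?H = "\<lambda>r q. v q * w (inv q \<otimes> r) * F (act (inv r) y)"
    have c: "continuous_map (prod_topology T T) euclidean (\<lambda>(r, q). ?H r q)"
      unfolding split_beta
      by (intro continuous_map_cmult continuous_map_compose[OF continuous_map_snd v, unfolded o_def]
          cfun_act_cont[OF F] self.cfun_act_cont[OF w] continuous_inv' continuous_map_snd continuous_map_fst)
        (use y in simp)
    have "conv (self.conv v w) F y = haar (\<lambda>r. haar (\<lambda>q. ?H r q))"
    proof -
      have "haar (\<lambda>q. v q * w (inv q \<otimes> r)) * F (act (inv r) y) = haar (\<lambda>q. ?H r q)" if "r \<in> carrier G" for r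
        using haar_mult_right[OF self.conv_cfunG[OF v w, of r]] that topspace_eq by simp
      then show ?thesis using y unfolding conv_def self.conv_def by (auto simp: topspace_eq intro!: haar_cong)
    qed
    also have "\<dots> = haar (\<lambda>q. haar (\<lambda>r. ?H r q))" by (rule haar_fubini[OF c])
    also have "\<dots> = haar (\<lambda>q. v q * conv w F (act (inv q) y))"
    proof (rule haar_cong)
      fix q assume q: "q \<in> carrier G"
      have "haar (\<lambda>r. ?H r q) = haar (\<lambda>r. ?H (q \<otimes> r) q)"
        by (rule haar_left[symmetric, OF continuous_slice[OF c q] q])
      also have "\<dots> = haar (\<lambda>r. v q * (w r * F (act (inv r) (act (inv q) y))))"
        using q y by (intro haar_cong) (simp add: inv_mult_group act_mult mult_inv_cancel mult.assoc)
      also have "\<dots> = v q * conv w F (act (inv q) y)"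
        using q y haar_cmult[OF conv_cfunG[OF cw F, of "act (inv q) y"]] by (simp add: conv_def)
      finally show "haar (\<lambda>r. ?H r q) = v q * conv w F (act (inv q) y)" .
    qed
    also have "\<dots> = conv v (conv w F) y" using y by (simp add: conv_def)
    finally show ?thesis .
  qed (simp add: conv_def)
qed

end

section \<open>Convolution and projections\<close>

lemma quadratic_cauchy_schwarz:
  fixes z :: complex
  assumes b: "b \<ge> 0" and *: "\<And>c. 0 \<le> a - 2 * Re (cnj c * z) + (norm c)\<^sup>2 * b"
  shows "(norm z)\<^sup>2 \<le> a * b"
proof -
  have r: "0 \<le> a - 2 * t * (norm z)\<^sup>2 + t\<^sup>2 * (norm z)\<^sup>2 * b" for t :: real
    using *[of "of_real t * z"]
    by (simp add: norm_mult power_mult_distrib mult.assoc complex_norm_square[symmetric] mult.commute[of "cnj z"])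
  show ?thesis
  proof (cases "b = 0")
    case True
    have "a \<ge> 0" using r[of 0] by simp
    have "(norm z)\<^sup>2 = 0"
    proof (rule ccontr)
      assume "(norm z)\<^sup>2 \<noteq> 0"
      \<comment> \<open>The affine function of \<open>t\<close> that remains for
        \<open>b = 0\<close> takes the value \<open>- a - 2\<close> there.\<close>
      then show False using r[of "(a + 1) / (norm z)\<^sup>2"] True \<open>a \<ge> 0\<close> by simp
    qed
    then show ?thesis using True by simp
  next
    case False
    then show ?thesis using r[of "1 / b"] b by (simp add: field_simps power2_eq_square)
  qed
qed

section \<open>Inner product, involution and convolution norms on the group\<close>

context compact_group
begin

abbreviation gconv (infixl "\<star>" 70) where "f \<star> g \<equiv> self.conv f g"

text \<open>The involution of the convolution algebra: right convolution by \<open>adj g\<close> is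
  the adjoint of right convolution by \<open>g\<close>, so \<open>adj \<psi> = \<psi>\<close> makes
  the operator of \<open>\<psi>\<close> self-adjoint.\<close>

definition adj :: "('a \<Rightarrow> complex) \<Rightarrow> 'a \<Rightarrow> complex" where
  "adj f t = (if t \<in> carrier G then cnj (f (inv t)) else 0)"

definition ip :: "('a \<Rightarrow> complex) \<Rightarrow> ('a \<Rightarrow> complex) \<Rightarrow> complex" where
  "ip f g = haar (\<lambda>t. f t * cnj (g t))"

definition nrm :: "('a \<Rightarrow> complex) \<Rightarrow> real" where
  "nrm f = sqrt (Re (ip f f))"

lemma cfunT_memI: "cfunG f \<Longrightarrow> (\<And>t. t \<notin> carrier G \<Longrightarrow> f t = 0) \<Longrightarrow> f \<in> cfun T"
  by (simp add: cfun_def topspace_eq)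

lemma cfunT_zero: "f \<in> cfun T \<Longrightarrow> t \<notin> carrier G \<Longrightarrow> f t = 0"
  by (simp add: cfun_def topspace_eq)

lemma cfunT [simp]: "f \<in> cfun T \<Longrightarrow> cfunG f"
  by (simp add: cfun_def)

lemma cfun_eqI: "f \<in> cfun T \<Longrightarrow> g \<in> cfun T \<Longrightarrow> (\<And>t. t \<in> carrier G \<Longrightarrow> f t = g t) \<Longrightarrow> f = g"
  by (metis cfunT_zero ext)

lemmas cfun_add = fun_space.subspace_add[OF self.subspace_cfun]
  and cfun_diff = fun_space.subspace_diff[OF self.subspace_cfun]
  and cfun_fscale = fun_space.subspace_scale[OF self.subspace_cfun]
  and cfun_0 = fun_space.subspace_0[OF self.subspace_cfun]

lemma conv_mem [simp]: "f \<in> cfun T \<Longrightarrow> g \<in> cfun T \<Longrightarrow> f \<star> g \<in> cfun T"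
  by (simp add: self.conv_cfun)

lemma conv_asc: "f \<in> cfun T \<Longrightarrow> g \<in> cfun T \<Longrightarrow> h \<in> cfun T \<Longrightarrow> f \<star> g \<star> h = f \<star> (g \<star> h)"
  by (simp add: self.conv_assoc)

lemma adj_mem [simp]: "f \<in> cfun T \<Longrightarrow> adj f \<in> cfun T"
proof -
  assume f: "f \<in> cfun T"
  have "cfunG (\<lambda>t. cnj (f (inv t)))" by (intro continuous_intros cfunG_inv cfunT f)
  then have "cfunG (adj f)" by (rule continuous_map_eq) (simp add: adj_def topspace_eq)
  then show ?thesis by (rule cfunT_memI) (simp add: adj_def)
qed

lemma adj_adj: "f \<in> cfun T \<Longrightarrow> adj (adj f) = f"
  by (rule cfun_eqI) (auto simp: adj_def)

lemma ip_cfunG: "f \<in> cfun T \<Longrightarrow> g \<in> cfun T \<Longrightarrow> cfunG (\<lambda>t. f t * cnj (g t))"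
  by (intro continuous_intros cfunT)

lemma ip_add_left: "f \<in> cfun T \<Longrightarrow> g \<in> cfun T \<Longrightarrow> h \<in> cfun T \<Longrightarrow> ip (f + g) h = ip f h + ip g h"
  by (simp add: ip_def distrib_right haar_add ip_cfunG)

lemma ip_fscale_left: "f \<in> cfun T \<Longrightarrow> h \<in> cfun T \<Longrightarrow> ip (fscale c f) h = c * ip f h"
  by (simp add: ip_def fscale_def mult.assoc haar_cmult ip_cfunG)

lemma ip_diff_left: "f \<in> cfun T \<Longrightarrow> g \<in> cfun T \<Longrightarrow> h \<in> cfun T \<Longrightarrow> ip (f - g) h = ip f h - ip g h"
  by (simp add: ip_def left_diff_distrib haar_diff ip_cfunG)

lemma ip_sym: "f \<in> cfun T \<Longrightarrow> g \<in> cfun T \<Longrightarrow> ip g f = cnj (ip f g)"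
  using haar_cnj[OF ip_cfunG[of f g]] by (simp add: ip_def mult.commute)

lemma ip_add_right: "f \<in> cfun T \<Longrightarrow> g \<in> cfun T \<Longrightarrow> h \<in> cfun T \<Longrightarrow> ip h (f + g) = ip h f + ip h g"
  by (simp add: ip_sym[of _ h] cfun_add ip_add_left)

lemma ip_diff_right: "f \<in> cfun T \<Longrightarrow> g \<in> cfun T \<Longrightarrow> h \<in> cfun T \<Longrightarrow> ip h (f - g) = ip h f - ip h g"
  by (simp add: ip_sym[of _ h] cfun_diff ip_diff_left)

lemma ip_fscale_right: "f \<in> cfun T \<Longrightarrow> h \<in> cfun T \<Longrightarrow> ip h (fscale c f) = cnj c * ip h f"
  by (simp add: ip_sym[of _ h] cfun_fscale ip_fscale_left)

lemma ip_self_nonneg: "f \<in> cfun T \<Longrightarrow> 0 \<le> Re (ip f f)"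
proof -
  assume f: "f \<in> cfun T"
  have "norm (haar (\<lambda>t. f t * cnj (f t))) \<le> Re (haar (\<lambda>t. f t * cnj (f t)))"
    by (intro haar_norm_le ip_cfunG f) (simp add: complex_norm_square[symmetric] norm_mult power2_eq_square)
  then show ?thesis unfolding ip_def using norm_ge_zero order_trans by blast
qed

lemma nrm_sq: "f \<in> cfun T \<Longrightarrow> (nrm f)\<^sup>2 = Re (ip f f)"
  by (simp add: nrm_def ip_self_nonneg)

lemma nrm_nonneg [simp]: "f \<in> cfun T \<Longrightarrow> 0 \<le> nrm f"
  by (simp add: nrm_def ip_self_nonneg)

lemma ip_self: "f \<in> cfun T \<Longrightarrow> ip f f = of_real ((nrm f)\<^sup>2)"
  using ip_sym[of f f] by (simp add: nrm_sq complex_eq_iff)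

lemma ip_self_0: "f \<in> cfun T \<Longrightarrow> nrm f = 0 \<Longrightarrow> f = 0"
proof (rule ccontr)
  assume f: "f \<in> cfun T" and n: "nrm f = 0" and "f \<noteq> 0"
  then obtain t where t: "f t \<noteq> 0" by (auto simp: fun_eq_iff)
  then have tG: "t \<in> carrier G" using f cfunT_zero by blast
  have sq: "f s * cnj (f s) = of_real ((norm (f s))\<^sup>2)" for s
    by (simp only: complex_norm_square)
  have "Re (haar (\<lambda>s. f s * cnj (f s))) > 0"
    by (rule haar_pos[OF ip_cfunG[OF f f] _ tG]) (use t in \<open>simp_all only: sq Re_complex_of_real, auto\<close>)
  then show False using nrm_sq[OF f] n by (simp add: ip_def)
qed

lemma cauchy_schwarz:
  assumes f: "f \<in> cfun T" and g: "g \<in> cfun T"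
  shows "norm (ip f g) \<le> nrm f * nrm g"
proof -
  have "(norm (ip f g))\<^sup>2 \<le> (nrm f)\<^sup>2 * (nrm g)\<^sup>2"
  proof (rule quadratic_cauchy_schwarz)
    fix c
    have "ip (f - fscale c g) (f - fscale c g) =
        ip f f - (c * cnj (ip f g) + cnj c * ip f g) + c * cnj c * ip g g"
      using f g by (simp add: ip_diff_left ip_diff_right ip_fscale_left ip_fscale_right cfun_diff
          cfun_fscale ip_sym[of f g] algebra_simps)
    then have "Re (ip (f - fscale c g) (f - fscale c g)) =
      (nrm f)\<^sup>2 - 2 * Re (cnj c * ip f g) + (norm c)\<^sup>2 * (nrm g)\<^sup>2"
      by (simp add: ip_self f g complex_norm_square[symmetric])
    then show "0 \<le> (nrm f)\<^sup>2 - 2 * Re (cnj c * ip f g) + (norm c)\<^sup>2 * (nrm g)\<^sup>2"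
      using ip_self_nonneg[of "f - fscale c g"] f g by (simp add: cfun_diff cfun_fscale)
  qed simp
  then have "(norm (ip f g))\<^sup>2 \<le> (nrm f * nrm g)\<^sup>2" by (simp add: power_mult_distrib)
  then show ?thesis by (rule power2_le_imp_le) (use f g in auto)
qed

lemma nrm_fscale: "f \<in> cfun T \<Longrightarrow> nrm (fscale c f) = norm c * nrm f"
proof -
  assume f: "f \<in> cfun T"
  have "ip (fscale c f) (fscale c f) = of_real ((norm c)\<^sup>2 * (nrm f)\<^sup>2)"
    using f complex_norm_square[of c]
    by (simp add: ip_fscale_left[OF _ cfun_fscale] ip_fscale_right ip_self[OF f] mult.assoc[symmetric])
  then have "(nrm (fscale c f))\<^sup>2 = (norm c * nrm f)\<^sup>2"
    using f by (simp add: nrm_sq[OF cfun_fscale] power_mult_distrib)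
  then show ?thesis using f by (simp add: cfun_fscale)
qed

lemma nrm_le_sup:
  assumes f: "f \<in> cfun T" and M: "M \<ge> 0" "\<And>t. t \<in> carrier G \<Longrightarrow> norm (f t) \<le> M"
  shows "nrm f \<le> M"
proof -
  have "norm (haar (\<lambda>t. f t * cnj (f t))) \<le> Re (haar (\<lambda>t. of_real (M * M)))"
    using M f by (intro haar_norm_le ip_cfunG continuous_intros) (auto simp: norm_mult intro!: mult_mono)
  then have "(nrm f)\<^sup>2 \<le> M\<^sup>2"
    using nrm_sq[OF f] complex_Re_le_cmod[of "ip f f"] by (simp add: ip_def haar_const power2_eq_square)
  then show ?thesis using M(1) by (rule power2_le_imp_le)
qed

lemma nrm_adj: "f \<in> cfun T \<Longrightarrow> nrm (adj f) = nrm f"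
proof -
  assume f: "f \<in> cfun T"
  have "ip (adj f) (adj f) = haar (\<lambda>t. f (inv t) * cnj (f (inv t)))"
    unfolding ip_def by (intro haar_cong) (simp add: adj_def mult.commute)
  also have "\<dots> = ip f f" unfolding ip_def by (rule haar_inv[OF ip_cfunG[OF f f]])
  finally show ?thesis by (simp add: nrm_def)
qed

lemma ip_trans:
  assumes f: "f \<in> cfun T" and g: "g \<in> cfun T" and s: "s \<in> carrier G"
  shows "ip (self.trans s f) (self.trans s g) = ip f g"
proof -
  have "ip (self.trans s f) (self.trans s g) = haar (\<lambda>t. f (inv s \<otimes> t) * cnj (g (inv s \<otimes> t)))"
    unfolding ip_def by (intro haar_cong) (simp add: self.trans_apply topspace_eq)
  also have "\<dots> = ip f g" unfolding ip_def by (rule haar_left[OF ip_cfunG[OF f g]]) (use s in simp)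
  finally show ?thesis .
qed

lemma nrm_trans: "f \<in> cfun T \<Longrightarrow> s \<in> carrier G \<Longrightarrow> nrm (self.trans s f) = nrm f"
  by (simp add: nrm_def ip_trans)

text \<open>Values of a convolution as inner products: Cauchy--Schwarz then bounds them uniformly by
  \<open>nrm\<close>. One convolution thereby turns convergence in \<open>nrm\<close> into uniform
  convergence, which keeps limits continuous.\<close>

lemma conv_eq_ip:
  assumes "f \<in> cfun T" "g \<in> cfun T" "t \<in> carrier G"
  shows "(f \<star> g) t = ip f (self.trans t (adj g))"
  unfolding self.conv_def ip_def
  using assms by (auto simp: topspace_eq self.trans_apply adj_def inv_mult_group intro!: haar_cong)

lemma norm_conv_le_nrm:
  assumes "f \<in> cfun T" "g \<in> cfun T"
  shows "norm ((f \<star> g) t) \<le> nrm f * nrm g"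
proof (cases "t \<in> carrier G")
  case True
  then show ?thesis
    using cauchy_schwarz[of f "self.trans t (adj g)"] assms
    by (simp add: conv_eq_ip self.trans_cfun nrm_trans nrm_adj)
next
  case False
  then show ?thesis using assms by (simp add: self.conv_def topspace_eq)
qed

lemma nrm_conv_le: "f \<in> cfun T \<Longrightarrow> g \<in> cfun T \<Longrightarrow> nrm (f \<star> g) \<le> nrm f * nrm g"
  by (rule nrm_le_sup) (auto simp: norm_conv_le_nrm)

lemma ip_eq_conv: "f \<in> cfun T \<Longrightarrow> g \<in> cfun T \<Longrightarrow> ip f g = (f \<star> adj g) \<one>"
  by (simp add: conv_eq_ip adj_adj self.trans_one)

lemma adj_conv:
  assumes f: "f \<in> cfun T" and g: "g \<in> cfun T"
  shows "adj (f \<star> g) = adj g \<star> adj f"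
proof (rule cfun_eqI)
  fix t assume t: "t \<in> carrier G"
  have c: "cfunG (\<lambda>r. adj g r * adj f (inv r \<otimes> t))"
    using self.conv_cfunG[of "adj g" "adj f" t] f g t by (simp add: topspace_eq)
  have "(adj g \<star> adj f) t = haar (\<lambda>r. adj g (t \<otimes> r) * adj f (inv (t \<otimes> r) \<otimes> t))"
    using t haar_left[OF c t] by (simp add: self.conv_def topspace_eq)
  also have "\<dots> = haar (\<lambda>r. cnj (f r * g (inv r \<otimes> inv t)))"
    using t by (intro haar_cong) (simp add: adj_def inv_mult_group m_assoc)
  also have "\<dots> = adj (f \<star> g) t"
    using t f g haar_cnj[OF self.conv_cfunG[of f g "inv t"]]
    by (simp add: adj_def self.conv_def topspace_eq)
  finally show "adj (f \<star> g) t = (adj g \<star> adj f) t" by simp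
qed (use f g in auto)

lemma ip_conv_left:
  assumes "f \<in> cfun T" "g \<in> cfun T" "h \<in> cfun T"
  shows "ip (f \<star> g) h = ip f (h \<star> adj g)"
  using assms by (simp add: ip_eq_conv adj_conv adj_adj conv_asc)

lemma adj_diff: "adj (f - g) = adj f - adj g"
  by (simp add: adj_def fun_eq_iff)

lemma adj_fscale: "adj (fscale c f) = fscale (cnj c) (adj f)"
  by (simp add: adj_def fun_eq_iff fscale_def)

lemma conv_diff_left:
  assumes "f \<in> cfun T" "g \<in> cfun T" "h \<in> cfun T"
  shows "(f - g) \<star> h = f \<star> h - g \<star> h"
  using self.conv_add_left[of "f - g" g h] assms by (simp add: cfun_diff algebra_simps)

lemma conv_diff_right:
  assumes "f \<in> cfun T" "g \<in> cfun T" "h \<in> cfun T"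
  shows "h \<star> (f - g) = h \<star> f - h \<star> g"
  using self.conv_add_right[of h "f - g" g] assms by (simp add: cfun_diff algebra_simps)

text \<open>Right convolution by such a \<open>p\<close> is an orthogonal projection that commutes
  with left translations, so its range is an invariant space.\<close>

definition projections :: "('a \<Rightarrow> complex) set" where
  "projections = {p \<in> cfun T. adj p = p \<and> p \<star> p = p}"

text \<open>Power iteration: the powers \<open>\<psi>\<^sup>2\<^sup>n\<close> of a self-adjoint \<open>\<psi>\<close> with convolution norm one
  converge to a nonzero projection, because \<open>\<parallel>\<psi>\<^sup>n\<parallel>\<close> decreases and stays at least one.\<close>

lemma top_projection:
  assumes \<psi>: "\<psi> \<in> cfun T" "adj \<psi> = \<psi>"
    and contr: "\<And>f. f \<in> cfun T \<Longrightarrow> nrm (f \<star> \<psi>) \<le> nrm f"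
    and sharp: "\<And>\<eta>. \<eta> < 1 \<Longrightarrow> \<exists>f\<in>cfun T. \<eta> * nrm f < nrm (f \<star> \<psi>)"
  obtains p where "p \<in> projections" "p \<star> \<psi> = \<psi> \<star> p" "p \<star> \<psi> \<star> \<psi> = p" "nrm p \<ge> 1"
proof -
  \<comment> \<open>The index is shifted by one: \<open>P n\<close> is the convolution power with
    exponent \<open>n + 1\<close>, since there is no convolution unit to start from.\<close>
  define P where "P n = ((\<lambda>f. f \<star> \<psi>) ^^ n) \<psi>" for n
  have P0: "P 0 = \<psi>" and PS: "P (Suc n) = P n \<star> \<psi>" for n by (simp_all add: P_def)
  have Pm [simp]: "P n \<in> cfun T" for n by (induction n) (use \<psi> in \<open>simp_all add: P0 PS\<close>)
  have comm: "\<psi> \<star> P n = P n \<star> \<psi>" for n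
    by (induction n) (use \<psi> in \<open>simp_all add: P0 PS conv_asc[symmetric]\<close>)
  have adjP: "adj (P n) = P n" for n
    by (induction n) (use \<psi> in \<open>simp_all add: P0 PS adj_conv comm\<close>)
  have PP: "P n \<star> P m = P (Suc (n + m))" for n m
    by (induction m) (use \<psi> in \<open>simp_all add: P0 PS flip: conv_asc\<close>)
  have ipP: "ip (P n) (P m) = P (Suc (n + m)) \<one>" for n m
    by (simp add: ip_eq_conv adjP PP)
  have ge1: "nrm (P n) \<ge> 1" for n
  proof (rule field_le_mult_one_interval)
    fix z :: real assume z: "0 < z" "z < 1"
    \<comment> \<open>\<open>P n\<close> convolves \<open>n + 1\<close> times, and a growth factor
      \<open>\<eta>\<close> per convolution accumulates to \<open>z\<close> after that many.\<close>
    define \<eta> where "\<eta> = root (Suc n) z"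
    have \<eta>: "0 < \<eta>" "\<eta> < 1" "\<eta> ^ Suc n = z"
      using z by (simp_all add: \<eta>_def del: power_Suc)
    obtain f where f: "f \<in> cfun T" "\<eta> * nrm f < nrm (f \<star> \<psi>)" using sharp[OF \<eta>(2)] by blast
    define x where "x k = nrm (((\<lambda>f. f \<star> \<psi>) ^^ k) f)" for k
    have Sm [simp]: "((\<lambda>f. f \<star> \<psi>) ^^ k) f \<in> cfun T" for k
      by (induction k) (use \<psi> f in simp_all)
    have fP: "f \<star> P k = ((\<lambda>f. f \<star> \<psi>) ^^ (Suc k)) f" for k
      by (induction k) (use \<psi> f in \<open>simp_all add: P0 PS flip: conv_asc\<close>)
    have f0: "nrm f > 0"
      using f contr[OF f(1)] \<eta> by (metis nrm_nonneg less_le mult_zero_right not_less)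
    \<comment> \<open>Cauchy--Schwarz and self-adjointness of \<open>\<psi>\<close> make the norms
      of the iterates log-convex, so the initial growth factor above \<open>\<eta>\<close>
      persists.\<close>
    have lc: "(x (Suc k))\<^sup>2 \<le> x (Suc (Suc k)) * x k" for k
    proof -
      let ?u = "((\<lambda>f. f \<star> \<psi>) ^^ k) f"
      have "(x (Suc k))\<^sup>2 = Re (ip (?u \<star> \<psi>) (?u \<star> \<psi>))"
        using \<psi> by (simp add: x_def nrm_sq)
      also have "\<dots> = Re (ip (?u \<star> \<psi> \<star> \<psi>) ?u)"
        using \<psi> ip_conv_left[of "?u \<star> \<psi>" \<psi> ?u] by simp
      also have "\<dots> \<le> norm (ip (?u \<star> \<psi> \<star> \<psi>) ?u)" by (rule complex_Re_le_cmod)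
      also have "\<dots> \<le> x (Suc (Suc k)) * x k"
        using cauchy_schwarz[of "?u \<star> \<psi> \<star> \<psi>" ?u] \<psi> by (simp add: x_def)
      finally show ?thesis .
    qed
    have grow: "0 < x k \<and> \<eta> * x k \<le> x (Suc k)" for k
    proof (induction k)
      case 0
      then show ?case using f f0 by (simp add: x_def)
    next
      case (Suc k)
      have pos: "0 < x (Suc k)" using Suc \<eta> by (meson less_le_trans mult_pos_pos)
      have "\<eta> * x k * x (Suc k) \<le> x (Suc k) * x (Suc k)" using Suc pos by simp
      also have "\<dots> \<le> x (Suc (Suc k)) * x k" using lc[of k] by (simp add: power2_eq_square)
      finally have "(\<eta> * x (Suc k)) * x k \<le> x (Suc (Suc k)) * x k" by (simp add: mult_ac)
      then have "\<eta> * x (Suc k) \<le> x (Suc (Suc k))" using Suc by simp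
      then show ?case using pos by simp
    qed
    have "\<eta> ^ k * x 0 \<le> x k" for k
    proof (induction k)
      case (Suc k)
      have "\<eta> ^ Suc k * x 0 = \<eta> * (\<eta> ^ k * x 0)" by simp
      also have "\<dots> \<le> \<eta> * x k" using Suc \<eta> by simp
      finally show ?case using grow[of k] by linarith
    qed simp
    then have "z * nrm f \<le> x (Suc n)" using \<eta>(3) by (metis funpow_0 x_def)
    also have "\<dots> \<le> nrm f * nrm (P n)"
      using nrm_conv_le[OF f(1) Pm[of n]] by (simp add: fP x_def)
    finally show "z * 1 \<le> nrm (P n)" using f0 by (simp add: mult.commute)
  qed
  define y where "y n = (nrm (P n))\<^sup>2" for n
  have yP: "y n = Re (P (Suc (2 * n)) \<one>)" for n
    using nrm_sq[OF Pm[of n]] by (simp add: y_def ipP mult_2)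
  have "decseq y"
    unfolding y_def PS[abs_def] by (intro decseq_SucI power_mono) (use contr[OF Pm] \<psi> in \<open>simp_all add: PS\<close>)
  moreover have "y n \<ge> 0" for n by (simp add: y_def)
  ultimately obtain L where L: "y \<longlonglongrightarrow> L" using decseq_convergent[of y 0] by blast
  \<comment> \<open>Only even powers of \<open>\<psi>\<close> are kept: a spectral value
    \<open>-1\<close> would make the full sequence oscillate.\<close>
  define h where "h n = P (Suc (2 * n))" for n
  define \<kappa> where "\<kappa> = \<psi> \<star> \<psi>"
  have [simp]: "h n \<in> cfun T" "\<kappa> \<in> cfun T" for n using \<psi> by (simp_all add: h_def \<kappa>_def)
  have hS: "h (Suc n) = h n \<star> \<kappa>" for n using \<psi> by (simp add: h_def PS \<kappa>_def conv_asc)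
  have iph: "Re (ip (h n) (h m)) = y (n + m + 1)" for n m
    by (simp add: h_def ipP yP algebra_simps)
  \<comment> \<open>Inner products of the \<open>h n\<close> depend on the sum of the indices only,
    so convergence of \<open>y\<close> alone makes the sequence Cauchy in
    \<open>nrm\<close>.\<close>
  have dist: "(nrm (h n - h m))\<^sup>2 = y (2 * n + 1) - 2 * y (n + m + 1) + y (2 * m + 1)" for n m
  proof -
    have "(nrm (h n - h m))\<^sup>2 = Re (ip (h n) (h n)) - Re (ip (h m) (h n)) - (Re (ip (h n) (h m)) - Re (ip (h m) (h m)))"
      by (simp add: nrm_sq cfun_diff ip_diff_left ip_diff_right)
    moreover have "y (m + n + 1) = y (n + m + 1)" by (rule arg_cong[where f = y]) simp
    moreover have "y (n + n + 1) = y (2 * n + 1)" "y (m + m + 1) = y (2 * m + 1)"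
      by (simp_all add: mult_2)
    ultimately show ?thesis unfolding iph by linarith
  qed
  have cauchy: "\<exists>N. \<forall>m\<ge>N. \<forall>n\<ge>N. nrm (h m - h n) \<le> e" if e: "e > 0" for e
  proof -
    have "e\<^sup>2 / 4 > 0" using e by simp
    from LIMSEQ_D[OF L this] obtain N where N: "\<And>n. n \<ge> N \<Longrightarrow> \<bar>y n - L\<bar> < e\<^sup>2 / 4" by auto
    have "nrm (h m - h n) \<le> e" if "m \<ge> N" "n \<ge> N" for m n
    proof -
      have "(nrm (h m - h n))\<^sup>2 \<le> e\<^sup>2"
      proof -
        have "\<bar>y (2 * m + 1) - L\<bar> < e\<^sup>2 / 4" "\<bar>y (m + n + 1) - L\<bar> < e\<^sup>2 / 4" "\<bar>y (2 * n + 1) - L\<bar> < e\<^sup>2 / 4"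
          by (rule N, use that in simp)+
        then show ?thesis unfolding dist by linarith
      qed
      then show ?thesis by (rule power2_le_imp_le) (use e in simp)
    qed
    then show ?thesis by blast
  qed
  \<comment> \<open>One more convolution by \<open>\<kappa>\<close> upgrades the Cauchy property
    from \<open>nrm\<close> to the uniform norm, at the price of an index shift.\<close>
  have ucauchy: "\<exists>N. \<forall>m\<ge>N. \<forall>n\<ge>N. \<forall>t. norm (h m t - h n t) \<le> e" if e: "e > 0" for e
  proof -
    have \<kappa>1: "nrm \<kappa> + 1 > 0" by (simp add: add_nonneg_pos)
    then have "e / (nrm \<kappa> + 1) > 0" using e by simp
    from cauchy[OF this] obtain N where N: "\<And>m n. m \<ge> N \<Longrightarrow> n \<ge> N \<Longrightarrow> nrm (h m - h n) \<le> e / (nrm \<kappa> + 1)"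
      by blast
    have "norm (h m t - h n t) \<le> e" if mn: "m \<ge> Suc N" "n \<ge> Suc N" for m n t
    proof -
      obtain m' n' where m': "m = Suc m'" "n = Suc n'" "m' \<ge> N" "n' \<ge> N"
        using mn by (cases m; cases n) auto
      have "h m t - h n t = ((h m' - h n') \<star> \<kappa>) t"
        by (simp add: m' hS conv_diff_left)
      also have "norm \<dots> \<le> nrm (h m' - h n') * nrm \<kappa>"
        by (rule norm_conv_le_nrm) (simp_all add: cfun_diff)
      also have "\<dots> \<le> e / (nrm \<kappa> + 1) * (nrm \<kappa> + 1)"
        using N[OF m'(3,4)] e by (intro mult_mono) (auto simp: cfun_diff)
      finally show ?thesis using \<kappa>1 by simp
    qed
    then show ?thesis by blast
  qed
  define p where "p t = lim (\<lambda>n. h n t)" for t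
  have lim: "(\<lambda>n. h n t) \<longlonglongrightarrow> p t" for t
  proof -
    have "Cauchy (\<lambda>n. h n t)"
      unfolding Cauchy_def
    proof (intro allI impI)
      fix e :: real assume "e > 0"
      then obtain N where "\<forall>m\<ge>N. \<forall>n\<ge>N. \<forall>t. norm (h m t - h n t) \<le> e/2" using ucauchy[of "e/2"] by auto
      then show "\<exists>M. \<forall>m\<ge>M. \<forall>n\<ge>M. dist (h m t) (h n t) < e"
        using \<open>e > 0\<close> by (intro exI[of _ N]) (auto simp: dist_norm intro: le_less_trans[of _ "e/2"])
    qed
    then show ?thesis unfolding p_def by (simp add: Cauchy_convergent_iff convergent_LIMSEQ_iff)
  qed
  have unif: "\<exists>N. \<forall>n\<ge>N. \<forall>t. norm (h n t - p t) \<le> e" if e: "e > 0" for e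
  proof -
    obtain N where N: "\<And>m n t. m \<ge> N \<Longrightarrow> n \<ge> N \<Longrightarrow> norm (h m t - h n t) \<le> e" using ucauchy[OF e] by blast
    have "norm (h n t - p t) \<le> e" if n: "n \<ge> N" for n t
    proof (rule LIMSEQ_le_const2)
      show "(\<lambda>m. norm (h n t - h m t)) \<longlonglongrightarrow> norm (h n t - p t)"
        by (intro tendsto_intros lim)
      show "\<exists>M. \<forall>m\<ge>M. norm (h n t - h m t) \<le> e" using N n by blast
    qed
    then show ?thesis by blast
  qed
  have pm [simp]: "p \<in> cfun T"
  proof -
    have "cfunG p"
    proof (rule continuous_map_uniform)
      fix e :: real assume "e > 0"
      then obtain N where "\<forall>t. norm (h N t - p t) \<le> e" using unif by blast
      then show "\<exists>g. cfunG g \<and> (\<forall>z\<in>topspace T. norm (g z - p z) \<le> e)"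
        by (intro exI[of _ "h N"]) auto
    qed
    moreover have "p t = 0" if "t \<notin> carrier G" for t
      using lim[of t] cfunT_zero[of "h _" t] that by (simp add: LIMSEQ_const_iff)
    ultimately show ?thesis by (rule cfunT_memI)
  qed
  have nlim: "(\<lambda>n. nrm (h n - p)) \<longlonglongrightarrow> 0"
    unfolding LIMSEQ_iff
  proof (intro allI impI)
    fix e :: real assume e: "e > 0"
    then obtain N where N: "\<And>n t. n \<ge> N \<Longrightarrow> norm (h n t - p t) \<le> e/2" using unif[of "e/2"] by auto
    have "nrm (h n - p) \<le> e/2" if "n \<ge> N" for n
      by (rule nrm_le_sup) (use N[OF that] e in \<open>auto simp: cfun_diff\<close>)
    then show "\<exists>N. \<forall>n\<ge>N. norm (nrm (h n - p) - 0) < e"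
      using e by (intro exI[of _ N]) (auto simp: cfun_diff intro: le_less_trans[of _ "e/2"])
  qed
  have convl: "(\<lambda>n. (h n \<star> g) t) \<longlonglongrightarrow> (p \<star> g) t" if g: "g \<in> cfun T" for g t
  proof (rule Lim_transform2[OF tendsto_const])
    have "norm ((p \<star> g) t - (h n \<star> g) t) \<le> nrm (h n - p) * nrm g" for n
      using norm_conv_le_nrm[of "h n - p" g t] g
      by (simp add: cfun_diff conv_diff_left norm_minus_commute)
    then show "(\<lambda>n. (p \<star> g) t - (h n \<star> g) t) \<longlonglongrightarrow> 0"
      by (rule Lim_null_comparison[OF always_eventually[OF allI]]) (use tendsto_mult_left_zero[OF nlim] in auto)
  qed
  have convr: "(\<lambda>n. (g \<star> h n) t) \<longlonglongrightarrow> (g \<star> p) t" if g: "g \<in> cfun T" for g t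
  proof (rule Lim_transform2[OF tendsto_const])
    have "norm ((g \<star> p) t - (g \<star> h n) t) \<le> nrm (h n - p) * nrm g" for n
      using norm_conv_le_nrm[of g "h n - p" t] g
      by (simp add: cfun_diff conv_diff_right norm_minus_commute mult.commute)
    then show "(\<lambda>n. (g \<star> p) t - (g \<star> h n) t) \<longlonglongrightarrow> 0"
      by (rule Lim_null_comparison[OF always_eventually[OF allI]]) (use tendsto_mult_left_zero[OF nlim] in auto)
  qed
  have p\<kappa>: "p \<star> \<kappa> = p"
  proof
    fix t
    have "(\<lambda>n. h (Suc n) t) \<longlonglongrightarrow> p t" by (rule LIMSEQ_Suc[OF lim])
    then show "(p \<star> \<kappa>) t = p t" using convl[of \<kappa> t] by (simp add: hS LIMSEQ_unique)
  qed
  have p\<psi>: "p \<star> \<psi> = \<psi> \<star> p"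
  proof
    fix t
    show "(p \<star> \<psi>) t = (\<psi> \<star> p) t"
      using convl[OF \<psi>(1), of t] convr[OF \<psi>(1), of t] by (simp add: h_def comm LIMSEQ_unique)
  qed
  have adjp: "adj p = p"
  proof
    fix t
    have "(\<lambda>n. adj (h n) t) \<longlonglongrightarrow> adj p t"
      using tendsto_cnj[OF lim[of "inv t"]] by (auto simp: adj_def)
    then show "adj p t = p t" using lim[of t] by (simp add: h_def adjP LIMSEQ_unique)
  qed
  have ph: "p \<star> h n = p" for n
  proof (induction n)
    case 0
    then show ?case using p\<kappa> \<psi> by (simp add: h_def PS P0 \<kappa>_def)
  next
    case (Suc n)
    then show ?case using p\<kappa> by (simp add: hS flip: conv_asc)
  qed
  have pp: "p \<star> p = p"
  proof
    fix t show "(p \<star> p) t = p t" using convr[OF pm, of t] by (simp add: ph LIMSEQ_const_iff)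
  qed
  have "(nrm p)\<^sup>2 = Re (p \<one>)" using nrm_sq[OF pm] by (simp add: ip_eq_conv adjp pp)
  moreover have "Re (p \<one>) \<ge> 1"
  proof (rule LIMSEQ_le_const)
    show "(\<lambda>n. Re (h n \<one>)) \<longlonglongrightarrow> Re (p \<one>)" by (intro tendsto_Re lim)
    show "\<exists>N. \<forall>n\<ge>N. 1 \<le> Re (h n \<one>)"
      using ge1 by (simp add: h_def flip: yP) (simp add: y_def)
  qed
  ultimately have "(nrm p)\<^sup>2 \<ge> 1\<^sup>2" by simp
  then have "nrm p \<ge> 1" by (rule power2_le_imp_le) simp
  moreover have "p \<star> \<psi> \<star> \<psi> = p" using p\<kappa> \<psi> by (simp add: \<kappa>_def conv_asc)
  ultimately show ?thesis using that[of p] adjp pp p\<psi> pm unfolding projections_def by blast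
qed

definition proj_span :: "('a \<Rightarrow> complex) set" where
  "proj_span = fun_space.span {f \<in> cfun T. \<exists>p\<in>projections. f \<star> p = f}"

text \<open>Each step splits off the top spectral projection of \<open>\<psi>\<close>. While the
  convolution norm \<open>l\<close> exceeds \<open>e\<close>, this lowers
  \<open>(nrm \<psi>)\<^sup>2\<close> by at least \<open>l\<^sup>2 \<ge> e\<^sup>2\<close>, so
  \<open>N\<close> counts the steps that the norm can pay for. Once the convolution norm is at most
  \<open>e\<close>, the zero function is a good enough approximation.\<close>

lemma peter_weyl_approx:
  assumes e: "e > 0"
  shows "\<psi> \<in> cfun T \<Longrightarrow> adj \<psi> = \<psi> \<Longrightarrow> (nrm \<psi>)\<^sup>2 \<le> real N * e\<^sup>2 \<Longrightarrow> f \<in> cfun T \<Longrightarrow>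
    \<exists>g\<in>proj_span. nrm (f \<star> \<psi> - g) \<le> e * nrm f"
proof (induction N arbitrary: \<psi> f)
  case 0
  then have "nrm \<psi> = 0" by simp
  moreover have "0 \<le> e * nrm f" using e 0 by simp
  ultimately have "nrm (f \<star> \<psi> - 0) \<le> e * nrm f"
    using nrm_conv_le[of f \<psi>] 0 by simp
  then show ?case using fun_space.span_zero unfolding proj_span_def by blast
next
  case (Suc N)
  note \<psi> = Suc.prems(1,2)
  show ?case
  proof (cases "\<forall>f\<in>cfun T. nrm (f \<star> \<psi>) \<le> e * nrm f")
    case True
    then have "nrm (f \<star> \<psi> - 0) \<le> e * nrm f" using Suc.prems(4) by simp
    then show ?thesis using fun_space.span_zero unfolding proj_span_def by blast
  next
    case False
    then obtain f0 where f0: "f0 \<in> cfun T" "e * nrm f0 < nrm (f0 \<star> \<psi>)" by force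
    have f0n: "nrm f0 > 0"
      using f0 nrm_conv_le[OF f0(1) \<psi>(1)] nrm_nonneg[OF f0(1)] less_le[of 0 "nrm f0"]
      by (cases "nrm f0 = 0") auto
    \<comment> \<open>The ratios whose supremum \<open>l\<close> is the operator norm of right
      convolution by \<open>\<psi>\<close>.\<close>
    define Q where "Q = (\<lambda>f. nrm (f \<star> \<psi>) / nrm f) ` {f \<in> cfun T. nrm f > 0}"
    define l where "l = Sup Q"
    have bdd: "bdd_above Q"
      unfolding Q_def bdd_above_def
      using nrm_conv_le[OF _ \<psi>(1)] by (intro exI[of _ "nrm \<psi>"]) (auto simp: divide_le_eq mult.commute)
    have Qne: "Q \<noteq> {}" using f0 f0n by (auto simp: Q_def)
    have "e < nrm (f0 \<star> \<psi>) / nrm f0" using f0 f0n by (simp add: less_divide_eq)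
    also have "\<dots> \<le> l" unfolding l_def by (rule cSup_upper[OF _ bdd]) (use f0 f0n in \<open>auto simp: Q_def\<close>)
    finally have el: "e < l" .
    have l0: "l > 0" using e el by simp
    have lb: "nrm (h \<star> \<psi>) \<le> l * nrm h" if h: "h \<in> cfun T" for h
    proof (cases "nrm h = 0")
      case True
      then show ?thesis using nrm_conv_le[OF h \<psi>(1)] by simp
    next
      case False
      then have "nrm h > 0" using nrm_nonneg[OF h] by simp
      then have "nrm (h \<star> \<psi>) / nrm h \<le> l"
        unfolding l_def using h by (intro cSup_upper[OF _ bdd]) (auto simp: Q_def)
      then show ?thesis using \<open>nrm h > 0\<close> by (simp add: divide_le_eq)
    qed
    define \<psi>1 where "\<psi>1 = fscale (of_real (1 / l)) \<psi>"
    have \<psi>1: "\<psi>1 \<in> cfun T" "adj \<psi>1 = \<psi>1" using \<psi> by (simp_all add: \<psi>1_def cfun_fscale adj_fscale)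
    have n1: "nrm (h \<star> \<psi>1) = nrm (h \<star> \<psi>) / l" if "h \<in> cfun T" for h
      using that \<psi> l0 by (simp add: \<psi>1_def self.conv_fscale_right nrm_fscale norm_divide)
    obtain p where p: "p \<in> projections" "p \<star> \<psi>1 = \<psi>1 \<star> p" "p \<star> \<psi>1 \<star> \<psi>1 = p" "nrm p \<ge> 1"
    proof (rule top_projection[OF \<psi>1])
      show "nrm (h \<star> \<psi>1) \<le> nrm h" if "h \<in> cfun T" for h
        using lb[OF that] l0 that by (simp add: n1 divide_le_eq mult.commute)
      show "\<exists>h\<in>cfun T. \<eta> * nrm h < nrm (h \<star> \<psi>1)" if \<eta>: "\<eta> < 1" for \<eta>
      proof -
        have "\<eta> * l < l" using \<eta> l0 by simp
        then obtain q where "q \<in> Q" "\<eta> * l < q"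
          unfolding l_def using less_cSup_iff[OF Qne bdd] by blast
        then obtain h where h: "h \<in> cfun T" "nrm h > 0" "\<eta> * l < nrm (h \<star> \<psi>) / nrm h"
          by (auto simp: Q_def)
        then have "\<eta> * nrm h < nrm (h \<star> \<psi>1)"
          using l0 by (simp add: n1 less_divide_eq mult_ac)
        then show ?thesis using h by blast
      qed
    qed
    have pm: "p \<in> cfun T" "adj p = p" "p \<star> p = p" using p(1) by (simp_all add: projections_def)
    have \<psi>_eq: "\<psi> = fscale (of_real l) \<psi>1" using l0 by (simp add: \<psi>1_def fscale_def)
    have comm: "p \<star> \<psi> = \<psi> \<star> p"
      using p(2) pm \<psi>1 by (simp add: \<psi>_eq self.conv_fscale_left self.conv_fscale_right)
    define \<psi>' where "\<psi>' = \<psi> - \<psi> \<star> p"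
    have \<psi>'m: "\<psi>' \<in> cfun T" "adj \<psi>' = \<psi>'"
      using \<psi> pm comm by (simp_all add: \<psi>'_def cfun_diff adj_diff adj_conv)
    have orth: "ip \<psi>' (\<psi> \<star> p) = 0"
    proof -
      have "ip \<psi>' (\<psi> \<star> p) = ip (\<psi>' \<star> p) \<psi>"
        using ip_conv_left[of \<psi>' p \<psi>] \<psi>'m pm \<psi> by simp
      also have "\<psi>' \<star> p = 0"
        using \<psi> pm by (simp add: \<psi>'_def conv_diff_left conv_asc)
      finally show ?thesis by (simp add: ip_def haar_const)
    qed
    have "\<psi> = \<psi>' + \<psi> \<star> p" by (simp add: \<psi>'_def)
    then have "ip \<psi> \<psi> = ip (\<psi>' + \<psi> \<star> p) (\<psi>' + \<psi> \<star> p)" by simp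
    also have "\<dots> = ip \<psi>' \<psi>' + ip (\<psi> \<star> p) (\<psi> \<star> p)"
      using \<psi>'m \<psi> pm orth ip_sym[of \<psi>' "\<psi> \<star> p"]
      by (simp add: ip_add_left ip_add_right cfun_add)
    finally have pyth: "(nrm \<psi>)\<^sup>2 = (nrm \<psi>')\<^sup>2 + (nrm (\<psi> \<star> p))\<^sup>2"
      using \<psi> \<psi>'m pm by (simp add: nrm_sq)
    have "(nrm (\<psi>1 \<star> p))\<^sup>2 = Re (ip (p \<star> \<psi>1) (p \<star> \<psi>1))"
      using p(2) \<psi>1 pm by (simp add: nrm_sq)
    also have "\<dots> = Re (ip (p \<star> \<psi>1 \<star> \<psi>1) p)"
      using ip_conv_left[of "p \<star> \<psi>1" \<psi>1 p] \<psi>1 pm by simp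
    also have "\<dots> = (nrm p)\<^sup>2" using p(3) pm by (simp add: nrm_sq)
    finally have "(nrm (\<psi>1 \<star> p))\<^sup>2 \<ge> 1" using p(4) by simp
    moreover have "nrm (\<psi> \<star> p) = l * nrm (\<psi>1 \<star> p)"
      using l0 \<psi>1 pm by (simp add: \<psi>_eq self.conv_fscale_left nrm_fscale)
    ultimately have "(nrm (\<psi> \<star> p))\<^sup>2 \<ge> l\<^sup>2"
      using l0 by (simp add: power_mult_distrib mult_le_cancel_left1)
    moreover have "l\<^sup>2 \<ge> e\<^sup>2" using el e by (intro power_mono) auto
    ultimately have "(nrm \<psi>')\<^sup>2 \<le> real N * e\<^sup>2"
      using pyth Suc.prems(3) by (simp add: algebra_simps)
    then obtain g where g: "g \<in> proj_span" "nrm (f \<star> \<psi>' - g) \<le> e * nrm f"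
      using Suc.IH[OF \<psi>'m _ Suc.prems(4)] by blast
    have "f \<star> \<psi> \<star> p \<star> p = f \<star> \<psi> \<star> p"
      using Suc.prems(4) \<psi> pm by (simp add: conv_asc)
    then have fp: "f \<star> \<psi> \<star> p \<in> proj_span"
      unfolding proj_span_def using p(1) Suc.prems(4) \<psi> pm by (intro fun_space.span_base) auto
    have "f \<star> \<psi>' = f \<star> \<psi> - f \<star> \<psi> \<star> p"
      using Suc.prems(4) \<psi> pm by (simp add: \<psi>'_def conv_diff_right conv_asc)
    then have eq: "f \<star> \<psi> - (g + f \<star> \<psi> \<star> p) = f \<star> \<psi>' - g" by (simp add: algebra_simps)
    have "nrm (f \<star> \<psi> - (g + f \<star> \<psi> \<star> p)) \<le> e * nrm f"
      unfolding eq by (rule g(2))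
    moreover have "g + f \<star> \<psi> \<star> p \<in> proj_span"
      using g(1) fp unfolding proj_span_def by (rule fun_space.span_add)
    ultimately show ?thesis by blast
  qed
qed

end

section \<open>Decomposition into irreducible representations\<close>

context compact_action
begin

text \<open>An intertwiner from \<open>\<alpha>\<close> into the functions on the space, recorded by
  the images of the standard basis vectors. It may be zero, and its entries from index
  \<open>d\<close> on are unconstrained.\<close>

definition mor :: "nat \<Rightarrow> ('a \<Rightarrow> complex mat) \<Rightarrow> (nat \<Rightarrow> 'x \<Rightarrow> complex) set" where
  "mor d \<alpha> = {e. (\<forall>i<d. e i \<in> cfun TX) \<and>
     (\<forall>s\<in>carrier G. \<forall>i<d. trans s (e i) = (\<Sum>j<d. fscale (\<alpha> s $$ (j, i)) (e j)))}"

definition comps :: "nat \<Rightarrow> ('a \<Rightarrow> complex mat) \<Rightarrow> ('x \<Rightarrow> complex) set" where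
  "comps d \<alpha> = {e i |e i. e \<in> mor d \<alpha> \<and> i < d}"

end

section \<open>Finite-dimensional invariant spaces of functions on the group\<close>

context compact_group
begin

text \<open>Evaluating the intertwining relation at \<open>\<one>\<close> shows that
  \<open>e i (inv s)\<close> is a linear combination of the entries
  \<open>\<alpha> s $$ (j, i)\<close>: these functions are matrix coefficients at inverses.\<close>

definition coefs :: "('a \<Rightarrow> complex) set" where
  "coefs = {f. \<exists>d \<alpha>. irreducible_representation G T d \<alpha> \<and> f \<in> self.comps d \<alpha>}"

definition inv_sub :: "('a \<Rightarrow> complex) set \<Rightarrow> bool" where
  "inv_sub Y \<longleftrightarrow> Y \<subseteq> cfun T \<and> fun_space.subspace Y \<and> (\<forall>s\<in>carrier G. \<forall>f\<in>Y. self.trans s f \<in> Y)"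

definition ons :: "('a \<Rightarrow> complex) set \<Rightarrow> nat \<Rightarrow> (nat \<Rightarrow> 'a \<Rightarrow> complex) \<Rightarrow> bool" where
  "ons Y n e \<longleftrightarrow> (\<forall>i<n. e i \<in> Y) \<and> (\<forall>i<n. \<forall>j<n. ip (e i) (e j) = (if i = j then 1 else 0))"

text \<open>Dimension is encoded as the maximal length of an orthonormal system, so bounding such
  lengths is all that finite dimensionality amounts to.\<close>

definition maxons :: "('a \<Rightarrow> complex) set \<Rightarrow> nat \<Rightarrow> bool" where
  "maxons Y n \<longleftrightarrow> (\<exists>e. ons Y n e) \<and> (\<forall>k e. ons Y k e \<longrightarrow> k \<le> n)"

lemma cfun_sum: "(\<And>i. i \<in> I \<Longrightarrow> f i \<in> cfun T) \<Longrightarrow> (\<Sum>i\<in>I. fscale (c i) (f i)) \<in> cfun T"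
  by (intro fun_space.subspace_sum[OF self.subspace_cfun] cfun_fscale)

lemma ip_sum_left:
  assumes "\<And>i. i \<in> I \<Longrightarrow> f i \<in> cfun T" "h \<in> cfun T"
  shows "ip (\<Sum>i\<in>I. fscale (c i) (f i)) h = (\<Sum>i\<in>I. c i * ip (f i) h)"
  using assms
proof (induction I rule: infinite_finite_induct)
  case (insert i I)
  have "(\<Sum>i\<in>I. fscale (c i) (f i)) \<in> cfun T" by (rule cfun_sum) (use insert in auto)
  then show ?case unfolding sum.insert[OF insert(1,2)]
    using insert by (subst ip_add_left) (auto simp: ip_fscale_left cfun_fscale)
qed (auto simp: ip_def haar_const)

lemma ip_sum_right:
  assumes "\<And>i. i \<in> I \<Longrightarrow> f i \<in> cfun T" "h \<in> cfun T"
  shows "ip h (\<Sum>i\<in>I. fscale (c i) (f i)) = (\<Sum>i\<in>I. cnj (c i) * ip h (f i))"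
proof -
  have "ip h (\<Sum>i\<in>I. fscale (c i) (f i)) = cnj (ip (\<Sum>i\<in>I. fscale (c i) (f i)) h)"
    using assms by (intro ip_sym cfun_sum)
  also have "\<dots> = (\<Sum>i\<in>I. cnj (c i) * cnj (ip (f i) h))"
    using assms by (simp add: ip_sum_left)
  also have "\<dots> = (\<Sum>i\<in>I. cnj (c i) * ip h (f i))"
    by (rule sum.cong[OF refl]) (use assms ip_sym in metis)
  finally show ?thesis .
qed

definition proj_on :: "nat \<Rightarrow> (nat \<Rightarrow> 'a \<Rightarrow> complex) \<Rightarrow> ('a \<Rightarrow> complex) \<Rightarrow> 'a \<Rightarrow> complex" where
  "proj_on n e f = (\<Sum>i<n. fscale (ip f (e i)) (e i))"

lemma ons_coef:
  assumes "ons (cfun T) n e" "i < n"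
  shows "ip (\<Sum>j<n. fscale (c j) (e j)) (e i) = c i"
proof -
  have "ip (\<Sum>j<n. fscale (c j) (e j)) (e i) = (\<Sum>j<n. c j * ip (e j) (e i))"
    using assms by (intro ip_sum_left) (auto simp: ons_def)
  also have "\<dots> = (\<Sum>j<n. if j = i then c j else 0)"
    using assms by (intro sum.cong) (auto simp: ons_def)
  finally show ?thesis using assms by simp
qed

lemma ons_mono: "ons Y n e \<Longrightarrow> Y \<subseteq> Z \<Longrightarrow> ons Z n e"
  by (auto simp: ons_def)

lemma proj_on_orth:
  assumes e: "ons (cfun T) n e" and f: "f \<in> cfun T" and i: "i < n"
  shows "ip (f - proj_on n e f) (e i) = 0"
proof -
  have "proj_on n e f \<in> cfun T" unfolding proj_on_def using e by (intro cfun_sum) (auto simp: ons_def)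
  then show ?thesis
    using ons_coef[OF e i, of "\<lambda>i. ip f (e i)"] e f i
    by (simp add: ip_diff_left proj_on_def ons_def)
qed

lemma bessel:
  assumes e: "ons (cfun T) n e" and f: "f \<in> cfun T"
  shows "(\<Sum>i<n. (norm (ip f (e i)))\<^sup>2) \<le> (nrm f)\<^sup>2"
proof -
  let ?P = "proj_on n e f"
  have em: "e i \<in> cfun T" if "i < n" for i using e that by (auto simp: ons_def)
  have P: "?P \<in> cfun T" unfolding proj_on_def using em by (intro cfun_sum) auto
  have fP: "f - ?P \<in> cfun T" using f P by (rule cfun_diff)
  have gP: "ip h ?P = (\<Sum>i<n. cnj (ip f (e i)) * ip h (e i))" if "h \<in> cfun T" for h
    unfolding proj_on_def by (rule ip_sum_right) (use em that in auto)
  have 1: "ip f ?P = of_real (\<Sum>i<n. (norm (ip f (e i)))\<^sup>2)"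
    unfolding gP[OF f] by (simp only: of_real_sum complex_norm_square mult.commute)
  have 2: "ip (f - ?P) ?P = 0"
    unfolding gP[OF fP] using proj_on_orth[OF e f] by simp
  have "ip (f - ?P) (f - ?P) = ip f f - ip ?P f - ip (f - ?P) ?P"
    using f P fP by (subst ip_diff_right) (auto simp: ip_diff_left)
  also have "\<dots> = ip f f - cnj (ip f ?P)" unfolding 2 ip_sym[OF f P] by simp
  finally have "Re (ip f f) = Re (ip (f - ?P) (f - ?P)) + (\<Sum>i<n. (norm (ip f (e i)))\<^sup>2)"
    by (simp add: 1)
  then show ?thesis using ip_self_nonneg[OF fP] nrm_sq[OF f] by simp
qed

text \<open>The kernel \<open>p\<close> reproduces its range: \<open>e i t\<close> is the inner
  product of \<open>e i\<close> with the translate of \<open>p\<close> by \<open>t\<close>. Bessel's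
  inequality for that translate bounds the sum of \<open>(norm (e i t))\<^sup>2\<close> at every
  \<open>t\<close>, and its mean over \<open>t\<close> is \<open>n\<close>.\<close>

lemma ons_projection_bound:
  assumes p: "p \<in> projections" and e: "ons {f \<in> cfun T. f \<star> p = f} n e"
  shows "real n \<le> (nrm p)\<^sup>2"
proof -
  have pm: "p \<in> cfun T" "adj p = p" using p by (auto simp: projections_def)
  have em: "e i \<in> cfun T" "e i \<star> p = e i" if "i < n" for i using e that by (auto simp: ons_def)
  have e': "ons (cfun T) n e" using e by (auto simp: ons_def)
  have pt: "(\<Sum>i<n. (norm (e i t))\<^sup>2) \<le> (nrm p)\<^sup>2" if t: "t \<in> carrier G" for t
  proof -
    have "norm (e i t) = norm (ip (self.trans t p) (e i))" if i: "i < n" for i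
    proof -
      have "e i t = ip (e i) (self.trans t p)"
        using conv_eq_ip[OF em(1)[OF i] pm(1) t] em(2)[OF i] pm by simp
      also have "\<dots> = cnj (ip (self.trans t p) (e i))"
        using em(1)[OF i] pm t by (intro ip_sym self.trans_cfun)
      finally show ?thesis by simp
    qed
    then show ?thesis
      using bessel[OF e' self.trans_cfun[OF t pm(1)]] nrm_trans[OF pm(1) t] by simp
  qed
  have c: "cfunG (\<lambda>t. \<Sum>i<n. e i t * cnj (e i t))"
    using em by (intro continuous_map_sum continuous_intros cfunT) auto
  have "haar (\<lambda>t. \<Sum>i<n. e i t * cnj (e i t)) = (\<Sum>i<n. ip (e i) (e i))"
    unfolding ip_def using em by (intro haar_sum) (auto intro!: continuous_intros)
  also have "\<dots> = of_nat n" using e by (simp add: ons_def)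
  finally have h: "haar (\<lambda>t. \<Sum>i<n. e i t * cnj (e i t)) = of_nat n" .
  have sq: "(\<Sum>i<n. e i t * cnj (e i t)) = of_real (\<Sum>i<n. (norm (e i t))\<^sup>2)" for t
    by (simp only: of_real_sum complex_norm_square)
  have "norm (haar (\<lambda>t. \<Sum>i<n. e i t * cnj (e i t))) \<le> Re (haar (\<lambda>t. of_real ((nrm p)\<^sup>2)))"
  proof (rule haar_norm_le[OF c])
    show "norm (\<Sum>i<n. e i t * cnj (e i t)) \<le> Re (of_real ((nrm p)\<^sup>2))" if "t \<in> carrier G" for t
      unfolding sq norm_of_real Re_complex_of_real using pt[OF that] by (simp add: sum_nonneg)
  qed (intro continuous_intros)
  then show ?thesis by (simp add: h haar_const)
qed

lemma maxons_exists:
  assumes "\<And>n e. ons Y n e \<Longrightarrow> n \<le> N"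
  obtains n where "maxons Y n" "n \<le> N"
proof -
  have 0: "\<exists>e. ons Y 0 e" by (simp add: ons_def)
  have b: "\<And>n. \<exists>e. ons Y n e \<Longrightarrow> n \<le> N" using assms by blast
  define n where "n = (GREATEST n. \<exists>e. ons Y n e)"
  have "\<exists>e. ons Y n e" unfolding n_def
    by (rule GreatestI_nat[where P = "\<lambda>n. \<exists>e. ons Y n e", OF 0]) (use b in auto)
  moreover have "\<forall>k e. ons Y k e \<longrightarrow> k \<le> n"
    unfolding n_def using Greatest_le_nat[of "\<lambda>n. \<exists>e. ons Y n e" _ N] b by blast
  ultimately have "maxons Y n" by (simp add: maxons_def)
  moreover have "n \<le> N" using calculation assms by (auto simp: maxons_def)
  ultimately show ?thesis by (rule that)
qed

text \<open>A nonzero remainder could be normalized and appended to the system, against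
  maximality.\<close>

lemma maxons_expand:
  assumes Y: "Y \<subseteq> cfun T" "fun_space.subspace Y" and n: "maxons Y n" and e: "ons Y n e" and f: "f \<in> Y"
  shows "f = proj_on n e f"
proof (rule ccontr)
  assume ne: "f \<noteq> proj_on n e f"
  have em: "e i \<in> Y" if "i < n" for i using e that by (auto simp: ons_def)
  define g where "g = f - proj_on n e f"
  have "proj_on n e f \<in> Y" unfolding proj_on_def
    using Y(2) em by (intro fun_space.subspace_sum fun_space.subspace_scale) auto
  then have gY: "g \<in> Y" unfolding g_def using Y(2) f fun_space.subspace_diff by blast
  have gT: "g \<in> cfun T" using gY Y by blast
  have "nrm g \<noteq> 0" using ip_self_0[OF gT] ne by (auto simp: g_def)
  define u where "u = fscale (of_real (1 / nrm g)) g"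
  have uY: "u \<in> Y" unfolding u_def by (rule fun_space.subspace_scale[OF Y(2) gY])
  have uT: "u \<in> cfun T" using uY Y by blast
  have "nrm u = 1" using gT \<open>nrm g \<noteq> 0\<close> by (simp add: u_def nrm_fscale norm_divide)
  then have uu: "ip u u = 1" using ip_self[OF uT] by simp
  have e': "ons (cfun T) n e" using e Y by (auto simp: ons_def)
  have ue: "ip u (e i) = 0" if i: "i < n" for i
  proof -
    have "ip g (e i) = 0" unfolding g_def by (rule proj_on_orth[OF e' _ i]) (use f Y in blast)
    then show ?thesis using gT em[OF i] Y(1) by (simp add: u_def ip_fscale_left subset_iff)
  qed
  have eu: "ip (e i) u = 0" if i: "i < n" for i
    using ip_sym[OF uT, of "e i"] ue[OF i] em[OF i] Y by auto
  have "ons Y (Suc n) (e(n := u))"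
    using e uY uu ue eu by (auto simp: ons_def less_Suc_eq)
  then show False using n unfolding maxons_def by (meson not_less_eq_eq order_refl)
qed

lemma subspace_0: "fun_space.subspace Y \<Longrightarrow> 0 \<in> Y"
  by (rule fun_space.subspace_0)

lemma trans_coef_continuous:
  assumes f: "f \<in> cfun T" and g: "g \<in> cfun T"
  shows "cfunG (\<lambda>s. ip (self.trans s f) g)"
proof -
  have "continuous_map (prod_topology T T) euclidean (\<lambda>(s, t). f (inv s \<otimes> t) * cnj (g t))"
    unfolding split_beta
    by (intro continuous_map_cmult continuous_map_cnj self.cfun_act_cont[OF f] continuous_inv'
        continuous_map_fst continuous_map_snd continuous_map_compose[OF continuous_map_snd cfunT[OF g], unfolded o_def])
  from haar_continuous[OF compact_T this]
  show ?thesis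
    by (rule continuous_map_eq)
       (auto simp: ip_def self.trans_apply topspace_eq intro!: haar_cong)
qed

text \<open>Among the nonzero invariant subspaces of \<open>Y\<close> take \<open>Z\<close> of least
  dimension. The matrices of the translations in an orthonormal basis of \<open>Z\<close> form the
  representation; an invariant subspace of coordinate vectors corresponds to an invariant subspace
  of \<open>Z\<close>, which leaves no proper nonzero choice.\<close>

lemma irreducible_system:
  assumes Y: "inv_sub Y" "Y \<noteq> {0}" and bound: "\<And>n e. ons Y n e \<Longrightarrow> n \<le> N"
  obtains d \<alpha> e where "irreducible_representation G T d \<alpha>" "e \<in> self.mor d \<alpha>" "ons Y d e"
proof -
  define P where "P m \<longleftrightarrow> (\<exists>Z. inv_sub Z \<and> Z \<subseteq> Y \<and> Z \<noteq> {0} \<and> maxons Z m)" for m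
  have ex: "\<exists>m. maxons Z m" if "Z \<subseteq> Y" for Z
  proof (rule maxons_exists[of Z N])
    show "n \<le> N" if "ons Z n e" for n e using bound ons_mono[OF that \<open>Z \<subseteq> Y\<close>] .
    show "\<exists>m. maxons Z m" if "maxons Z n" for n using that by blast
  qed
  have "\<exists>m. P m" using ex[of Y] Y by (auto simp: P_def)
  then obtain d where d: "P d" and least: "\<And>m. P m \<Longrightarrow> d \<le> m"
    by (metis LeastI_ex Least_le)
  from d obtain Z where Z: "inv_sub Z" "Z \<subseteq> Y" "Z \<noteq> {0}" "maxons Z d" by (auto simp: P_def)
  have ZT: "Z \<subseteq> cfun T" and Zs: "fun_space.subspace Z"
    and Zt: "\<And>s f. s \<in> carrier G \<Longrightarrow> f \<in> Z \<Longrightarrow> self.trans s f \<in> Z"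
    using Z(1) by (auto simp: inv_sub_def)
  obtain e where e: "ons Z d e" using Z(4) by (auto simp: maxons_def)
  have em: "e i \<in> Z" if "i < d" for i using e that by (auto simp: ons_def)
  have emT: "e i \<in> cfun T" if "i < d" for i using em[OF that] ZT by blast
  have eT: "ons (cfun T) d e" using e ZT by (rule ons_mono)
  have exp: "f = (\<Sum>i<d. fscale (ip f (e i)) (e i))" if "f \<in> Z" for f
    using maxons_expand[OF ZT Zs Z(4) e that] by (simp add: proj_on_def)
  have d0: "d > 0"
  proof (rule ccontr)
    assume "\<not> d > 0"
    then have "Z \<subseteq> {0}" using exp by auto
    then show False using Z(3) subspace_0[OF Zs] by blast
  qed
  define \<alpha> where "\<alpha> s = mat d d (\<lambda>(j, i). ip (self.trans s (e i)) (e j))" for s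
  have te: "self.trans s (e i) = (\<Sum>j<d. fscale (\<alpha> s $$ (j, i)) (e j))"
    if s: "s \<in> carrier G" and i: "i < d" for s i
  proof -
    have "self.trans s (e i) = (\<Sum>j<d. fscale (ip (self.trans s (e i)) (e j)) (e j))"
      by (rule exp[OF Zt[OF s em[OF i]]])
    then show ?thesis using i by (simp add: \<alpha>_def)
  qed
  have mor: "e \<in> self.mor d \<alpha>" using te emT by (simp add: self.mor_def)
  have rep: "representation G T d \<alpha>"
    unfolding representation_def
  proof (intro conjI ballI allI impI)
    show "\<alpha> s \<in> carrier_mat d d" for s by (simp add: \<alpha>_def)
    show "\<alpha> \<one> = 1\<^sub>m d"
      by (rule eq_matI) (use eT emT in \<open>auto simp: \<alpha>_def self.trans_one ons_def\<close>)
    fix s t assume s: "s \<in> carrier G" and t: "t \<in> carrier G"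
    show "\<alpha> (s \<otimes> t) = \<alpha> s * \<alpha> t"
    proof (rule eq_matI)
      fix k i assume "k < dim_row (\<alpha> s * \<alpha> t)" "i < dim_col (\<alpha> s * \<alpha> t)"
      then have k: "k < d" and i: "i < d" by (auto simp: \<alpha>_def)
      have "\<alpha> (s \<otimes> t) $$ (k, i) = ip (self.trans s (self.trans t (e i))) (e k)"
        using s t k i by (simp add: \<alpha>_def self.trans_mult)
      also have "self.trans s (self.trans t (e i)) = (\<Sum>j<d. fscale (\<alpha> t $$ (j, i)) (self.trans s (e j)))"
        using te[OF t i] by (simp add: self.trans_sum self.trans_fscale)
      also have "ip \<dots> (e k) = (\<Sum>j<d. \<alpha> t $$ (j, i) * ip (self.trans s (e j)) (e k))"
        using emT k s by (intro ip_sum_left self.trans_cfun) auto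
      also have "\<dots> = (\<alpha> s * \<alpha> t) $$ (k, i)"
        using k i by (auto simp: \<alpha>_def scalar_prod_def lessThan_atLeast0 mult.commute intro!: sum.cong)
      finally show "\<alpha> (s \<otimes> t) $$ (k, i) = (\<alpha> s * \<alpha> t) $$ (k, i)" .
    qed (auto simp: \<alpha>_def)
  next
    fix j i assume "j < d" "i < d"
    then show "cfunG (\<lambda>s. \<alpha> s $$ (j, i))"
      using trans_coef_continuous[OF emT emT] by (simp add: \<alpha>_def)
  qed
  have irr: "W = {0\<^sub>v d} \<or> W = carrier_vec d"
    if W: "linear_subspace d W" and inv: "\<forall>s\<in>carrier G. \<forall>v\<in>W. \<alpha> s *\<^sub>v v \<in> W" for W
  proof -
    define \<Psi> where "\<Psi> v = (\<Sum>i<d. fscale (v $ i) (e i))" for v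
    have WC: "W \<subseteq> carrier_vec d" and W0: "0\<^sub>v d \<in> W" and Wa: "\<And>v w. v \<in> W \<Longrightarrow> w \<in> W \<Longrightarrow> v + w \<in> W"
      and Ws: "\<And>c v. v \<in> W \<Longrightarrow> c \<cdot>\<^sub>v v \<in> W"
      using W by (auto simp: linear_subspace_def)
    have inj: "v = w" if "v \<in> carrier_vec d" "w \<in> carrier_vec d" "\<Psi> v = \<Psi> w" for v w
    proof (rule eq_vecI)
      fix i assume "i < dim_vec w"
      then have i: "i < d" using that by auto
      show "v $ i = w $ i"
        using ons_coef[OF eT i, of "\<lambda>i. v $ i"] ons_coef[OF eT i, of "\<lambda>i. w $ i"] that(3)
        by (simp add: \<Psi>_def)
    qed (use that in auto)
    have \<Psi>Z: "\<Psi> v \<in> Z" for v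
      unfolding \<Psi>_def using em by (intro fun_space.subspace_sum[OF Zs] fun_space.subspace_scale[OF Zs]) auto
    have \<Psi>0: "\<Psi> (0\<^sub>v d) = 0" by (simp add: \<Psi>_def)
    have \<Psi>a: "\<Psi> (v + w) = \<Psi> v + \<Psi> w" if "v \<in> carrier_vec d" "w \<in> carrier_vec d" for v w
      unfolding \<Psi>_def sum.distrib[symmetric] using that
      by (intro sum.cong) (auto simp: fun_space.scale_left_distrib)
    have \<Psi>s: "\<Psi> (c \<cdot>\<^sub>v v) = fscale c (\<Psi> v)" if "v \<in> carrier_vec d" for v c
      unfolding \<Psi>_def fun_space.scale_sum_right using that
      by (intro sum.cong) auto
    have \<Psi>t: "self.trans s (\<Psi> v) = \<Psi> (\<alpha> s *\<^sub>v v)" if v: "v \<in> carrier_vec d" and s: "s \<in> carrier G" for s v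
    proof -
      have "self.trans s (\<Psi> v) = (\<Sum>i<d. fscale (v $ i) (\<Sum>j<d. fscale (\<alpha> s $$ (j, i)) (e j)))"
        unfolding \<Psi>_def using te[OF s] by (simp add: self.trans_sum self.trans_fscale)
      also have "\<dots> = (\<Sum>i<d. \<Sum>j<d. fscale (v $ i * \<alpha> s $$ (j, i)) (e j))"
        by (simp add: fun_space.scale_sum_right)
      also have "\<dots> = (\<Sum>j<d. \<Sum>i<d. fscale (v $ i * \<alpha> s $$ (j, i)) (e j))"
        by (rule sum.swap)
      also have "\<dots> = (\<Sum>j<d. fscale (\<Sum>i<d. v $ i * \<alpha> s $$ (j, i)) (e j))"
        by (simp add: fun_space.scale_sum_left)
      also have "\<dots> = \<Psi> (\<alpha> s *\<^sub>v v)"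
        unfolding \<Psi>_def using v
        by (intro sum.cong) (auto simp: \<alpha>_def scalar_prod_def lessThan_atLeast0 mult.commute)
      finally show ?thesis .
    qed
    define Z' where "Z' = \<Psi> ` W"
    have Z'Z: "Z' \<subseteq> Z" using \<Psi>Z by (auto simp: Z'_def)
    have Z's: "fun_space.subspace Z'"
      unfolding fun_space.subspace_def Z'_def
    proof (intro conjI ballI allI)
      show "0 \<in> \<Psi> ` W" using W0 \<Psi>0 by (metis imageI)
      show "x + y \<in> \<Psi> ` W" if "x \<in> \<Psi> ` W" "y \<in> \<Psi> ` W" for x y
        using that \<Psi>a Wa WC by (smt (verit) image_iff subsetD)
      show "fscale c x \<in> \<Psi> ` W" if "x \<in> \<Psi> ` W" for c x
        using that \<Psi>s Ws WC by (smt (verit) image_iff subsetD)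
    qed
    have Z'i: "inv_sub Z'"
      unfolding inv_sub_def
    proof (intro conjI ballI)
      show "Z' \<subseteq> cfun T" using Z'Z ZT by blast
      fix s f assume s: "s \<in> carrier G" and "f \<in> Z'"
      then obtain v where v: "v \<in> W" "f = \<Psi> v" by (auto simp: Z'_def)
      then show "self.trans s f \<in> Z'" using \<Psi>t[OF _ s, of v] inv s WC by (auto simp: Z'_def)
    qed (rule Z's)
    show ?thesis
    proof (cases "Z' = {0}")
      case True
      have "v = 0\<^sub>v d" if "v \<in> W" for v
        using inj[of v "0\<^sub>v d"] that WC True \<Psi>0 by (auto simp: Z'_def)
      then show ?thesis using W0 by blast
    next
      case False
      \<comment> \<open>By minimality of \<open>d\<close> the nonzero \<open>Z'\<close> has an
        orthonormal system of length \<open>d\<close>; this system lies in \<open>Z\<close> and is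
        maximal there, so \<open>Z'\<close> is all of \<open>Z\<close>.\<close>
      obtain m where m: "maxons Z' m" using ex[of Z'] Z'Z Z(2) by blast
      have "Z' \<subseteq> Y" using Z'Z Z(2) by blast
      then have "P m" unfolding P_def using Z'i False m by (intro exI[of _ Z'] conjI)
      then have dm: "d \<le> m" by (rule least)
      obtain e' where e': "ons Z' m e'" using m by (auto simp: maxons_def)
      have e'Z: "ons Z m e'" using e' Z'Z by (rule ons_mono)
      then have "m \<le> d" using Z(4) by (auto simp: maxons_def)
      then have md: "m = d" using dm by simp
      have "Z \<subseteq> Z'"
      proof
        fix f assume "f \<in> Z"
        then have "f = proj_on d e' f" using maxons_expand[OF ZT Zs Z(4)] e'Z md by simp
        also have "\<dots> \<in> Z'" unfolding proj_on_def using e' md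
          by (intro fun_space.subspace_sum[OF Z's] fun_space.subspace_scale[OF Z's]) (auto simp: ons_def)
        finally show "f \<in> Z'" .
      qed
      have "v \<in> W" if v: "v \<in> carrier_vec d" for v
      proof -
        have "\<Psi> v \<in> Z'" using \<Psi>Z \<open>Z \<subseteq> Z'\<close> by blast
        then obtain w where "w \<in> W" "\<Psi> v = \<Psi> w" by (auto simp: Z'_def)
        then show ?thesis using inj[OF v, of w] WC by auto
      qed
      then show ?thesis using WC by blast
    qed
  qed
  have "irreducible_representation G T d \<alpha>"
    unfolding irreducible_representation_def using rep d0 irr by blast
  then show ?thesis using that mor ons_mono[OF e Z(2)] by blast
qed

text \<open>Translations preserve \<open>ip\<close>, so the orthogonal complement of an irreducible
  subspace is invariant and of smaller dimension; induct on the dimension.\<close>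

lemma inv_sub_subset_span_coefs:
  "inv_sub Y \<Longrightarrow> maxons Y N \<Longrightarrow> Y \<subseteq> fun_space.span coefs"
proof (induction N arbitrary: Y rule: less_induct)
  case (less N)
  note Y = less.prems(1)
  have YT: "Y \<subseteq> cfun T" and Ys: "fun_space.subspace Y"
    and Yt: "\<And>s f. s \<in> carrier G \<Longrightarrow> f \<in> Y \<Longrightarrow> self.trans s f \<in> Y"
    using Y by (auto simp: inv_sub_def)
  show ?case
  proof (cases "Y = {0}")
    case True
    then show ?thesis by (simp add: fun_space.span_zero)
  next
    case False
    have bound: "\<And>n e. ons Y n e \<Longrightarrow> n \<le> N" using less.prems(2) by (auto simp: maxons_def)
    obtain d \<alpha> e where e: "irreducible_representation G T d \<alpha>" "e \<in> self.mor d \<alpha>" "ons Y d e"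
      using irreducible_system[OF Y False, of N] bound by blast
    have d0: "d > 0" using e(1) by (simp add: irreducible_representation_def)
    have em: "e i \<in> Y" if "i < d" for i using e(3) that by (auto simp: ons_def)
    have emT: "e i \<in> cfun T" if "i < d" for i using em[OF that] YT by blast
    have ecoef: "e i \<in> fun_space.span coefs" if "i < d" for i
      using e(1,2) that by (intro fun_space.span_base) (auto simp: coefs_def self.comps_def)
    have te: "self.trans s (e i) = (\<Sum>j<d. fscale (\<alpha> s $$ (j, i)) (e j))"
      if "s \<in> carrier G" "i < d" for s i
      using e(2) that by (auto simp: self.mor_def)
    define Y' where "Y' = {f \<in> Y. \<forall>i<d. ip f (e i) = 0}"
    have Y's: "fun_space.subspace Y'"
      unfolding fun_space.subspace_def
    proof (intro conjI ballI allI)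
      show "0 \<in> Y'" using subspace_0[OF Ys] by (auto simp: Y'_def ip_def haar_const)
      show "x + y \<in> Y'" if "x \<in> Y'" "y \<in> Y'" for x y
      proof -
        have "x + y \<in> Y" using that fun_space.subspace_add[OF Ys] by (auto simp: Y'_def)
        moreover have "ip (x + y) (e i) = 0" if "i < d" for i
          using \<open>x \<in> Y'\<close> \<open>y \<in> Y'\<close> emT[OF that] YT that by (subst ip_add_left) (auto simp: Y'_def)
        ultimately show ?thesis by (simp add: Y'_def)
      qed
      show "fscale c x \<in> Y'" if "x \<in> Y'" for c x
      proof -
        have "fscale c x \<in> Y" using that fun_space.subspace_scale[OF Ys] by (auto simp: Y'_def)
        moreover have "ip (fscale c x) (e i) = 0" if "i < d" for i
          using \<open>x \<in> Y'\<close> emT[OF that] YT that by (subst ip_fscale_left) (auto simp: Y'_def)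
        ultimately show ?thesis by (simp add: Y'_def)
      qed
    qed
    have Y'i: "inv_sub Y'"
      unfolding inv_sub_def
    proof (intro conjI ballI)
      show "Y' \<subseteq> cfun T" using YT by (auto simp: Y'_def)
      fix s f assume s: "s \<in> carrier G" and f: "f \<in> Y'"
      have fT: "f \<in> cfun T" using f YT by (auto simp: Y'_def)
      have "ip (self.trans s f) (e i) = 0" if i: "i < d" for i
      proof -
        have "e i = self.trans s (self.trans (inv s) (e i))"
          using s emT[OF i] by (simp add: self.trans_mult self.trans_one)
        then have "ip (self.trans s f) (e i) = ip (self.trans s f) (self.trans s (self.trans (inv s) (e i)))"
          by simp
        also have "\<dots> = ip f (self.trans (inv s) (e i))"
          using fT emT[OF i] s by (intro ip_trans self.trans_cfun) auto
        also have "\<dots> = (\<Sum>j<d. cnj (\<alpha> (inv s) $$ (j, i)) * ip f (e j))"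
          unfolding te[OF inv_closed[OF s] i] by (rule ip_sum_right) (use emT fT in auto)
        also have "\<dots> = 0" using f by (simp add: Y'_def)
        finally show ?thesis .
      qed
      then show "self.trans s f \<in> Y'" using f Yt[OF s] by (simp add: Y'_def)
    qed (rule Y's)
    \<comment> \<open>A system in the complement can be extended by \<open>e 0\<close>, hence its
      length is strictly below \<open>N\<close>.\<close>
    have b': "Suc k \<le> N" if k: "ons Y' k u" for k u
    proof (rule bound)
      have uT: "u i \<in> Y" "u i \<in> cfun T" "ip (u i) (e 0) = 0" if "i < k" for i
        using k that YT d0 by (auto simp: ons_def Y'_def)
      have "ip (e 0) (u i) = 0" if "i < k" for i
        using ip_sym[OF uT(2)[OF that] emT[OF d0]] uT(3)[OF that] by simp
      then show "ons Y (Suc k) (u(k := e 0))"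
        using k uT em[OF d0] e(3) d0 by (auto simp: ons_def less_Suc_eq)
    qed
    then have "ons Y' k u \<Longrightarrow> k \<le> N" for k u using Suc_leD by blast
    then obtain m where m: "maxons Y' m" by (rule maxons_exists)
    have "m < N" using b' m unfolding maxons_def Suc_le_eq by blast
    then have Y'c: "Y' \<subseteq> fun_space.span coefs" using less.IH Y'i m by blast
    have eT: "ons (cfun T) d e" using e(3) YT by (rule ons_mono)
    show ?thesis
    proof
      fix f assume f: "f \<in> Y"
      have pY: "proj_on d e f \<in> Y" unfolding proj_on_def using em
        by (intro fun_space.subspace_sum[OF Ys] fun_space.subspace_scale[OF Ys]) auto
      have "f - proj_on d e f \<in> Y'"
        unfolding Y'_def using proj_on_orth[OF eT] f YT fun_space.subspace_diff[OF Ys f pY] by auto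
      then have 1: "f - proj_on d e f \<in> fun_space.span coefs" using Y'c by blast
      have 2: "proj_on d e f \<in> fun_space.span coefs"
        unfolding proj_on_def using ecoef by (intro fun_space.span_sum fun_space.span_scale) auto
      show "f \<in> fun_space.span coefs" using fun_space.span_add[OF 1 2] by simp
    qed
  qed
qed

text \<open>The range of a projection is invariant because right convolution commutes with left
  translation, and finite dimensional by \<open>ons_projection_bound\<close>.\<close>

lemma proj_span_subset_coefs: "proj_span \<subseteq> fun_space.span coefs"
  unfolding proj_span_def
proof (rule fun_space.span_minimal[OF _ fun_space.subspace_span], rule subsetI)
  fix f assume "f \<in> {f \<in> cfun T. \<exists>p\<in>projections. f \<star> p = f}"
  then obtain p where p: "p \<in> projections" and f: "f \<in> cfun T" "f \<star> p = f" by blast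
  have pm: "p \<in> cfun T" using p by (simp add: projections_def)
  define Y where "Y = {f \<in> cfun T. f \<star> p = f}"
  have "inv_sub Y"
    unfolding inv_sub_def
  proof (intro conjI ballI)
    show "fun_space.subspace Y"
      unfolding fun_space.subspace_def
    proof (intro conjI ballI allI)
      show "0 \<in> Y" using cfun_0 by (auto simp: Y_def self.conv_def fun_eq_iff haar_const)
      show "x + y \<in> Y" if "x \<in> Y" "y \<in> Y" for x y
        using that pm by (simp add: Y_def cfun_add self.conv_add_left)
      show "fscale c x \<in> Y" if "x \<in> Y" for c x
        using that pm by (simp add: Y_def cfun_fscale self.conv_fscale_left)
    qed
    fix s g assume s: "s \<in> carrier G" and g: "g \<in> Y"
    have "self.trans s g \<star> p = (\<lambda>r. g (inv s \<otimes> r)) \<star> p"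
      by (rule self.conv_cong) (simp add: self.trans_apply topspace_eq)
    also have "\<dots> = self.trans s (g \<star> p)"
      using g pm s by (intro self.trans_conv[symmetric]) (auto simp: Y_def)
    finally show "self.trans s g \<in> Y" using g s by (simp add: Y_def self.trans_cfun)
  qed (auto simp: Y_def)
  moreover have "n \<le> nat \<lfloor>(nrm p)\<^sup>2\<rfloor>" if "ons Y n e" for n e
    using ons_projection_bound[OF p, of n e] that by (simp add: Y_def le_nat_floor)
  then obtain m where "maxons Y m" by (rule maxons_exists)
  ultimately have "Y \<subseteq> fun_space.span coefs" by (rule inv_sub_subset_span_coefs)
  then show "f \<in> fun_space.span coefs" using f by (auto simp: Y_def)
qed

lemma span_coefs_cfun: "fun_space.span coefs \<subseteq> cfun T"
  by (rule fun_space.span_minimal[OF _ self.subspace_cfun])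
     (auto simp: coefs_def self.comps_def self.mor_def)

text \<open>The approximated functions have the smoothed form \<open>f \<star> \<psi>\<close>. The
  application takes both factors to be the same bump function.\<close>

theorem peter_weyl:
  assumes "\<psi> \<in> cfun T" "adj \<psi> = \<psi>" "f \<in> cfun T" "e > 0"
  shows "\<exists>w\<in>fun_space.span coefs. nrm (f \<star> \<psi> - w) \<le> e * nrm f"
proof -
  obtain N :: nat where "(nrm \<psi>)\<^sup>2 / e\<^sup>2 \<le> real N" using real_arch_simple by blast
  then have "(nrm \<psi>)\<^sup>2 \<le> real N * e\<^sup>2" using assms(4) by (simp add: divide_le_eq)
  from peter_weyl_approx[OF assms(4,1,2) this assms(3)] show ?thesis
    using proj_span_subset_coefs by blast
qed

end

section \<open>Isotypic components\<close>

lemma sum_lessThan_add: "(\<Sum>p<(a::nat) + b. g p) = (\<Sum>p<a. g p) + (\<Sum>j<b. g (a + j))"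
  by (induction b) (simp_all add: add.assoc)

lemma sum_lessThan_mult: "(\<Sum>p<n * d. g p) = (\<Sum>k<n. \<Sum>j<(d::nat). g (k * d + j))"
proof (induction n)
  case (Suc n)
  have "Suc n * d = n * d + d" by simp
  then show ?case by (simp only: sum_lessThan_add Suc sum.lessThan_Suc)
qed simp

lemma block_index: "k < n \<Longrightarrow> j < d \<Longrightarrow> k * d + j < n * (d::nat)"
proof -
  assume "k < n" "j < d"
  then have "k * d + j < Suc k * d" by simp
  also have "\<dots> \<le> n * d" using \<open>k < n\<close> by (intro mult_le_mono1) simp
  finally show ?thesis .
qed

lemma diag_block_mat_replicate:
  fixes A :: "complex mat"
  assumes A: "A \<in> carrier_mat d d"
  shows "diag_block_mat (replicate n A) \<in> carrier_mat (n * d) (n * d)"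
    and "p < n * d \<Longrightarrow> q < n * d \<Longrightarrow> diag_block_mat (replicate n A) $$ (p, q) =
      (if p div d = q div d then A $$ (p mod d, q mod d) else 0)"
proof -
  have *: "diag_block_mat (replicate n A) \<in> carrier_mat (n * d) (n * d) \<and>
    (\<forall>p<n * d. \<forall>q<n * d. diag_block_mat (replicate n A) $$ (p, q) =
      (if p div d = q div d then A $$ (p mod d, q mod d) else 0))"
  proof (induction n)
    case 0
    then show ?case by auto
  next
    case (Suc n)
    let ?D = "diag_block_mat (replicate n A)"
    have D: "dim_row ?D = n * d" "dim_col ?D = n * d" using Suc by auto
    have dA: "dim_row A = d" "dim_col A = d" using A by auto
    have eq: "diag_block_mat (replicate (Suc n) A) = four_block_mat A (0\<^sub>m d (n * d)) (0\<^sub>m (n * d) d) ?D"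
      using D dA by (simp add: Let_def)
    show ?case
    proof (intro conjI allI impI)
      show "diag_block_mat (replicate (Suc n) A) \<in> carrier_mat (Suc n * d) (Suc n * d)"
        unfolding eq using D dA by (intro carrier_matI) simp_all
      fix p q assume p: "p < Suc n * d" and q: "q < Suc n * d"
      then have d0: "d > 0" by (cases d) auto
      have e: "four_block_mat A (0\<^sub>m d (n * d)) (0\<^sub>m (n * d) d) ?D $$ (p, q) =
        (if p < d then if q < d then A $$ (p, q) else 0\<^sub>m d (n * d) $$ (p, q - d)
         else if q < d then 0\<^sub>m (n * d) d $$ (p - d, q) else ?D $$ (p - d, q - d))"
        using p q D dA by (subst index_mat_four_block) auto
      have IH: "?D $$ (p - d, q - d) = (if (p - d) div d = (q - d) div d then A $$ ((p - d) mod d, (q - d) mod d) else 0)"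
        if "\<not> p < d" "\<not> q < d" using Suc p q that by auto
      have r: "r div d = Suc ((r - d) div d)" "(r - d) mod d = r mod d" if "\<not> r < d" for r
        using that d0 by (simp_all add: le_div_geq le_mod_geq)
      show "diag_block_mat (replicate (Suc n) A) $$ (p, q) =
        (if p div d = q div d then A $$ (p mod d, q mod d) else 0)"
        unfolding eq e using p q IH r[of p] r[of q] d0
        by (cases "p < d"; cases "q < d") (auto simp: div_less mod_less)
    qed
  qed
  show "diag_block_mat (replicate n A) \<in> carrier_mat (n * d) (n * d)" using * by blast
  show "p < n * d \<Longrightarrow> q < n * d \<Longrightarrow> diag_block_mat (replicate n A) $$ (p, q) =
      (if p div d = q div d then A $$ (p mod d, q mod d) else 0)" using * by blast
qed

lemma linear_map_unit_vec:
  fixes \<Phi> :: "complex vec \<Rightarrow> 'x \<Rightarrow> complex"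
  assumes add: "\<And>v w. v \<in> carrier_vec m \<Longrightarrow> w \<in> carrier_vec m \<Longrightarrow> \<Phi> (v + w) = \<Phi> v + \<Phi> w"
    and scale: "\<And>c v. v \<in> carrier_vec m \<Longrightarrow> \<Phi> (c \<cdot>\<^sub>v v) = fscale c (\<Phi> v)"
    and v: "v \<in> carrier_vec m"
  shows "\<Phi> v = (\<Sum>p<m. fscale (v $ p) (\<Phi> (unit_vec m p)))"
proof -
  define u where "u k = vec m (\<lambda>p. if p < k then v $ p else 0)" for k
  have "\<Phi> (u k) = (\<Sum>p<k. fscale (v $ p) (\<Phi> (unit_vec m p)))" if "k \<le> m" for k
    using that
  proof (induction k)
    case 0
    have "u 0 = 0 \<cdot>\<^sub>v u 0" by (intro eq_vecI) (auto simp: u_def)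
    then have "\<Phi> (u 0) = fscale 0 (\<Phi> (u 0))" using scale[of "u 0" 0] by (simp add: u_def)
    then show ?case by simp
  next
    case (Suc k)
    have "u (Suc k) = u k + v $ k \<cdot>\<^sub>v unit_vec m k"
      using Suc.prems by (intro eq_vecI) (auto simp: u_def less_Suc_eq)
    then have "\<Phi> (u (Suc k)) = \<Phi> (u k) + fscale (v $ k) (\<Phi> (unit_vec m k))"
      using add[of "u k" "v $ k \<cdot>\<^sub>v unit_vec m k"] scale[of "unit_vec m k" "v $ k"] by (simp add: u_def)
    then show ?case using Suc by simp
  qed
  moreover have "u m = v" using v by (intro eq_vecI) (auto simp: u_def)
  ultimately show ?thesis by (metis order_refl)
qed

section \<open>Sums of copies of one representation and complete reducibility\<close>

context compact_action
begin

lemma mor_cfun: "e \<in> mor d \<alpha> \<Longrightarrow> i < d \<Longrightarrow> e i \<in> cfun TX"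
  by (simp add: mor_def)

lemma mor_trans: "e \<in> mor d \<alpha> \<Longrightarrow> s \<in> carrier G \<Longrightarrow> i < d \<Longrightarrow>
    trans s (e i) = (\<Sum>j<d. fscale (\<alpha> s $$ (j, i)) (e j))"
  by (simp add: mor_def)

lemma comps_cfun: "fun_space.span (comps d \<alpha>) \<subseteq> cfun TX"
  by (rule fun_space.span_minimal[OF _ subspace_cfun]) (auto simp: comps_def mor_def)

definition inv_space :: "('x \<Rightarrow> complex) set \<Rightarrow> bool" where
  "inv_space Y \<longleftrightarrow> Y \<subseteq> cfun TX \<and> fun_space.subspace Y \<and> (\<forall>s\<in>carrier G. \<forall>f\<in>Y. trans s f \<in> Y)"

lemma trans_0: "trans s 0 = 0"
  by (auto simp: translate_def fun_eq_iff)

lemma trans_span_subset: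
  assumes B: "\<And>b. b \<in> B \<Longrightarrow> trans s b \<in> fun_space.span B" and f: "f \<in> fun_space.span B"
  shows "trans s f \<in> fun_space.span B"
proof -
  have "fun_space.subspace {f. trans s f \<in> fun_space.span B}"
    unfolding fun_space.subspace_def mem_Collect_eq trans_add trans_fscale trans_0
    by (intro conjI ballI allI fun_space.span_zero fun_space.span_add fun_space.span_scale) auto
  then have "fun_space.span B \<subseteq> {f. trans s f \<in> fun_space.span B}"
    by (rule fun_space.span_minimal[rotated]) (use B in auto)
  then show ?thesis using f by blast
qed

lemma inv_space_span:
  assumes "B \<subseteq> cfun TX" "\<And>s b. s \<in> carrier G \<Longrightarrow> b \<in> B \<Longrightarrow> trans s b \<in> fun_space.span B"
  shows "inv_space (fun_space.span B)"
  unfolding inv_space_def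
  using fun_space.span_minimal[OF assms(1) subspace_cfun] trans_span_subset assms(2) by blast

lemma orbit_span_inv_space:
  assumes f: "f \<in> cfun TX"
  shows "inv_space (orbit_span G TX act f)" "f \<in> orbit_span G TX act f"
proof -
  show "inv_space (orbit_span G TX act f)"
    unfolding orbit_span_def
  proof (rule inv_space_span)
    show "(\<lambda>s. trans s f) ` carrier G \<subseteq> cfun TX" using f trans_cfun by auto
    fix s b assume s: "s \<in> carrier G" and "b \<in> (\<lambda>s. trans s f) ` carrier G"
    then obtain t where "t \<in> carrier G" "b = trans t f" by auto
    then show "trans s b \<in> fun_space.span ((\<lambda>s. trans s f) ` carrier G)"
      using s by (intro fun_space.span_base) (auto simp: trans_mult)
  qed
  have "trans \<one> f \<in> orbit_span G TX act f"
    unfolding orbit_span_def by (intro fun_space.span_base) auto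
  then show "f \<in> orbit_span G TX act f" by (simp add: trans_one f)
qed

definition mspan :: "nat \<Rightarrow> (nat \<Rightarrow> 'x \<Rightarrow> complex) list \<Rightarrow> ('x \<Rightarrow> complex) set" where
  "mspan d es = fun_space.span {e i |e i. e \<in> set es \<and> i < d}"

lemma mspan_base: "e \<in> set es \<Longrightarrow> i < d \<Longrightarrow> e i \<in> mspan d es"
  unfolding mspan_def by (rule fun_space.span_base) blast

lemma subspace_mspan: "fun_space.subspace (mspan d es)"
  unfolding mspan_def by (rule fun_space.subspace_span)

lemma mspan_mono: "set es \<subseteq> set fs \<Longrightarrow> mspan d es \<subseteq> mspan d fs"
  unfolding mspan_def by (rule fun_space.span_mono) blast

lemma mspan_least:
  assumes "fun_space.subspace W" "\<And>e i. e \<in> set es \<Longrightarrow> i < d \<Longrightarrow> e i \<in> W"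
  shows "mspan d es \<subseteq> W"
  unfolding mspan_def by (rule fun_space.span_minimal[OF _ assms(1)]) (use assms(2) in blast)

lemma inv_space_mspan:
  assumes "set es \<subseteq> mor d \<alpha>"
  shows "inv_space (mspan d es)"
  unfolding mspan_def
proof (rule inv_space_span)
  show "{e i |e i. e \<in> set es \<and> i < d} \<subseteq> cfun TX" using assms mor_cfun by blast
  fix s b assume s: "s \<in> carrier G" and "b \<in> {e i |e i. e \<in> set es \<and> i < d}"
  then obtain e i where e: "e \<in> set es" "i < d" "b = e i" by blast
  then have "trans s b = (\<Sum>j<d. fscale (\<alpha> s $$ (j, i)) (e j))" using assms s mor_trans by blast
  also have "\<dots> \<in> fun_space.span {e i |e i. e \<in> set es \<and> i < d}"
    using e by (intro fun_space.span_sum fun_space.span_scale fun_space.span_base) auto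
  finally show "trans s b \<in> fun_space.span {e i |e i. e \<in> set es \<and> i < d}" .
qed

lemma span_comps_imp_mspan:
  assumes "f \<in> fun_space.span (comps d \<alpha>)"
  obtains es where "set es \<subseteq> mor d \<alpha>" "f \<in> mspan d es"
proof -
  let ?S = "{f. \<exists>es. set es \<subseteq> mor d \<alpha> \<and> f \<in> mspan d es}"
  have "fun_space.subspace ?S"
    unfolding fun_space.subspace_def
  proof (intro conjI ballI allI)
    show "0 \<in> ?S" using fun_space.subspace_0[OF subspace_mspan, of d "[]"] by (auto intro!: exI[of _ "[]"])
    show "x + y \<in> ?S" if xy: "x \<in> ?S" "y \<in> ?S" for x y
    proof -
      obtain es fs where "set es \<subseteq> mor d \<alpha>" "x \<in> mspan d es" "set fs \<subseteq> mor d \<alpha>" "y \<in> mspan d fs"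
        using xy by blast
      then have "set (es @ fs) \<subseteq> mor d \<alpha>" "x \<in> mspan d (es @ fs)" "y \<in> mspan d (es @ fs)"
        using mspan_mono[of es "es @ fs" d] mspan_mono[of fs "es @ fs" d] by auto
      then show ?thesis using fun_space.subspace_add[OF subspace_mspan] by blast
    qed
    show "fscale c x \<in> ?S" if "x \<in> ?S" for c x
      using that fun_space.subspace_scale[OF subspace_mspan] by blast
  qed
  moreover have "comps d \<alpha> \<subseteq> ?S"
  proof
    fix x assume "x \<in> comps d \<alpha>"
    then obtain e i where "e \<in> mor d \<alpha>" "i < d" "x = e i" by (auto simp: comps_def)
    then show "x \<in> ?S" using mspan_base[of e "[e]" i d] by (auto intro!: exI[of _ "[e]"])
  qed
  ultimately have "fun_space.span (comps d \<alpha>) \<subseteq> ?S" using fun_space.span_minimal by blast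
  then show ?thesis using assms that by blast
qed

text \<open>Directness of a sum: each copy meets the span of \<open>Y\<close> and of the copies
  after it trivially. Phrasing this by coefficients also makes each copy faithful, so that its
  coordinates are linearly independent.\<close>

fun indep :: "nat \<Rightarrow> ('x \<Rightarrow> complex) set \<Rightarrow> (nat \<Rightarrow> 'x \<Rightarrow> complex) list \<Rightarrow> bool" where
  "indep d Y [] = True"
| "indep d Y (e # es) = (indep d Y es \<and>
     (\<forall>v. (\<Sum>i<d. fscale (v i) (e i)) \<in> fun_space.span (Y \<union> mspan d es) \<longrightarrow> (\<forall>i<d. v i = 0)))"

text \<open>Irreducibility enters here only: a copy of the representation lies in an invariant space
  or meets it trivially.\<close>

lemma mor_dichotomy:
  assumes irr: "irreducible_representation G T d \<alpha>" and e: "e \<in> mor d \<alpha>" and W: "inv_space W"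
  shows "(\<forall>i<d. e i \<in> W) \<or> (\<forall>v. (\<Sum>i<d. fscale (v i) (e i)) \<in> W \<longrightarrow> (\<forall>i<d. v i = 0))"
proof -
  have Ws: "fun_space.subspace W" using W by (simp add: inv_space_def)
  have rep: "\<alpha> s \<in> carrier_mat d d" if "s \<in> carrier G" for s
    using irr that by (auto simp: irreducible_representation_def representation_def)
  define \<Psi> where "\<Psi> v = (\<Sum>i<d. fscale (v $ i) (e i))" for v
  have \<Psi>a: "\<Psi> (v + w) = \<Psi> v + \<Psi> w" if "v \<in> carrier_vec d" "w \<in> carrier_vec d" for v w
    unfolding \<Psi>_def sum.distrib[symmetric] using that
    by (intro sum.cong) (auto simp: fun_space.scale_left_distrib)
  have \<Psi>s: "\<Psi> (c \<cdot>\<^sub>v v) = fscale c (\<Psi> v)" if "v \<in> carrier_vec d" for v c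
    unfolding \<Psi>_def fun_space.scale_sum_right using that
    by (intro sum.cong) auto
  have \<Psi>t: "trans s (\<Psi> v) = \<Psi> (\<alpha> s *\<^sub>v v)" if v: "v \<in> carrier_vec d" and s: "s \<in> carrier G" for s v
  proof -
    have "trans s (\<Psi> v) = (\<Sum>i<d. fscale (v $ i) (\<Sum>j<d. fscale (\<alpha> s $$ (j, i)) (e j)))"
      unfolding \<Psi>_def using mor_trans[OF e s] by (simp add: trans_sum trans_fscale)
    also have "\<dots> = (\<Sum>i<d. \<Sum>j<d. fscale (v $ i * \<alpha> s $$ (j, i)) (e j))"
      by (simp add: fun_space.scale_sum_right)
    also have "\<dots> = (\<Sum>j<d. \<Sum>i<d. fscale (v $ i * \<alpha> s $$ (j, i)) (e j))"
      by (rule sum.swap)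
    also have "\<dots> = (\<Sum>j<d. fscale (\<Sum>i<d. v $ i * \<alpha> s $$ (j, i)) (e j))"
      by (simp add: fun_space.scale_sum_left)
    also have "\<dots> = \<Psi> (\<alpha> s *\<^sub>v v)"
      unfolding \<Psi>_def using v rep[OF s]
      by (intro sum.cong) (auto simp: scalar_prod_def lessThan_atLeast0 mult.commute)
    finally show ?thesis .
  qed
  \<comment> \<open>The coefficient vectors whose combination falls into \<open>W\<close> form an
    invariant subspace, to which irreducibility applies.\<close>
  define V where "V = {v \<in> carrier_vec d. \<Psi> v \<in> W}"
  have "linear_subspace d V"
    unfolding linear_subspace_def
  proof (intro conjI ballI allI)
    show "0\<^sub>v d \<in> V" using fun_space.subspace_0[OF Ws] by (simp add: V_def \<Psi>_def)
    show "v + w \<in> V" if "v \<in> V" "w \<in> V" for v w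
      using that fun_space.subspace_add[OF Ws] by (auto simp: V_def \<Psi>a)
    show "c \<cdot>\<^sub>v v \<in> V" if "v \<in> V" for c v
      using that fun_space.subspace_scale[OF Ws] by (auto simp: V_def \<Psi>s)
  qed (auto simp: V_def)
  moreover have "\<forall>s\<in>carrier G. \<forall>v\<in>V. \<alpha> s *\<^sub>v v \<in> V"
    using W mult_mat_vec_carrier[OF rep] by (auto simp: V_def inv_space_def \<Psi>t[symmetric])
  ultimately consider "V = {0\<^sub>v d}" | "V = carrier_vec d"
    using irr unfolding irreducible_representation_def by blast
  then show ?thesis
  proof cases
    case 1
    have "\<forall>i<d. v i = 0" if "(\<Sum>i<d. fscale (v i) (e i)) \<in> W" for v
    proof -
      have "\<Psi> (vec d v) = (\<Sum>i<d. fscale (v i) (e i))" by (simp add: \<Psi>_def)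
      then have "vec d v \<in> V" using that by (simp add: V_def)
      then have "vec d v = 0\<^sub>v d" using 1 by blast
      then show ?thesis by (metis index_vec index_zero_vec(1))
    qed
    then show ?thesis by blast
  next
    case 2
    have "e i \<in> W" if i: "i < d" for i
    proof -
      have "\<Psi> (unit_vec d i) = (\<Sum>j<d. if j = i then e j else 0)"
        unfolding \<Psi>_def using i by (intro sum.cong) auto
      also have "\<dots> = e i" using i by simp
      finally have "\<Psi> (unit_vec d i) = e i" .
      moreover have "unit_vec d i \<in> V" unfolding 2 by (rule unit_vec_carrier)
      ultimately show ?thesis unfolding V_def by auto
    qed
    then show ?thesis by blast
  qed
qed

lemma inv_space_span_Un:
  assumes "inv_space Y" "set fs \<subseteq> mor d \<alpha>"
  shows "inv_space (fun_space.span (Y \<union> mspan d fs))"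
  using assms(1) inv_space_mspan[OF assms(2)]
  by (intro inv_space_span) (auto simp: inv_space_def intro: fun_space.span_base)

text \<open>Greedy selection: by \<open>mor_dichotomy\<close> the next copy either lies in the span
  reached so far and is dropped, or is independent of it and is kept.\<close>

lemma exists_indep:
  assumes irr: "irreducible_representation G T d \<alpha>" and Y: "inv_space Y" and "set es \<subseteq> mor d \<alpha>"
  shows "\<exists>fs. set fs \<subseteq> set es \<and> indep d Y fs \<and> mspan d es \<subseteq> fun_space.span (Y \<union> mspan d fs)"
  using assms(3)
proof (induction es)
  case Nil
  then show ?case by (intro exI[of _ "[]"]) (auto simp: fun_space.span_superset intro: fun_space.span_base)
next
  case (Cons e es)
  then obtain fs where fs: "set fs \<subseteq> set es" "indep d Y fs" "mspan d es \<subseteq> fun_space.span (Y \<union> mspan d fs)"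
    by auto
  let ?W = "fun_space.span (Y \<union> mspan d fs)"
  have W: "inv_space ?W" using fs Cons.prems by (intro inv_space_span_Un[OF Y]) auto
  have e: "e \<in> mor d \<alpha>" using Cons.prems by simp
  from mor_dichotomy[OF irr e W] show ?case
  proof
    assume a: "\<forall>i<d. e i \<in> ?W"
    have "mspan d (e # es) \<subseteq> ?W"
      by (rule mspan_least) (use a fs(3) mspan_base[of _ es] in auto)
    then show ?thesis using fs by (intro exI[of _ fs]) auto
  next
    assume a: "\<forall>v. (\<Sum>i<d. fscale (v i) (e i)) \<in> ?W \<longrightarrow> (\<forall>i<d. v i = 0)"
    have W': "?W \<subseteq> fun_space.span (Y \<union> mspan d (e # fs))"
      using mspan_mono[of fs "e # fs" d] by (intro fun_space.span_mono) auto
    have "mspan d (e # es) \<subseteq> fun_space.span (Y \<union> mspan d (e # fs))"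
    proof (rule mspan_least)
      fix g i assume g: "g \<in> set (e # es)" and i: "i < d"
      show "g i \<in> fun_space.span (Y \<union> mspan d (e # fs))"
      proof (cases "g = e")
        case True
        then show ?thesis using mspan_base[of e "e # fs" i d] i by (intro fun_space.span_base) auto
      next
        case False
        then show ?thesis using g mspan_base[of g es i d] i fs(3) W' by auto
      qed
    qed simp
    then show ?thesis using fs a by (intro exI[of _ "e # fs"]) auto
  qed
qed

lemma mspan_Cons: "x \<in> mspan d (e # es) \<Longrightarrow> \<exists>v. \<exists>z\<in>mspan d es. x = (\<Sum>i<d. fscale (v i) (e i)) + z"
proof -
  assume x: "x \<in> mspan d (e # es)"
  let ?S = "{x. \<exists>v. \<exists>z\<in>mspan d es. x = (\<Sum>i<d. fscale (v i) (e i)) + z}"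
  note sub = subspace_mspan[of d es]
  have I: "(\<Sum>i<d. fscale (v i) (e i)) + z \<in> ?S" if "z \<in> mspan d es" for v z
    using that by (intro CollectI exI[of _ v] bexI[of _ z] refl)
  have "fun_space.subspace ?S"
    unfolding fun_space.subspace_def
  proof (intro conjI ballI allI)
    show "0 \<in> ?S" using fun_space.subspace_0[OF sub] by (auto intro!: exI[of _ "\<lambda>_. 0"] bexI[of _ 0])
    show "x + y \<in> ?S" if xy: "x \<in> ?S" "y \<in> ?S" for x y
    proof -
      obtain v z v' z' where "z \<in> mspan d es" "z' \<in> mspan d es"
        "x = (\<Sum>i<d. fscale (v i) (e i)) + z" "y = (\<Sum>i<d. fscale (v' i) (e i)) + z'"
        using xy by (elim CollectE exE bexE)
      then have "x + y = (\<Sum>i<d. fscale (v i + v' i) (e i)) + (z + z')"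
        by (simp add: fun_space.scale_left_distrib sum.distrib algebra_simps)
      moreover have "z + z' \<in> mspan d es" using \<open>z \<in> _\<close> \<open>z' \<in> _\<close> fun_space.subspace_add[OF sub] by blast
      ultimately show ?thesis using I by (simp only:)
    qed
    show "fscale c x \<in> ?S" if xS: "x \<in> ?S" for c x
    proof -
      obtain v z where z: "z \<in> mspan d es" "x = (\<Sum>i<d. fscale (v i) (e i)) + z"
        using xS by (elim CollectE exE bexE)
      have "fscale c x = (\<Sum>i<d. fscale (c * v i) (e i)) + fscale c z"
        unfolding z(2) by (simp add: fun_space.scale_right_distrib fun_space.scale_sum_right)
      moreover have "fscale c z \<in> mspan d es" using z fun_space.subspace_scale[OF sub] by blast
      ultimately show ?thesis using I by (simp only:)
    qed
  qed
  then have "mspan d (e # es) \<subseteq> ?S"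
  proof (rule mspan_least)
    fix g i assume g: "g \<in> set (e # es)" and i: "i < d"
    show "g i \<in> ?S"
    proof (cases "g = e")
      case True
      have "e i = (\<Sum>j<d. fscale (if j = i then 1 else 0) (e j)) + 0"
      proof -
        have "(\<Sum>j<d. fscale (if j = i then 1 else 0) (e j)) = (\<Sum>j<d. if j = i then e j else 0)"
          by (intro sum.cong) auto
        then show ?thesis using i by simp
      qed
      then show ?thesis using True I[OF fun_space.subspace_0[OF sub]] by (simp only:)
    next
      case False
      then have "g i \<in> mspan d es" using g i mspan_base by auto
      moreover have "g i = (\<Sum>j<d. fscale 0 (e j)) + g i" by simp
      ultimately show ?thesis by (intro CollectI exI[of _ "\<lambda>_. 0"] bexI[of _ "g i"])
    qed
  qed
  then show ?thesis using x by blast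
qed

lemma indep_unique:
  assumes Y: "fun_space.subspace Y"
  shows "indep d Y fs \<Longrightarrow> y \<in> Y \<Longrightarrow> z \<in> mspan d fs \<Longrightarrow> y + z = 0 \<Longrightarrow> y = 0"
proof (induction fs arbitrary: z)
  case Nil
  then show ?case by (simp add: mspan_def)
next
  case (Cons e fs)
  obtain v z' where z: "z' \<in> mspan d fs" "z = (\<Sum>i<d. fscale (v i) (e i)) + z'"
    using mspan_Cons[OF Cons.prems(3)] by blast
  have "(\<Sum>i<d. fscale (v i) (e i)) + (y + z') = y + ((\<Sum>i<d. fscale (v i) (e i)) + z')"
    by (rule add.left_commute)
  also have "\<dots> = 0" using Cons.prems(4) unfolding z(2) .
  finally have "(\<Sum>i<d. fscale (v i) (e i)) = - (y + z')"
    by (rule eq_neg_iff_add_eq_0[THEN iffD2])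
  also have "\<dots> \<in> fun_space.span (Y \<union> mspan d fs)"
    using Cons.prems(2) z(1) by (intro fun_space.span_neg fun_space.span_add fun_space.span_base) auto
  finally have "\<forall>i<d. v i = 0" using Cons.prems(1) by simp
  then have "z = z'" using z(2) by simp
  then show ?case using Cons.IH[OF _ Cons.prems(2) z(1)] Cons.prems by simp
qed

lemma indep_coefs:
  "indep d {0} fs \<Longrightarrow> (\<Sum>k<length fs. \<Sum>i<d. fscale (c k i) ((fs ! k) i)) = 0 \<Longrightarrow>
    k < length fs \<Longrightarrow> i < d \<Longrightarrow> c k i = 0"
proof (induction fs arbitrary: c k)
  case (Cons e fs)
  let ?z = "\<Sum>k<length fs. \<Sum>i<d. fscale (c (Suc k) i) ((fs ! k) i)"
  have z: "?z \<in> mspan d fs"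
    by (intro fun_space.subspace_sum[OF subspace_mspan] fun_space.subspace_scale[OF subspace_mspan] mspan_base) auto
  have eq: "(\<Sum>i<d. fscale (c 0 i) (e i)) + ?z = 0"
    using Cons.prems(2) unfolding length_Cons sum.lessThan_Suc_shift nth_Cons_0 nth_Cons_Suc .
  then have "(\<Sum>i<d. fscale (c 0 i) (e i)) = - ?z" by (rule eq_neg_iff_add_eq_0[THEN iffD2])
  also have "\<dots> \<in> fun_space.span ({0} \<union> mspan d fs)"
    using z by (intro fun_space.span_neg fun_space.span_base) auto
  finally have c0: "\<forall>i<d. c 0 i = 0" using Cons.prems(1) unfolding indep.simps by blast
  then have "?z = 0" using eq by simp
  then have "c (Suc k) i = 0" if "k < length fs" for k
    using Cons.IH[of "\<lambda>k. c (Suc k)" k] Cons.prems that by simp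
  then show ?case using Cons.prems c0 by (cases k) auto
qed simp

text \<open>A sublist \<open>fs\<close> of \<open>es\<close> spans a complement of \<open>Y\<close>.
  The projection onto \<open>Y\<close> along this invariant complement is equivariant, so it sends
  each member of \<open>es\<close> to an intertwiner with values in \<open>Y\<close>. The images
  span \<open>Y\<close>, and a direct sublist of them is extracted.\<close>

lemma inv_space_isotypic:
  assumes irr: "irreducible_representation G T d \<alpha>" and Y: "inv_space Y"
    and es: "set es \<subseteq> mor d \<alpha>" and sub: "Y \<subseteq> mspan d es"
  obtains gs where "set gs \<subseteq> mor d \<alpha>" "indep d {0} gs" "Y = mspan d gs"
proof -
  have Ys: "fun_space.subspace Y" and Yt: "\<And>s f. s \<in> carrier G \<Longrightarrow> f \<in> Y \<Longrightarrow> trans s f \<in> Y"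
    and YC: "Y \<subseteq> cfun TX"
    using Y by (auto simp: inv_space_def)
  obtain fs where fs: "set fs \<subseteq> set es" "indep d Y fs" "mspan d es \<subseteq> fun_space.span (Y \<union> mspan d fs)"
    using exists_indep[OF irr Y es] by blast
  have fm: "set fs \<subseteq> mor d \<alpha>" using fs es by blast
  note ft = inv_space_mspan[OF fm]
  note fsub = subspace_mspan[of d fs]
  have "\<exists>g. g \<in> mor d \<alpha> \<and> (\<forall>i<d. g i \<in> Y) \<and> (\<forall>i<d. e i - g i \<in> mspan d fs)" if e: "e \<in> set es" for e
  proof -
    have em: "e \<in> mor d \<alpha>" using e es by blast
    have "\<exists>y\<in>Y. e i - y \<in> mspan d fs" if i: "i < d" for i
    proof -
      have "e i \<in> fun_space.span (Y \<union> mspan d fs)" using mspan_base[OF e i] fs(3) by blast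
      then obtain y z where yz: "e i = y + z" "y \<in> fun_space.span Y" "z \<in> fun_space.span (mspan d fs)"
        unfolding fun_space.span_Un by blast
      then have "y \<in> Y" "z \<in> mspan d fs"
        using fun_space.span_eq_iff Ys fsub by blast+
      then show ?thesis using yz(1) by (intro bexI[of _ y]) auto
    qed
    then obtain g where g: "\<And>i. i < d \<Longrightarrow> g i \<in> Y" "\<And>i. i < d \<Longrightarrow> e i - g i \<in> mspan d fs" by metis
    have "g \<in> mor d \<alpha>"
      unfolding mor_def
    proof (intro CollectI conjI allI impI ballI)
      show "g i \<in> cfun TX" if "i < d" for i using g that YC by blast
      fix s i assume s: "s \<in> carrier G" and i: "i < d"
      \<comment> \<open>The failure of \<open>g\<close> to be equivariant lies in \<open>Y\<close>,
        that of \<open>e - g\<close> in the complement. They add up to zero because \<open>e\<close>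
        is equivariant, so both vanish.\<close>
      let ?y = "trans s (g i) - (\<Sum>j<d. fscale (\<alpha> s $$ (j, i)) (g j))"
      let ?z = "trans s (e i - g i) - (\<Sum>j<d. fscale (\<alpha> s $$ (j, i)) (e j - g j))"
      have "?y \<in> Y" using Yt[OF s] g(1) i
        by (intro fun_space.subspace_diff[OF Ys] fun_space.subspace_sum[OF Ys] fun_space.subspace_scale[OF Ys]) auto
      moreover have "?z \<in> mspan d fs"
      proof (rule fun_space.subspace_diff[OF fsub])
        show "trans s (e i - g i) \<in> mspan d fs" using ft s g(2)[OF i] by (simp add: inv_space_def)
        show "(\<Sum>j<d. fscale (\<alpha> s $$ (j, i)) (e j - g j)) \<in> mspan d fs"
          by (rule fun_space.subspace_sum[OF fsub], rule fun_space.subspace_scale[OF fsub]) (use g(2) in auto)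
      qed
      moreover have "?y + ?z = 0"
      proof -
        have "trans s (g i) + trans s (e i - g i) = trans s (e i)" by (simp flip: trans_add)
        also have "\<dots> = (\<Sum>j<d. fscale (\<alpha> s $$ (j, i)) (g j)) + (\<Sum>j<d. fscale (\<alpha> s $$ (j, i)) (e j - g j))"
          by (simp add: mor_trans[OF em s i] flip: sum.distrib fun_space.scale_right_distrib)
        finally show ?thesis by (simp add: algebra_simps)
      qed
      ultimately have "?y = 0" by (rule indep_unique[OF Ys fs(2)])
      then show "trans s (g i) = (\<Sum>j<d. fscale (\<alpha> s $$ (j, i)) (g j))" by simp
    qed
    then show ?thesis using g by blast
  qed
  then obtain P where P: "\<And>e. e \<in> set es \<Longrightarrow> P e \<in> mor d \<alpha>"
    "\<And>e i. e \<in> set es \<Longrightarrow> i < d \<Longrightarrow> P e i \<in> Y"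
    "\<And>e i. e \<in> set es \<Longrightarrow> i < d \<Longrightarrow> e i - P e i \<in> mspan d fs" by metis
  define hs where "hs = map P es"
  have hm: "set hs \<subseteq> mor d \<alpha>" using P by (auto simp: hs_def)
  have hY: "mspan d hs \<subseteq> Y" by (rule mspan_least[OF Ys]) (use P in \<open>auto simp: hs_def\<close>)
  note hsub = subspace_mspan[of d hs]
  have "mspan d es \<subseteq> {x. \<exists>y\<in>mspan d hs. x - y \<in> mspan d fs}"
  proof (rule mspan_least)
    show "fun_space.subspace {x. \<exists>y\<in>mspan d hs. x - y \<in> mspan d fs}"
      unfolding fun_space.subspace_def
    proof (intro conjI ballI allI)
      show "0 \<in> {x. \<exists>y\<in>mspan d hs. x - y \<in> mspan d fs}"
        using fun_space.subspace_0[OF hsub] fun_space.subspace_0[OF fsub] by (auto intro!: bexI[of _ 0])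
      fix x assume "x \<in> {x. \<exists>y\<in>mspan d hs. x - y \<in> mspan d fs}"
      then obtain u where u: "u \<in> mspan d hs" "x - u \<in> mspan d fs" by blast
      show "fscale c x \<in> {x. \<exists>y\<in>mspan d hs. x - y \<in> mspan d fs}" for c
        using fun_space.subspace_scale[OF hsub u(1), of c] fun_space.subspace_scale[OF fsub u(2), of c]
        by (auto simp: fun_space.scale_right_diff_distrib)
      fix y assume "y \<in> {x. \<exists>y\<in>mspan d hs. x - y \<in> mspan d fs}"
      then obtain v where v: "v \<in> mspan d hs" "y - v \<in> mspan d fs" by blast
      have "x + y - (u + v) = (x - u) + (y - v)" by (simp add: algebra_simps)
      then have "x + y - (u + v) \<in> mspan d fs" using fun_space.subspace_add[OF fsub u(2) v(2)] by (simp only:)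
      then show "x + y \<in> {x. \<exists>y\<in>mspan d hs. x - y \<in> mspan d fs}"
        using fun_space.subspace_add[OF hsub u(1) v(1)] by blast
    qed
    fix e i assume "e \<in> set es" "i < d"
    then show "e i \<in> {x. \<exists>y\<in>mspan d hs. x - y \<in> mspan d fs}"
      using P(3) mspan_base[of "P e" hs i d] by (auto simp: hs_def)
  qed
  then have "Y \<subseteq> mspan d hs"
  proof (intro subsetI)
    fix x assume "mspan d es \<subseteq> {x. \<exists>y\<in>mspan d hs. x - y \<in> mspan d fs}" and x: "x \<in> Y"
    then obtain u where u: "u \<in> mspan d hs" "x - u \<in> mspan d fs" using sub by blast
    have "x - u \<in> Y" using x u hY by (intro fun_space.subspace_diff[OF Ys]) auto
    moreover have "- (x - u) \<in> mspan d fs" by (rule fun_space.subspace_neg[OF fsub u(2)])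
    moreover have "(x - u) + - (x - u) = 0" by simp
    ultimately have "x - u = 0" by (rule indep_unique[OF Ys fs(2)])
    then show "x \<in> mspan d hs" using u by simp
  qed
  then have Yh: "Y = mspan d hs" using hY by blast
  have "inv_space {0}"
    unfolding inv_space_def
    using fun_space.subspace_0[OF subspace_cfun] fun_space.subspace_single_0 trans_0 by blast
  then obtain gs where gs: "set gs \<subseteq> set hs" "indep d {0} gs" "mspan d hs \<subseteq> fun_space.span ({0} \<union> mspan d gs)"
    using exists_indep[OF irr _ hm] by blast
  have "fun_space.span ({0} \<union> mspan d gs) \<subseteq> mspan d gs"
    using fun_space.subspace_0[OF subspace_mspan] by (intro fun_space.span_minimal subspace_mspan) auto
  then have "Y = mspan d gs" using gs Yh mspan_mono[OF gs(1), of d] by blast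
  then show ?thesis using that gs hm by blast
qed

lemma mspan_isomorphic:
  assumes irr: "irreducible_representation G T d \<alpha>"
    and gs: "set gs \<subseteq> mor d \<alpha>" "indep d {0} gs"
  shows "isomorphic_to_rep G TX act (mspan d gs) (length gs * d) (rep_power \<alpha> (length gs))"
proof -
  define n where "n = length gs"
  have d0: "d > 0" using irr by (simp add: irreducible_representation_def)
  have rep: "\<alpha> s \<in> carrier_mat d d" if "s \<in> carrier G" for s
    using irr that by (auto simp: irreducible_representation_def representation_def)
  have gm: "gs ! k \<in> mor d \<alpha>" if "k < n" for k using gs(1) that n_def nth_mem by blast
  \<comment> \<open>Position \<open>k * d + i\<close> is coordinate \<open>i\<close> of the diagonal
    block \<open>k\<close> of \<open>rep_power\<close>.\<close>
  define \<Phi> where "\<Phi> v = (\<Sum>k<n. \<Sum>i<d. fscale (v $ (k * d + i)) ((gs ! k) i))" for v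
  have \<Phi>a: "\<Phi> (v + w) = \<Phi> v + \<Phi> w" if "v \<in> carrier_vec (n * d)" "w \<in> carrier_vec (n * d)" for v w
    unfolding \<Phi>_def sum.distrib[symmetric] using that block_index
    by (intro sum.cong refl) (auto simp: fun_space.scale_left_distrib)
  have \<Phi>s: "\<Phi> (c \<cdot>\<^sub>v v) = fscale c (\<Phi> v)" if "v \<in> carrier_vec (n * d)" for v c
    unfolding \<Phi>_def fun_space.scale_sum_right using that block_index
    by (intro sum.cong refl) auto
  have \<Phi>m: "\<Phi> v \<in> mspan d gs" for v
    unfolding \<Phi>_def by (intro fun_space.subspace_sum[OF subspace_mspan] fun_space.subspace_scale[OF subspace_mspan] mspan_base)
      (auto simp: n_def)
  have inj: "inj_on \<Phi> (carrier_vec (n * d))"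
  proof (rule inj_onI)
    fix v w assume v: "v \<in> carrier_vec (n * d)" and w: "w \<in> carrier_vec (n * d)" and eq: "\<Phi> v = \<Phi> w"
    have "(\<Sum>k<length gs. \<Sum>i<d. fscale (v $ (k * d + i) - w $ (k * d + i)) ((gs ! k) i)) = \<Phi> v - \<Phi> w"
      unfolding \<Phi>_def n_def by (simp add: fun_space.scale_left_diff_distrib sum_subtractf)
    then have z: "(\<Sum>k<length gs. \<Sum>i<d. fscale (v $ (k * d + i) - w $ (k * d + i)) ((gs ! k) i)) = 0"
      using eq by simp
    have "v $ p = w $ p" if p: "p < n * d" for p
    proof -
      have "p div d < n" "p mod d < d" using p d0 by (simp_all add: less_mult_imp_div_less)
      then have "v $ (p div d * d + p mod d) - w $ (p div d * d + p mod d) = 0"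
        using indep_coefs[OF gs(2), of "\<lambda>k i. v $ (k * d + i) - w $ (k * d + i)", OF z] n_def by blast
      then show ?thesis by simp
    qed
    then show "v = w" using v w by (intro eq_vecI) auto
  qed
  have surj: "mspan d gs \<subseteq> \<Phi> ` carrier_vec (n * d)"
  proof (rule mspan_least)
    show "fun_space.subspace (\<Phi> ` carrier_vec (n * d))"
      unfolding fun_space.subspace_def
    proof (intro conjI ballI allI)
      have "\<Phi> (0\<^sub>v (n * d)) = 0" unfolding \<Phi>_def using block_index[of _ n _ d] by simp
      then show "0 \<in> \<Phi> ` carrier_vec (n * d)" by (metis imageI zero_carrier_vec)
      fix x assume "x \<in> \<Phi> ` carrier_vec (n * d)"
      then obtain v where v: "v \<in> carrier_vec (n * d)" "x = \<Phi> v" by blast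
      show "fscale c x \<in> \<Phi> ` carrier_vec (n * d)" for c
        using v \<Phi>s[OF v(1), of c] by (metis imageI smult_carrier_vec)
      fix y assume "y \<in> \<Phi> ` carrier_vec (n * d)"
      then obtain w where w: "w \<in> carrier_vec (n * d)" "y = \<Phi> w" by blast
      show "x + y \<in> \<Phi> ` carrier_vec (n * d)"
        using v w \<Phi>a[OF v(1) w(1)] by (metis imageI add_carrier_vec)
    qed
    fix e i assume "e \<in> set gs" and i: "i < d"
    then obtain k where k: "k < n" "e = gs ! k" by (auto simp: in_set_conv_nth n_def)
    have "\<Phi> (unit_vec (n * d) (k * d + i)) = (\<Sum>l<n. \<Sum>j<d. if j = i then (if l = k then (gs ! l) j else 0) else 0)"
      unfolding \<Phi>_def
    proof (intro sum.cong refl)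
      fix l j assume "l \<in> {..<n}" "j \<in> {..<d}"
      then have l: "l < n" and j: "j < d" by auto
      have "l * d + j = k * d + i \<longleftrightarrow> l = k \<and> j = i"
      proof
        assume a: "l * d + j = k * d + i"
        have "l = (l * d + j) div d" "k = (k * d + i) div d" using i j by simp_all
        then have "l = k" using a by metis
        then show "l = k \<and> j = i" using a by simp
      qed simp
      then show "fscale (unit_vec (n * d) (k * d + i) $ (l * d + j)) ((gs ! l) j) =
         (if j = i then (if l = k then (gs ! l) j else 0) else 0)"
        using block_index[OF l j] block_index[OF k(1) i] by auto
    qed
    also have "\<dots> = (gs ! k) i" using i k by simp
    finally show "e i \<in> \<Phi> ` carrier_vec (n * d)" using k by (metis imageI unit_vec_carrier)
  qed
  have equiv: "\<Phi> (rep_power \<alpha> n s *\<^sub>v v) = trans s (\<Phi> v)"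
    if s: "s \<in> carrier G" and v: "v \<in> carrier_vec (n * d)" for s v
  proof -
    note R = diag_block_mat_replicate[OF rep[OF s], where n = n]
    have Rv: "(rep_power \<alpha> n s *\<^sub>v v) $ (k * d + j) = (\<Sum>i<d. \<alpha> s $$ (j, i) * v $ (k * d + i))"
      if k: "k < n" and j: "j < d" for k j
    proof -
      have "(rep_power \<alpha> n s *\<^sub>v v) $ (k * d + j) =
         (\<Sum>q<n * d. diag_block_mat (replicate n (\<alpha> s)) $$ (k * d + j, q) * v $ q)"
        using R(1) v block_index[OF k j]
        by (simp add: rep_power_def scalar_prod_def lessThan_atLeast0)
      also have "\<dots> = (\<Sum>l<n. \<Sum>i<d. diag_block_mat (replicate n (\<alpha> s)) $$ (k * d + j, l * d + i) * v $ (l * d + i))"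
        by (rule sum_lessThan_mult)
      also have "\<dots> = (\<Sum>l<n. if l = k then (\<Sum>i<d. \<alpha> s $$ (j, i) * v $ (l * d + i)) else 0)"
      proof (rule sum.cong[OF refl])
        fix l assume "l \<in> {..<n}"
        then have l: "l < n" by simp
        have "diag_block_mat (replicate n (\<alpha> s)) $$ (k * d + j, l * d + i) = (if l = k then \<alpha> s $$ (j, i) else 0)"
          if i: "i < d" for i
          using R(2)[OF block_index[OF k j] block_index[OF l i]] i j by auto
        then show "(\<Sum>i<d. diag_block_mat (replicate n (\<alpha> s)) $$ (k * d + j, l * d + i) * v $ (l * d + i)) =
          (if l = k then (\<Sum>i<d. \<alpha> s $$ (j, i) * v $ (l * d + i)) else 0)" by simp
      qed
      finally show ?thesis using k by simp
    qed
    have "\<Phi> (rep_power \<alpha> n s *\<^sub>v v) =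
        (\<Sum>k<n. \<Sum>j<d. \<Sum>i<d. fscale (v $ (k * d + i) * \<alpha> s $$ (j, i)) ((gs ! k) j))"
      unfolding \<Phi>_def using Rv
      by (intro sum.cong refl) (simp add: mult.commute flip: fun_space.scale_sum_left)
    also have "\<dots> = (\<Sum>k<n. \<Sum>i<d. \<Sum>j<d. fscale (v $ (k * d + i) * \<alpha> s $$ (j, i)) ((gs ! k) j))"
      by (intro sum.cong refl sum.swap)
    also have "\<dots> = (\<Sum>k<n. \<Sum>i<d. fscale (v $ (k * d + i)) (trans s ((gs ! k) i)))"
      using mor_trans[OF gm s] by (intro sum.cong refl) (simp add: fun_space.scale_sum_right)
    also have "\<dots> = trans s (\<Phi> v)"
      unfolding \<Phi>_def by (simp add: trans_sum trans_fscale)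
    finally show ?thesis .
  qed
  have "bij_betw \<Phi> (carrier_vec (n * d)) (mspan d gs)"
    unfolding bij_betw_def using inj surj \<Phi>m by blast
  then show ?thesis
    unfolding isomorphic_to_rep_def n_def[symmetric] using \<Phi>a \<Phi>s equiv by blast
qed

text \<open>The component is defined one function at a time and is not visibly a linear space; the
  span is. One inclusion is complete reducibility applied to the orbit span, the other reads off an
  intertwiner from each diagonal block of the given isomorphism.\<close>

theorem isotypic_component_eq_span:
  assumes irr: "irreducible_representation G T d \<alpha>"
  shows "isotypic_component G TX act d \<alpha> = fun_space.span (comps d \<alpha>)"
proof (intro equalityI subsetI)
  fix f assume f: "f \<in> fun_space.span (comps d \<alpha>)"
  then have fC: "f \<in> cfun TX" using comps_cfun by blast
  obtain es where es: "set es \<subseteq> mor d \<alpha>" "f \<in> mspan d es" using span_comps_imp_mspan[OF f] by blast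
  note O = orbit_span_inv_space[OF fC]
  have "orbit_span G TX act f \<subseteq> mspan d es"
    unfolding orbit_span_def using inv_space_mspan[OF es(1)] es(2)
    by (intro fun_space.span_minimal[OF _ subspace_mspan]) (auto simp: inv_space_def)
  then obtain gs where "set gs \<subseteq> mor d \<alpha>" "indep d {0} gs" "orbit_span G TX act f = mspan d gs"
    using inv_space_isotypic[OF irr O(1) es(1)] by blast
  then show "f \<in> isotypic_component G TX act d \<alpha>"
    unfolding isotypic_component_def using fC mspan_isomorphic[OF irr] by auto
next
  fix f assume "f \<in> isotypic_component G TX act d \<alpha>"
  then obtain n where fC: "f \<in> cfun TX"
    and iso: "isomorphic_to_rep G TX act (orbit_span G TX act f) (n * d) (rep_power \<alpha> n)"
    by (auto simp: isotypic_component_def)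
  have d0: "d > 0" using irr by (simp add: irreducible_representation_def)
  have rep: "\<alpha> s \<in> carrier_mat d d" if "s \<in> carrier G" for s
    using irr that by (auto simp: irreducible_representation_def representation_def)
  note O = orbit_span_inv_space[OF fC]
  obtain \<Phi> where bij: "bij_betw \<Phi> (carrier_vec (n * d)) (orbit_span G TX act f)"
    and add: "\<And>v w. v \<in> carrier_vec (n * d) \<Longrightarrow> w \<in> carrier_vec (n * d) \<Longrightarrow> \<Phi> (v + w) = \<Phi> v + \<Phi> w"
    and scale: "\<And>c v. v \<in> carrier_vec (n * d) \<Longrightarrow> \<Phi> (c \<cdot>\<^sub>v v) = fscale c (\<Phi> v)"
    and equiv: "\<And>s v. s \<in> carrier G \<Longrightarrow> v \<in> carrier_vec (n * d) \<Longrightarrow> \<Phi> (rep_power \<alpha> n s *\<^sub>v v) = trans s (\<Phi> v)"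
    using iso unfolding isomorphic_to_rep_def by blast
  have lin: "\<Phi> v = (\<Sum>p<n * d. fscale (v $ p) (\<Phi> (unit_vec (n * d) p)))"
    if "v \<in> carrier_vec (n * d)" for v
    by (rule linear_map_unit_vec[of "n * d" \<Phi>]) (use add scale that in auto)
  define u where "u k i = \<Phi> (unit_vec (n * d) (k * d + i))" for k i
  have um: "u k \<in> mor d \<alpha>" if k: "k < n" for k
    unfolding mor_def
  proof (intro CollectI conjI allI impI ballI)
    show "u k i \<in> cfun TX" if "i < d" for i
    proof -
      have "u k i \<in> orbit_span G TX act f"
        unfolding u_def using bij unit_vec_carrier[of "n * d"] by (auto simp: bij_betw_def)
      then show ?thesis using O(1) by (auto simp: inv_space_def)
    qed
    fix s i assume s: "s \<in> carrier G" and i: "i < d"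
    note R = diag_block_mat_replicate[OF rep[OF s], where n = n]
    let ?q = "k * d + i"
    have q: "?q < n * d" by (rule block_index[OF k i])
    let ?w = "rep_power \<alpha> n s *\<^sub>v unit_vec (n * d) ?q"
    have w: "?w \<in> carrier_vec (n * d)" using R(1) by (auto simp: rep_power_def)
    have wp: "?w $ (l * d + j) = (if l = k then \<alpha> s $$ (j, i) else 0)" if l: "l < n" and j: "j < d" for l j
    proof -
      have "?w $ (l * d + j) = diag_block_mat (replicate n (\<alpha> s)) $$ (l * d + j, ?q)"
        using R(1) block_index[OF l j] q by (simp add: rep_power_def)
      also have "\<dots> = (if l = k then \<alpha> s $$ (j, i) else 0)"
        using R(2)[OF block_index[OF l j] q] i j by auto
      finally show ?thesis .
    qed
    have "trans s (u k i) = \<Phi> ?w" unfolding u_def by (rule equiv[OF s unit_vec_carrier, symmetric])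
    also have "\<dots> = (\<Sum>p<n * d. fscale (?w $ p) (\<Phi> (unit_vec (n * d) p)))" by (rule lin[OF w])
    also have "\<dots> = (\<Sum>l<n. \<Sum>j<d. fscale (?w $ (l * d + j)) (u l j))"
      unfolding u_def by (rule sum_lessThan_mult)
    also have "\<dots> = (\<Sum>l<n. if l = k then (\<Sum>j<d. fscale (\<alpha> s $$ (j, i)) (u l j)) else 0)"
      using wp by (intro sum.cong) auto
    finally show "trans s (u k i) = (\<Sum>j<d. fscale (\<alpha> s $$ (j, i)) (u k j))" using k by simp
  qed
  obtain v where v: "v \<in> carrier_vec (n * d)" "f = \<Phi> v" using O(2) bij by (auto simp: bij_betw_def)
  have "\<Phi> v = (\<Sum>p<n * d. fscale (v $ p) (\<Phi> (unit_vec (n * d) p)))" by (rule lin[OF v(1)])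
  also have "\<dots> = (\<Sum>l<n. \<Sum>j<d. fscale (v $ (l * d + j)) (u l j))"
    unfolding u_def by (rule sum_lessThan_mult)
  also have "\<dots> \<in> fun_space.span (comps d \<alpha>)"
    using um by (intro fun_space.span_sum fun_space.span_scale fun_space.span_base) (auto simp: comps_def)
  finally show "f \<in> fun_space.span (comps d \<alpha>)" using v by simp
qed

end

section \<open>Finite generation implies continuity of stabilizers\<close>

lemma cfun_bounded:
  assumes "compact_space TX" "f \<in> cfun TX"
  obtains B where "B \<ge> 0" "\<And>x. norm (f x) \<le> B"
proof -
  have "compactin euclidean (f ` topspace TX)"
    by (rule image_compactin[of TX]) (use assms in \<open>auto simp: compact_space_def cfun_def\<close>)
  then have "bounded (f ` topspace TX)" by (simp add: compact_imp_bounded)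
  then obtain B where B: "\<And>x. x \<in> topspace TX \<Longrightarrow> norm (f x) \<le> B" by (auto simp: bounded_iff)
  have "norm (f x) \<le> max B 0" for x
    using B[of x] assms(2) by (cases "x \<in> topspace TX") (auto simp: cfun_def)
  then show ?thesis using that[of "max B 0"] by auto
qed

lemma cfun_urysohn:
  assumes "compact_space TX" "Hausdorff_space TX" "closedin TX A" "closedin TX B" "disjnt A B"
  obtains F where "F \<in> cfun TX" "\<And>x. \<exists>r. 0 \<le> r \<and> r \<le> 1 \<and> F x = complex_of_real r"
    "\<And>x. x \<in> A \<Longrightarrow> F x = 0" "\<And>x. x \<in> B \<Longrightarrow> F x = 1"
proof -
  have "normal_space TX" using assms compact_Hausdorff_or_regular_imp_normal_space by blast
  then obtain f where f: "continuous_map TX (top_of_set {0..1::real}) f" "f ` A \<subseteq> {0}" "f ` B \<subseteq> {1}"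
    using Urysohn_lemma[of TX A B 0 1] assms by auto
  have fr: "continuous_map TX euclideanreal f" and f01: "\<And>x. x \<in> topspace TX \<Longrightarrow> f x \<in> {0..1}"
    using f(1) by (auto simp: continuous_map_in_subtopology)
  define F where "F x = (if x \<in> topspace TX then complex_of_real (f x) else 0)" for x
  have "continuous_map TX euclidean F"
    by (rule continuous_map_eq[OF continuous_map_of_real[OF fr]]) (simp add: F_def)
  then have "F \<in> cfun TX" by (simp add: cfun_def F_def)
  moreover have "\<exists>r. 0 \<le> r \<and> r \<le> 1 \<and> F x = complex_of_real r" for x
    using f01[of x] by (cases "x \<in> topspace TX") (auto simp: F_def intro!: exI[of _ "f x"] exI[of _ "0::real"])
  moreover have "F x = 0" if "x \<in> A" for x using that f(2) by (auto simp: F_def)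
  moreover have "F x = 1" if "x \<in> B" for x
    using that f(3) closedin_subset[OF assms(4)] by (auto simp: F_def)
  ultimately show ?thesis by (rule that)
qed

text \<open>A uniform boundedness argument made explicit. Every \<open>F\<close> has its own
  constant, yet peaks of height \<open>\<delta>\<close> occur where the weight \<open>D\<close> is
  arbitrarily small. Hump \<open>n\<close> sits at a point \<open>y n\<close> where \<open>D\<close>
  is too small for the earlier humps to matter, and the later humps are too small to matter. The sum
  \<open>L\<close> of all humps then defeats every constant.\<close>

lemma gliding_hump:
  fixes \<Delta> :: "'y \<Rightarrow> ('x \<Rightarrow> complex) \<Rightarrow> complex" and D :: "'y \<Rightarrow> real"
  assumes add: "\<And>y F H. y \<in> Y \<Longrightarrow> F \<in> cfun TX \<Longrightarrow> H \<in> cfun TX \<Longrightarrow> \<Delta> y (F + H) = \<Delta> y F + \<Delta> y H"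
    and scale: "\<And>y c F. y \<in> Y \<Longrightarrow> F \<in> cfun TX \<Longrightarrow> \<Delta> y (fscale c F) = c * \<Delta> y F"
    and K: "K > 0" "\<And>y F M. y \<in> Y \<Longrightarrow> F \<in> cfun TX \<Longrightarrow> (\<And>x. norm (F x) \<le> M) \<Longrightarrow> norm (\<Delta> y F) \<le> K * M"
    and dom: "\<And>F. F \<in> cfun TX \<Longrightarrow> \<exists>C. \<forall>y\<in>Y. norm (\<Delta> y F) \<le> C * D y"
    and D: "\<And>y. y \<in> Y \<Longrightarrow> D y \<ge> 0" and \<delta>: "\<delta> > 0"
    and peak: "\<And>\<eta>. \<eta> > 0 \<Longrightarrow> \<exists>y\<in>Y. D y < \<eta> \<and> (\<exists>F\<in>cfun TX. (\<forall>x. norm (F x) \<le> 1) \<and> \<delta> \<le> norm (\<Delta> y F))"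
  shows False
proof -
  have sub: "fun_space.subspace (cfun TX)"
    unfolding fun_space.subspace_def cfun_def fscale_def
    by (auto simp: plus_fun_def zero_fun_def intro!: continuous_intros)
  have "\<exists>C\<ge>0. \<forall>y\<in>Y. norm (\<Delta> y F) \<le> C * D y" if F: "F \<in> cfun TX" for F
  proof -
    obtain C where C: "\<forall>y\<in>Y. norm (\<Delta> y F) \<le> C * D y" using dom[OF F] by blast
    have "norm (\<Delta> y F) \<le> \<bar>C\<bar> * D y" if y: "y \<in> Y" for y
    proof -
      have "norm (\<Delta> y F) \<le> C * D y" using C y by blast
      also have "\<dots> \<le> \<bar>C\<bar> * D y" using D[OF y] by (intro mult_right_mono) auto
      finally show ?thesis .
    qed
    then show ?thesis by (intro exI[of _ "\<bar>C\<bar>"]) auto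
  qed
  then obtain Cf where Cf: "\<And>F. F \<in> cfun TX \<Longrightarrow> Cf F \<ge> 0"
    "\<And>F y. F \<in> cfun TX \<Longrightarrow> y \<in> Y \<Longrightarrow> norm (\<Delta> y F) \<le> Cf F * D y" by metis
  obtain yy FF where yF: "\<And>\<eta>. \<eta> > 0 \<Longrightarrow> yy \<eta> \<in> Y" "\<And>\<eta>. \<eta> > 0 \<Longrightarrow> D (yy \<eta>) < \<eta>"
    "\<And>\<eta>. \<eta> > 0 \<Longrightarrow> FF \<eta> \<in> cfun TX" "\<And>\<eta> x. \<eta> > 0 \<Longrightarrow> norm (FF \<eta> x) \<le> 1"
    "\<And>\<eta>. \<eta> > 0 \<Longrightarrow> \<delta> \<le> norm (\<Delta> (yy \<eta>) (FF \<eta>))"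
  proof -
    have "\<exists>p. \<eta> > 0 \<longrightarrow> fst p \<in> Y \<and> D (fst p) < \<eta> \<and> snd p \<in> cfun TX \<and> (\<forall>x. norm (snd p x) \<le> 1)
       \<and> \<delta> \<le> norm (\<Delta> (fst p) (snd p))" for \<eta>
      using peak[of \<eta>] by (cases "\<eta> > 0") auto
    then obtain p where p: "\<And>\<eta>. \<eta> > 0 \<longrightarrow> fst (p \<eta>) \<in> Y \<and> D (fst (p \<eta>)) < \<eta> \<and> snd (p \<eta>) \<in> cfun TX \<and>
      (\<forall>x. norm (snd (p \<eta>) x) \<le> 1) \<and> \<delta> \<le> norm (\<Delta> (fst (p \<eta>)) (snd (p \<eta>)))" by metis
    show ?thesis
      by (rule that[of "\<lambda>\<eta>. fst (p \<eta>)" "\<lambda>\<eta>. snd (p \<eta>)"]) (use p in auto)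
  qed
  \<comment> \<open>Chosen so that \<open>K * (r / (1 - r)) = \<delta> / 4\<close>: all humps after
    the current one together account for at most a quarter of it.\<close>
  define r where "r = \<delta> / (\<delta> + 4 * K)"
  have r: "0 < r" "r < 1" using \<delta> K(1) by (simp_all add: r_def divide_less_eq)
  have rK: "K * (r / (1 - r)) = \<delta> / 4"
  proof -
    have S: "\<delta> + 4 * K \<noteq> 0" using \<delta> K(1) by simp
    have "1 - r = 4 * K / (\<delta> + 4 * K)" using S by (simp add: r_def field_simps)
    then have "r / (1 - r) = \<delta> / (4 * K)" using S by (simp add: r_def)
    then show ?thesis using K(1) by simp
  qed
  \<comment> \<open>The smallness demanded of \<open>D\<close> at stage \<open>n\<close>. The factor
    \<open>1 + Cf G\<close> keeps the contribution of the partial sum \<open>G\<close> to a quarter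
    of the hump; the factor \<open>n + 1\<close> drives the required constant to infinity.\<close>
  define et where "et n G = r ^ n * \<delta> / (4 * (1 + Cf G) * (real n + 1))" for n G
  define G where "G = rec_nat 0 (\<lambda>n G. G + fscale (of_real (r ^ n)) (FF (et n G)))"
  have G0: "G 0 = 0" and GS: "G (Suc n) = G n + fscale (of_real (r ^ n)) (FF (et n (G n)))" for n
    by (simp_all add: G_def)
  have etp: "et n H > 0" if "H \<in> cfun TX" for n H
    unfolding et_def using Cf(1)[OF that] \<delta> r by (intro divide_pos_pos mult_pos_pos) auto
  have Gm: "G n \<in> cfun TX" for n
  proof (induction n)
    case 0
    then show ?case using fun_space.subspace_0[OF sub] by (simp only: G0)
  next
    case (Suc n)
    then show ?case unfolding GS
      using yF(3)[OF etp[OF Suc]] by (intro fun_space.subspace_add[OF sub] fun_space.subspace_scale[OF sub])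
  qed
  define H where "H n = FF (et n (G n))" for n
  define y where "y n = yy (et n (G n))" for n
  note ep = etp[OF Gm]
  have Hm: "H n \<in> cfun TX" and H1: "norm (H n x) \<le> 1" and yY: "y n \<in> Y"
    and Dy: "D (y n) < et n (G n)" and peak': "\<delta> \<le> norm (\<Delta> (y n) (H n))" for n x
    using yF[OF ep[of n n]] by (simp_all add: H_def y_def)
  have Gsum: "G n x = (\<Sum>k<n. of_real (r ^ k) * H k x)" for n x
    by (induction n) (simp_all add: G0 GS H_def fscale_def)
  have bnd: "norm (of_real (r ^ k) * H k x) \<le> r ^ k" for k x
    using mult_left_mono[OF H1[of k x], of "r ^ k"] r by (simp add: norm_mult norm_power)
  have geo: "summable (\<lambda>k. r ^ (k + n))" for n
    using summable_ignore_initial_segment[OF summable_geometric[of r]] r by simp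
  have summ: "summable (\<lambda>k. of_real (r ^ k) * H k x)" for x
    by (rule summable_comparison_test'[OF geo[of 0], of 0]) (use bnd in simp)
  define L where "L x = (\<Sum>k. of_real (r ^ k) * H k x)" for x
  have tail: "norm (L x - G n x) \<le> r ^ n / (1 - r)" for n x
  proof -
    have "L x - G n x = (\<Sum>k. of_real (r ^ (k + n)) * H (k + n) x)"
      unfolding L_def Gsum using suminf_minus_initial_segment[OF summ[of x], of n] by simp
    also have "norm \<dots> \<le> (\<Sum>k. r ^ (k + n))"
      by (rule norm_suminf_le[OF _ geo]) (rule bnd)
    also have "\<dots> = r ^ n / (1 - r)"
    proof -
      have "summable (\<lambda>k. r ^ k)" using geo[of 0] by simp
      from suminf_mult2[OF this, of "r ^ n"] show ?thesis
        using r by (simp add: power_add suminf_geometric)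
    qed
    finally show ?thesis .
  qed
  have r0: "(\<lambda>n. r ^ n / (1 - r)) \<longlonglongrightarrow> 0"
    using tendsto_divide[OF LIMSEQ_realpow_zero[of r] tendsto_const[of "1 - r"]] r by simp
  have Lm: "L \<in> cfun TX"
  proof -
    have "continuous_map TX euclidean L"
    proof (rule continuous_map_uniform)
      fix e :: real assume "e > 0"
      then obtain n where "r ^ n / (1 - r) < e"
        using order_tendstoD(2)[OF r0, of e] by (auto simp: eventually_sequentially)
      then have "\<forall>x\<in>topspace TX. norm (G n x - L x) \<le> e"
        using tail[of _ n] by (metis less_imp_le norm_minus_commute order_trans)
      then show "\<exists>g. continuous_map TX euclidean g \<and> (\<forall>x\<in>topspace TX. norm (g x - L x) \<le> e)"
        using Gm[of n] by (auto simp: cfun_def)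
    qed
    moreover have "L x = 0" if "x \<notin> topspace TX" for x
      using Hm that by (simp add: L_def cfun_def)
    ultimately show ?thesis by (simp add: cfun_def)
  qed
  \<comment> \<open>At \<open>y n\<close> the hump contributes at least
    \<open>r ^ n * \<delta>\<close>, while the earlier sum and the later tail each take away at most
    a quarter of that. So \<open>\<Delta> (y n) L\<close> has at least half of this size, against
    \<open>D (y n)\<close> below \<open>r ^ n * \<delta> / (4 * (n + 1))\<close>.\<close>
  have main: "2 * (real n + 1) \<le> Cf L" for n
  proof -
    let ?y = "y n"
    have mR: "L - G (Suc n) \<in> cfun TX" by (rule fun_space.subspace_diff[OF sub Lm Gm])
    have mF: "fscale (of_real (r ^ n)) (H n) \<in> cfun TX" by (rule fun_space.subspace_scale[OF sub Hm])
    have "L = (G n + fscale (of_real (r ^ n)) (H n)) + (L - G (Suc n))"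
      by (simp add: GS H_def)
    then have "\<Delta> ?y L = \<Delta> ?y ((G n + fscale (of_real (r ^ n)) (H n)) + (L - G (Suc n)))"
      by (rule arg_cong)
    also have "\<dots> = \<Delta> ?y (G n) + of_real (r ^ n) * \<Delta> ?y (H n) + \<Delta> ?y (L - G (Suc n))"
      using add[OF yY[of n] fun_space.subspace_add[OF sub Gm mF] mR] add[OF yY[of n] Gm mF] scale[OF yY[of n] Hm]
      by simp
    finally have e: "of_real (r ^ n) * \<Delta> ?y (H n) = \<Delta> ?y L - \<Delta> ?y (G n) - \<Delta> ?y (L - G (Suc n))"
      by simp
    have "r ^ n * \<delta> \<le> norm (of_real (r ^ n) * \<Delta> ?y (H n))"
      using peak'[of n] r by (simp add: norm_mult norm_power)
    also have "\<dots> \<le> norm (\<Delta> ?y L) + norm (\<Delta> ?y (G n)) + norm (\<Delta> ?y (L - G (Suc n)))"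
      unfolding e by (meson add_right_mono norm_triangle_ineq4 order_trans)
    finally have 1: "r ^ n * \<delta> \<le> norm (\<Delta> ?y L) + norm (\<Delta> ?y (G n)) + norm (\<Delta> ?y (L - G (Suc n)))" .
    have "norm (\<Delta> ?y (L - G (Suc n))) \<le> K * (r ^ Suc n / (1 - r))"
      by (rule K(2)[OF yY mR]) (use tail[of _ "Suc n"] in simp)
    also have "\<dots> = r ^ n * (K * (r / (1 - r)))" by simp
    finally have 2: "norm (\<Delta> ?y (L - G (Suc n))) \<le> r ^ n * \<delta> / 4" unfolding rK by simp
    define a where "a = r ^ n * \<delta>"
    define q where "q = real n + 1"
    have a: "a > 0" and q: "q \<ge> 1" using r \<delta> by (simp_all add: a_def q_def)
    have etle: "c * D ?y \<le> c * a / (4 * (1 + Cf (G n)) * q)" if "c \<ge> 0" for c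
      using mult_left_mono[OF less_imp_le[OF Dy[of n]] that] by (simp add: et_def a_def q_def mult_ac)
    have CG: "0 \<le> Cf (G n)" by (rule Cf(1)[OF Gm])
    have p: "0 < (1 + Cf (G n)) * q" using CG q by simp
    have "norm (\<Delta> ?y (G n)) \<le> Cf (G n) * D ?y" by (rule Cf(2)[OF Gm yY])
    also have "\<dots> \<le> Cf (G n) * a / (4 * (1 + Cf (G n)) * q)" by (rule etle[OF CG])
    also have "\<dots> \<le> ((1 + Cf (G n)) * q * a) / (4 * (1 + Cf (G n)) * q)"
    proof (intro divide_right_mono mult_right_mono)
      have "(1 + Cf (G n)) * 1 \<le> (1 + Cf (G n)) * q" using CG q by (intro mult_left_mono) auto
      then show "Cf (G n) \<le> (1 + Cf (G n)) * q" unfolding mult_1_right by (rule order_trans[rotated]) simp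
    qed (use a q CG in auto)
    also have "\<dots> = a / 4"
    proof -
      have "p * a / (4 * p) = a / 4" if "p \<noteq> 0" for p :: real using that by simp
      from this[of "(1 + Cf (G n)) * q"] show ?thesis using p by (simp only: mult.assoc)
    qed
    finally have 3: "norm (\<Delta> ?y (G n)) \<le> a / 4" .
    have CL: "0 \<le> Cf L" by (rule Cf(1)[OF Lm])
    have "norm (\<Delta> ?y L) \<le> Cf L * D ?y" by (rule Cf(2)[OF Lm yY])
    also have "\<dots> \<le> Cf L * a / (4 * (1 + Cf (G n)) * q)" by (rule etle[OF CL])
    also have "\<dots> \<le> Cf L * a / (4 * q)"
    proof (rule divide_left_mono)
      have "1 * q \<le> (1 + Cf (G n)) * q" using CG q by (intro mult_right_mono) auto
      then show "4 * q \<le> 4 * (1 + Cf (G n)) * q" by (simp only: mult.assoc mult_1_left)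
      show "0 < 4 * (1 + Cf (G n)) * q * (4 * q)" using p q CG by (intro mult_pos_pos) auto
    qed (use CL a in simp)
    finally have "a / 2 \<le> Cf L * a / (4 * q)"
      using 1 2 3 unfolding a_def[symmetric] by linarith
    then have "a / 2 * (4 * q) \<le> Cf L * a" using q by (subst (asm) pos_le_divide_eq) auto
    then have "a * (2 * q) \<le> a * Cf L" by (simp add: mult_ac)
    then show ?thesis using a by (simp only: mult_le_cancel_left_pos q_def)
  qed
  obtain n where "Cf L < real n" using reals_Archimedean2 by blast
  then show False using main[of n] by simp
qed

section \<open>Self-adjoint bump functions on the group\<close>

context compact_group
begin

lemma small_neighborhood:
  assumes "openin T V" "\<one> \<in> V" and f: "continuous_map (prod_topology T T) T (\<lambda>(a, b). f a b)" "f \<one> \<one> = \<one>"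
  obtains N where "openin T N" "\<one> \<in> N" "\<And>a b. a \<in> N \<Longrightarrow> b \<in> N \<Longrightarrow> f a b \<in> V"
proof -
  have op: "openin (prod_topology T T) {z \<in> topspace (prod_topology T T). (\<lambda>(a, b). f a b) z \<in> V}"
    by (rule openin_continuous_map_preimage[OF f(1) assms(1)])
  have mem: "(\<one>, \<one>) \<in> {z \<in> topspace (prod_topology T T). (\<lambda>(a, b). f a b) z \<in> V}"
    using assms f(2) by (simp add: topspace_eq)
  obtain A B where AB: "openin T A" "openin T B" "\<one> \<in> A" "\<one> \<in> B"
    "A \<times> B \<subseteq> {z \<in> topspace (prod_topology T T). (\<lambda>(a, b). f a b) z \<in> V}"
    using openin_prod_topology_alt[THEN iffD1, OF op, rule_format, OF mem] by (elim exE conjE)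
  show ?thesis
    by (rule that[of "A \<inter> B"]) (use AB in auto)
qed

text \<open>The kernel used later is \<open>\<theta> \<star> \<theta>\<close>. It has the smoothed
  form that \<open>peter_weyl\<close> approximates, its support is controlled by that of
  \<open>\<theta>\<close>, and its mean, being the square of that of \<open>\<theta>\<close>, is not
  zero.\<close>

lemma bump:
  assumes U: "openin T U" "s \<in> U"
  obtains \<theta> C where "\<theta> \<in> cfun T" "adj \<theta> = \<theta>" "haar \<theta> \<noteq> 0" "compactin T C"
    "\<And>r. r \<notin> C \<Longrightarrow> (\<theta> \<star> \<theta>) r = 0" "\<And>a b. a \<in> C \<Longrightarrow> b \<in> C \<Longrightarrow> a \<otimes> inv b \<otimes> s \<in> U"
proof -
  have sG: "s \<in> carrier G" using U openin_subset topspace_eq by blast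
  define V0 where "V0 = {v \<in> topspace T. v \<otimes> s \<in> U}"
  have V0: "openin T V0"
    unfolding V0_def by (rule openin_continuous_map_preimage[OF continuous_mult' U(1)]) (use sG topspace_eq in auto)
  have 1: "\<one> \<in> V0" using U sG by (simp add: V0_def topspace_eq)
  obtain V1 where V1: "openin T V1" "\<one> \<in> V1" "\<And>a b. a \<in> V1 \<Longrightarrow> b \<in> V1 \<Longrightarrow> a \<otimes> inv b \<in> V0"
  proof (rule small_neighborhood[OF V0 1])
    show "continuous_map (prod_topology T T) T (\<lambda>(a, b). a \<otimes> inv b)"
      unfolding split_beta by (intro continuous_mult' continuous_inv' continuous_map_fst continuous_map_snd)
  qed auto
  obtain N where N: "openin T N" "\<one> \<in> N" "\<And>a b. a \<in> N \<Longrightarrow> b \<in> N \<Longrightarrow> a \<otimes> b \<in> V1"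
    by (rule small_neighborhood[OF V1(1,2) continuous_mult]) auto
  have c1: "closedin T {\<one>}" by (rule closedin_Hausdorff_singleton[OF hausdorff_T]) (simp add: topspace_eq)
  have c2: "closedin T (topspace T - N)" using N(1) by blast
  obtain f where f: "f \<in> cfun T" "\<And>x. \<exists>r. 0 \<le> r \<and> r \<le> 1 \<and> f x = complex_of_real r"
    "\<And>x. x \<in> topspace T - N \<Longrightarrow> f x = 0" "\<And>x. x \<in> {\<one>} \<Longrightarrow> f x = 1"
    by (rule cfun_urysohn[OF compact_T hausdorff_T c2 c1]) (use N(2) in \<open>auto simp: disjnt_def\<close>)
  \<comment> \<open>Urysohn only gives zeros outside the open set \<open>N\<close>. Clipping at
    height one half makes the function vanish off a closed, hence compact, subset \<open>R\<close>
    of \<open>N\<close>.\<close>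
  define g where "g t = max (Re (f t) - 1/2) 0" for t
  have cg: "continuous_map T euclideanreal g"
    unfolding g_def by (intro continuous_map_real_max continuous_map_diff continuous_map_Re cfunT[OF f(1)] continuous_map_canonical_const)
  define R where "R = {t \<in> topspace T. Re (f t) \<in> {1/2..}}"
  have "closedin T R" unfolding R_def
    by (rule closedin_continuous_map_preimage[OF continuous_map_Re[OF cfunT[OF f(1)]]]) simp
  then have R: "compactin T R" using closedin_compact_space[OF compact_T] by blast
  have RN: "R \<subseteq> N"
  proof
    fix t assume t: "t \<in> R"
    then show "t \<in> N" using f(3)[of t] by (cases "t \<in> N") (auto simp: R_def)
  qed
  have g0: "t \<in> R" if "t \<in> carrier G" "g t \<noteq> 0" for t
    using that by (auto simp: g_def R_def topspace_eq max_def split: if_splits)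
  \<comment> \<open>Multiplying by the reflected function makes \<open>\<theta>\<close> real and
    symmetric, that is, self-adjoint.\<close>
  define \<theta> where "\<theta> t = (if t \<in> carrier G then complex_of_real (g t * g (inv t)) else 0)" for t
  have \<theta>m: "\<theta> \<in> cfun T"
  proof (rule cfunT_memI)
    have "continuous_map T euclideanreal (\<lambda>t. g (inv t))"
      using continuous_map_compose[OF continuous_inv cg] by (simp add: o_def)
    then have "cfunG (\<lambda>t. complex_of_real (g t * g (inv t)))"
      by (intro continuous_map_of_real continuous_map_real_mult cg)
    then show "cfunG \<theta>" by (rule continuous_map_eq) (simp add: \<theta>_def topspace_eq)
  qed (simp add: \<theta>_def)
  have "adj \<theta> = \<theta>"
    by (rule cfun_eqI) (use \<theta>m in \<open>auto simp: adj_def \<theta>_def\<close>)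
  moreover have "haar \<theta> \<noteq> 0"
  proof -
    have "Re (haar \<theta>) > 0"
      by (rule haar_pos[OF cfunT[OF \<theta>m], of \<one>]) (use f(4) in \<open>auto simp: \<theta>_def g_def\<close>)
    then show ?thesis by auto
  qed
  moreover
  define C where "C = (\<lambda>(a, b). a \<otimes> b) ` (R \<times> R)"
  have "compactin T C" unfolding C_def
    by (rule image_compactin[OF _ continuous_mult]) (use R in \<open>simp add: compactin_Times\<close>)
  moreover have "(\<theta> \<star> \<theta>) r = 0" if r: "r \<notin> C" for r
  proof (cases "r \<in> carrier G")
    case rG: True
    have "\<theta> q * \<theta> (inv q \<otimes> r) = 0" if q: "q \<in> carrier G" for q
    proof (rule ccontr)
      assume "\<theta> q * \<theta> (inv q \<otimes> r) \<noteq> 0"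
      then have "q \<in> R" "inv q \<otimes> r \<in> R" using q rG g0 by (auto simp: \<theta>_def)
      then have "(\<lambda>(a, b). a \<otimes> b) (q, inv q \<otimes> r) \<in> C" unfolding C_def by (intro imageI) simp
      then show False using r q rG by (simp add: mult_inv_cancel)
    qed
    then have "haar (\<lambda>q. \<theta> q * \<theta> (inv q \<otimes> r)) = haar (\<lambda>q. 0)" by (intro haar_cong) auto
    then show ?thesis by (simp add: self.conv_def haar_const)
  qed (simp add: self.conv_def topspace_eq)
  moreover have "C \<subseteq> V1" using N(3) RN by (auto simp: C_def)
  then have "a \<otimes> inv b \<otimes> s \<in> U" if "a \<in> C" "b \<in> C" for a b
    using that V1(3)[of a b] by (auto simp: V0_def)
  ultimately show ?thesis using that \<theta>m by blast
qed

end

section \<open>Convolution by matrix coefficients and semicontinuity of stabilizers\<close>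

context compact_action
begin

lemma conv_sum_left:
  assumes "finite J" "\<And>j. j \<in> J \<Longrightarrow> w j \<in> cfun T" "F \<in> cfun TX"
  shows "conv (\<Sum>j\<in>J. fscale (c j) (w j)) F = (\<Sum>j\<in>J. fscale (c j) (conv (w j) F))"
  using assms(1,2)
proof (induction J rule: finite_induct)
  case empty
  show ?case by (auto simp: conv_def fun_eq_iff haar_const)
next
  case (insert j J)
  have "(\<Sum>j\<in>J. fscale (c j) (w j)) \<in> cfun T" by (rule cfun_sum) (use insert in auto)
  then show ?case unfolding sum.insert[OF insert(1,2)]
    using insert assms(3) by (subst conv_add_left) (auto simp: conv_fscale_left cfun_fscale)
qed

text \<open>By \<open>trans_conv\<close> translations act on the kernel, so kernels that transform
  by \<open>\<alpha>\<close> produce functions on \<open>X\<close> that transform by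
  \<open>\<alpha>\<close>.\<close>

lemma conv_comps:
  assumes w: "w \<in> self.comps d \<alpha>" and F: "F \<in> cfun TX"
  shows "conv w F \<in> comps d \<alpha>"
proof -
  obtain e i where e: "e \<in> self.mor d \<alpha>" "i < d" "w = e i" using w by (auto simp: self.comps_def)
  have em: "e i \<in> cfun T" if "i < d" for i using self.mor_cfun[OF e(1) that] .
  have "(\<lambda>i. conv (e i) F) \<in> mor d \<alpha>"
    unfolding mor_def
  proof (intro CollectI conjI allI impI ballI)
    show "conv (e i) F \<in> cfun TX" if "i < d" for i using conv_cfun[OF cfunT[OF em[OF that]] F] .
    fix s i assume s: "s \<in> carrier G" and i: "i < d"
    have "trans s (conv (e i) F) = conv (\<lambda>r. e i (inv s \<otimes> r)) F"
      by (rule trans_conv[OF cfunT[OF em[OF i]] F s])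
    also have "\<dots> = conv (self.trans s (e i)) F"
      by (rule conv_cong) (simp add: self.trans_apply topspace_eq)
    also have "self.trans s (e i) = (\<Sum>j<d. fscale (\<alpha> s $$ (j, i)) (e j))"
      by (rule self.mor_trans[OF e(1) s i])
    also have "conv \<dots> F = (\<Sum>j<d. fscale (\<alpha> s $$ (j, i)) (conv (e j) F))"
      using em F by (intro conv_sum_left) auto
    finally show "trans s (conv (e i) F) = (\<Sum>j<d. fscale (\<alpha> s $$ (j, i)) (conv (e j) F))" .
  qed
  then show ?thesis using e(2,3) by (auto simp: comps_def)
qed

definition dev :: "'a \<Rightarrow> ('x \<Rightarrow> complex) set \<Rightarrow> 'x \<Rightarrow> real" where
  "dev s S y = (\<Sum>h\<in>S. norm (h y - h (act s y)))"

text \<open>The order of quantifiers matters: \<open>S\<close> is chosen before \<open>F\<close>,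
  the constant \<open>C\<close> after it. This is the shape that \<open>gliding_hump\<close>
  refutes.\<close>

definition dominated :: "'a \<Rightarrow> ('a \<Rightarrow> complex) \<Rightarrow> bool" where
  "dominated s w \<longleftrightarrow> (\<exists>S. finite S \<and> S \<subseteq> cfun TX \<and>
     (\<forall>F\<in>cfun TX. \<exists>C\<ge>0. \<forall>y\<in>topspace TX. norm (conv w F y - conv w F (act s y)) \<le> C * dev s S y))"

lemma dev_mono: "finite S' \<Longrightarrow> S \<subseteq> S' \<Longrightarrow> dev s S y \<le> dev s S' y"
  unfolding dev_def by (rule sum_mono2) auto

lemma dev_nonneg: "0 \<le> dev s S y"
  unfolding dev_def by (rule sum_nonneg) auto

lemma invariant_cfun_act:
  assumes "a \<in> invariant_cfun G TX act" "s \<in> carrier G" "y \<in> topspace TX"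
  shows "a (act s y) = a y"
proof -
  have "trans s a = a" using assms by (simp add: invariant_cfun_def)
  then have "a (act (inv s) (act s y)) = a (act s y)"
    using trans_apply[of "act s y" s a] assms by simp
  then show ?thesis using assms by simp
qed

text \<open>The coefficients of \<open>conv w F\<close> with respect to the generators are
  invariant, hence equal at \<open>y\<close> and \<open>act s y\<close>; they factor out of the
  difference, and only their bounds enter the constant.\<close>

lemma dominated_coefs:
  assumes fg: "\<And>d \<alpha>. irreducible_representation G T d \<alpha> \<Longrightarrow>
       finitely_generated_over (invariant_cfun G TX act) (isotypic_component G TX act d \<alpha>)"
    and w: "w \<in> coefs" and s: "s \<in> carrier G"
  shows "dominated s w"
proof -
  obtain d \<alpha> where irr: "irreducible_representation G T d \<alpha>" and w': "w \<in> self.comps d \<alpha>"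
    using w by (auto simp: coefs_def)
  let ?M = "isotypic_component G TX act d \<alpha>"
  obtain S where S: "finite S" "S \<subseteq> ?M"
    "?M = {(\<Sum>h\<in>S. a h * h) | a. \<forall>h\<in>S. a h \<in> invariant_cfun G TX act}"
    using fg[OF irr] unfolding finitely_generated_over_def by blast
  have MC: "?M \<subseteq> cfun TX" using comps_cfun isotypic_component_eq_span[OF irr] by simp
  have "\<exists>C\<ge>0. \<forall>y\<in>topspace TX. norm (conv w F y - conv w F (act s y)) \<le> C * dev s S y"
    if F: "F \<in> cfun TX" for F
  proof -
    have "conv w F \<in> ?M"
      unfolding isotypic_component_eq_span[OF irr] by (rule fun_space.span_base[OF conv_comps[OF w' F]])
    then obtain a where a: "\<forall>h\<in>S. a h \<in> invariant_cfun G TX act" "conv w F = (\<Sum>h\<in>S. a h * h)"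
      unfolding S(3) by blast
    have "\<exists>B\<ge>0. \<forall>x. norm (a h x) \<le> B" if "h \<in> S" for h
    proof -
      have "a h \<in> cfun TX" using a(1) that by (simp add: invariant_cfun_def)
      from cfun_bounded[OF compact_TX this] obtain B where "B \<ge> 0" "\<And>x. norm (a h x) \<le> B" by metis
      then show ?thesis by blast
    qed
    then obtain B where B: "\<And>h. h \<in> S \<Longrightarrow> B h \<ge> 0" "\<And>h x. h \<in> S \<Longrightarrow> norm (a h x) \<le> B h" by metis
    have ap: "(\<Sum>h\<in>S. a h * h) y = (\<Sum>h\<in>S. a h y * h y)" for y
      using S(1) by (induction S rule: finite_induct) auto
    have "norm (conv w F y - conv w F (act s y)) \<le> (\<Sum>h\<in>S. B h) * dev s S y" if y: "y \<in> topspace TX" for y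
    proof -
      have "conv w F y - conv w F (act s y) = (\<Sum>h\<in>S. a h y * (h y - h (act s y)))"
        unfolding a(2) ap sum_subtractf[symmetric]
        using invariant_cfun_act[OF _ s y] a(1) by (intro sum.cong) (auto simp: right_diff_distrib)
      also have "norm \<dots> \<le> (\<Sum>h\<in>S. norm (a h y * (h y - h (act s y))))" by (rule norm_sum)
      also have "\<dots> \<le> (\<Sum>h\<in>S. (\<Sum>h\<in>S. B h) * norm (h y - h (act s y)))"
      proof (rule sum_mono)
        fix h assume h: "h \<in> S"
        have "norm (a h y) \<le> B h" using B(2)[OF h] .
        also have "\<dots> \<le> (\<Sum>h\<in>S. B h)" by (rule member_le_sum) (use h B S in auto)
        finally show "norm (a h y * (h y - h (act s y))) \<le> (\<Sum>h\<in>S. B h) * norm (h y - h (act s y))"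
          by (simp add: norm_mult mult_right_mono)
      qed
      also have "\<dots> = (\<Sum>h\<in>S. B h) * dev s S y" by (simp add: dev_def sum_distrib_left)
      finally show ?thesis .
    qed
    moreover have "(\<Sum>h\<in>S. B h) \<ge> 0" using B by (intro sum_nonneg)
    ultimately show ?thesis by blast
  qed
  then show ?thesis unfolding dominated_def using S(1,2) MC by blast
qed

lemma dominated_span:
  assumes dom: "\<And>w. w \<in> coefs \<Longrightarrow> dominated s w" and w: "w \<in> fun_space.span coefs"
  shows "dominated s w"
proof -
  let ?Q = "{w \<in> cfun T. dominated s w}"
  have "fun_space.subspace ?Q"
    unfolding fun_space.subspace_def
  proof (intro conjI ballI allI)
    have "conv 0 F y = 0" for F y by (simp add: conv_def haar_const)
    then have "dominated s 0" unfolding dominated_def by (intro exI[of _ "{}"]) (auto simp: dev_def)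
    then show "0 \<in> ?Q" using cfun_0 by blast
    fix v assume v: "v \<in> ?Q"
    then obtain S where S: "finite S" "S \<subseteq> cfun TX"
      "\<And>F. F \<in> cfun TX \<Longrightarrow> \<exists>C\<ge>0. \<forall>y\<in>topspace TX. norm (conv v F y - conv v F (act s y)) \<le> C * dev s S y"
      unfolding dominated_def by auto
    have vm: "v \<in> cfun T" using v by simp
    show "fscale c v \<in> ?Q" for c
    proof -
      have "\<exists>C\<ge>0. \<forall>y\<in>topspace TX. norm (conv (fscale c v) F y - conv (fscale c v) F (act s y)) \<le> C * dev s S y"
        if F: "F \<in> cfun TX" for F
      proof -
        obtain C where C: "C \<ge> 0" "\<And>y. y \<in> topspace TX \<Longrightarrow> norm (conv v F y - conv v F (act s y)) \<le> C * dev s S y"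
          using S(3)[OF F] by blast
        have "norm (conv (fscale c v) F y - conv (fscale c v) F (act s y)) \<le> (norm c * C) * dev s S y"
          if "y \<in> topspace TX" for y
          using mult_left_mono[OF C(2)[OF that], of "norm c"] conv_fscale_left[OF cfunT[OF vm] F, of c]
          by (simp add: fscale_def mult.assoc flip: norm_mult right_diff_distrib)
        then show ?thesis using C(1) by (intro exI[of _ "norm c * C"]) auto
      qed
      then show ?thesis using S(1,2) vm cfun_fscale unfolding dominated_def by blast
    qed
    fix u assume u: "u \<in> ?Q"
    then obtain S' where S': "finite S'" "S' \<subseteq> cfun TX"
      "\<And>F. F \<in> cfun TX \<Longrightarrow> \<exists>C\<ge>0. \<forall>y\<in>topspace TX. norm (conv u F y - conv u F (act s y)) \<le> C * dev s S' y"
      unfolding dominated_def by auto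
    have um: "u \<in> cfun T" using u by simp
    have "\<exists>C\<ge>0. \<forall>y\<in>topspace TX. norm (conv (v + u) F y - conv (v + u) F (act s y)) \<le> C * dev s (S \<union> S') y"
      if F: "F \<in> cfun TX" for F
    proof -
      obtain C where C: "C \<ge> 0" "\<And>y. y \<in> topspace TX \<Longrightarrow> norm (conv v F y - conv v F (act s y)) \<le> C * dev s S y"
        using S(3)[OF F] by blast
      obtain C' where C': "C' \<ge> 0" "\<And>y. y \<in> topspace TX \<Longrightarrow> norm (conv u F y - conv u F (act s y)) \<le> C' * dev s S' y"
        using S'(3)[OF F] by blast
      have "norm (conv (v + u) F y - conv (v + u) F (act s y)) \<le> (C + C') * dev s (S \<union> S') y"
        if y: "y \<in> topspace TX" for y
      proof -
        have "conv (v + u) F y - conv (v + u) F (act s y) =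
           (conv v F y - conv v F (act s y)) + (conv u F y - conv u F (act s y))"
          using conv_add_left[OF cfunT[OF vm] cfunT[OF um] F] by simp
        also have "norm \<dots> \<le> norm (conv v F y - conv v F (act s y)) + norm (conv u F y - conv u F (act s y))"
          by (rule norm_triangle_ineq)
        also have "\<dots> \<le> C * dev s (S \<union> S') y + C' * dev s (S \<union> S') y"
          using C(2)[OF y] C'(2)[OF y] S(1) S'(1) C(1) C'(1)
          by (intro add_mono order_trans[OF C(2)[OF y]] order_trans[OF C'(2)[OF y]] mult_left_mono dev_mono) auto
        finally show ?thesis by (simp add: distrib_right)
      qed
      then show ?thesis using C(1) C'(1) by (intro exI[of _ "C + C'"]) auto
    qed
    then have "dominated s (v + u)" unfolding dominated_def using S(1,2) S'(1,2)
      by (intro exI[of _ "S \<union> S'"]) auto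
    then show "v + u \<in> ?Q" using cfun_add[OF vm um] by blast
  qed
  moreover have "coefs \<subseteq> ?Q"
    using dom span_coefs_cfun fun_space.span_superset by blast
  ultimately have "fun_space.span coefs \<subseteq> ?Q" using fun_space.span_minimal by blast
  then show ?thesis using w by blast
qed

text \<open>The bound sees the kernel only through \<open>nrm\<close>, so approximating a kernel in
  \<open>nrm\<close> approximates its convolutions uniformly over all points and over all
  \<open>F\<close> bounded by 1.\<close>

lemma norm_conv_le_nrm_X:
  assumes u: "u \<in> cfun T" and F: "F \<in> cfun TX" "\<And>x. norm (F x) \<le> 1" and y: "y \<in> topspace TX"
  shows "norm (conv u F y) \<le> nrm u"
proof -
  define F' where "F' r = (if r \<in> carrier G then cnj (F (act (inv r) y)) else 0)" for r
  have F'm: "F' \<in> cfun T"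
  proof (rule cfunT_memI)
    have "cfunG (\<lambda>r. cnj (F (act (inv r) y)))"
      by (intro continuous_map_cnj cfun_act_cont[OF F(1)] continuous_inv) (use y in simp)
    then show "cfunG F'" by (rule continuous_map_eq) (simp add: F'_def topspace_eq)
  qed (simp add: F'_def)
  have "conv u F y = ip u F'"
    using y by (auto simp: conv_def ip_def F'_def intro!: haar_cong)
  also have "norm \<dots> \<le> nrm u * nrm F'" by (rule cauchy_schwarz[OF u F'm])
  also have "\<dots> \<le> nrm u * 1"
    using u F'm F(2) by (intro mult_left_mono nrm_le_sup) (auto simp: F'_def)
  finally show ?thesis by simp
qed

text \<open>The points with a stabilizer element outside \<open>V\<close> are the projection of a
  closed set along the compact group, and such a projection is a closed map.\<close>

lemma upper_semicontinuous_stabilizer: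
  "upper_semicontinuous_map TX T (\<lambda>x. stabilizer G act x)"
  unfolding upper_semicontinuous_map_def
proof (intro ballI allI impI)
  fix x U assume x: "x \<in> topspace TX" and U: "neighborhood_of T (stabilizer G act x) U"
  obtain V where V: "openin T V" "stabilizer G act x \<subseteq> V" "V \<subseteq> U" using U by (auto simp: neighborhood_of_def)
  define Z where "Z = {z \<in> topspace (prod_topology T TX). (\<lambda>(t, y). act t y) z = snd z} \<inter> ((topspace T - V) \<times> topspace TX)"
  have "closedin (prod_topology T TX) Z"
    unfolding Z_def using V(1)
    by (intro closedin_Int closedin_continuous_maps_eq[OF hausdorff_TX act_cont continuous_map_snd])
       (auto simp: closedin_prod_Times_iff)
  then have c: "closedin TX (snd ` Z)"
    using Abstract_Topological_Spaces.closed_map_snd[OF compact_T, of TX] by (auto simp: closed_map_def)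
  have "x \<notin> snd ` Z" using V(2) by (auto simp: Z_def stabilizer_def topspace_eq)
  moreover have "topspace TX - snd ` Z \<subseteq> {x' \<in> topspace TX. stabilizer G act x' \<subseteq> U}"
  proof
    fix y assume y: "y \<in> topspace TX - snd ` Z"
    have "t \<in> V" if t: "t \<in> stabilizer G act y" for t
    proof (rule ccontr)
      assume "t \<notin> V"
      then have "(t, y) \<in> Z" using t y by (auto simp: Z_def stabilizer_def topspace_eq)
      then show False using y by (metis DiffD2 image_eqI snd_conv)
    qed
    then show "y \<in> {x' \<in> topspace TX. stabilizer G act x' \<subseteq> U}" using y V(3) by auto
  qed
  ultimately show "neighborhood_of TX {x} {x' \<in> topspace TX. stabilizer G act x' \<subseteq> U}"
    unfolding neighborhood_of_def using c x
    by (intro conjI exI[of _ "topspace TX - snd ` Z"]) auto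
qed

text \<open>Suppose stabilizers arbitrarily close to \<open>x\<close> miss the neighbourhood
  \<open>U\<close> of \<open>s\<close>. At such a point \<open>y\<close>, a function that is 1 on
  the smeared point \<open>y\<close> and 0 on the smeared point \<open>act s y\<close> has a
  convolution with \<open>\<kappa>\<close> that jumps by \<open>haar \<kappa>\<close> between the
  two. After replacing \<open>\<kappa>\<close> by \<open>w\<close>, these jumps are the peaks for
  \<open>gliding_hump\<close>, with weight \<open>dev s S\<close>.\<close>

lemma lower_semicontinuous_stabilizer:
  assumes fg: "\<And>d \<alpha>. irreducible_representation G T d \<alpha> \<Longrightarrow>
       finitely_generated_over (invariant_cfun G TX act) (isotypic_component G TX act d \<alpha>)"
  shows "lower_semicontinuous_map TX T (\<lambda>x. stabilizer G act x)"
  unfolding lower_semicontinuous_map_def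
proof (intro ballI allI impI)
  fix x U assume x: "x \<in> topspace TX" and U: "openin T U \<and> stabilizer G act x \<inter> U \<noteq> {}"
  then obtain s where s: "s \<in> U" "s \<in> carrier G" "act s x = x" by (auto simp: stabilizer_def)
  have Uo: "openin T U" using U by blast
  let ?N = "{x' \<in> topspace TX. stabilizer G act x' \<inter> U \<noteq> {}}"
  show "neighborhood_of TX {x} ?N"
  proof (rule ccontr)
    assume not: "\<not> neighborhood_of TX {x} ?N"
    obtain \<theta> C where \<theta>: "\<theta> \<in> cfun T" "adj \<theta> = \<theta>" "haar \<theta> \<noteq> 0" and C: "compactin T C"
      "\<And>r. r \<notin> C \<Longrightarrow> (\<theta> \<star> \<theta>) r = 0" "\<And>a b. a \<in> C \<Longrightarrow> b \<in> C \<Longrightarrow> a \<otimes> inv b \<otimes> s \<in> U"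
      using bump[OF Uo s(1)] by metis
    have CG: "C \<subseteq> carrier G" using compactin_subset_topspace[OF C(1)] topspace_eq by simp
    define \<kappa> where "\<kappa> = \<theta> \<star> \<theta>"
    have \<kappa>m: "\<kappa> \<in> cfun T" using \<theta> by (simp add: \<kappa>_def)
    \<comment> \<open>Convolving with the constant function 1 multiplies it by the mean of the
      kernel, so associativity makes the mean multiplicative.\<close>
    have h\<kappa>: "haar \<kappa> = (haar \<theta>)\<^sup>2"
    proof -
      define one where "one y = (if y \<in> topspace TX then 1 else 0 :: complex)" for y
      have onem: "one \<in> cfun TX"
      proof -
        have "continuous_map TX euclidean one"
          by (rule continuous_map_eq[OF continuous_map_canonical_const[of _ "1::complex"]]) (simp add: one_def)
        then show ?thesis by (simp add: cfun_def one_def)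
      qed
      have co: "conv v one = fscale (haar v) one" for v
      proof
        fix y
        have "haar (\<lambda>r. v r * one (act (inv r) y)) = haar v" if "y \<in> topspace TX"
          using that by (intro haar_cong) (simp add: one_def)
        then show "conv v one y = fscale (haar v) one y" by (auto simp: conv_def fscale_def one_def)
      qed
      have "conv \<kappa> one x = conv \<theta> (conv \<theta> one) x" unfolding \<kappa>_def using conv_assoc[OF cfunT[OF \<theta>(1)] \<theta>(1) onem] by simp
      also have "\<dots> = conv \<theta> (fscale (haar \<theta>) one) x" by (simp only: co)
      also have "\<dots> = (haar \<theta>)\<^sup>2 * one x"
        unfolding conv_fscale_right[OF cfunT[OF \<theta>(1)] onem] co by (simp add: fscale_def power2_eq_square)
      finally show ?thesis using x by (simp add: co fscale_def one_def)
    qed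
    \<comment> \<open>The exact kernel gives a peak of height \<open>c\<close>. Passing to
      \<open>w\<close> costs at most \<open>c / 4\<close> at each of the two points and leaves
      \<open>c / 2\<close>.\<close>
    define c where "c = norm (haar \<kappa>)"
    have c: "c > 0" using h\<kappa> \<theta>(3) by (simp add: c_def)
    have n\<theta>: "nrm \<theta> + 1 > 0" using \<theta>(1) by (simp add: add_nonneg_pos)
    define e where "e = c / 4 / (nrm \<theta> + 1)"
    have e: "e > 0" using c n\<theta> by (simp add: e_def)
    obtain w where w: "w \<in> fun_space.span coefs" "nrm (\<kappa> - w) \<le> e * nrm \<theta>"
      using peter_weyl[OF \<theta>(1,2,1) e] unfolding \<kappa>_def by blast
    have wm: "w \<in> cfun T" using w(1) span_coefs_cfun by blast
    have wk: "nrm (\<kappa> - w) \<le> c / 4"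
    proof -
      have "e * nrm \<theta> \<le> e * (nrm \<theta> + 1)" using e by simp
      also have "\<dots> = c / 4"
      proof -
        have "nrm \<theta> + 1 \<noteq> 0" using n\<theta> by linarith
        from nonzero_divide_eq_eq[THEN iffD1, OF this e_def[symmetric]] show ?thesis by (rule sym)
      qed
      finally show ?thesis using w(2) by linarith
    qed
    have "dominated s w"
      by (rule dominated_span[OF dominated_coefs w(1)]) (use fg s in auto)
    then obtain S where S: "finite S" "S \<subseteq> cfun TX"
      "\<And>F. F \<in> cfun TX \<Longrightarrow> \<exists>C\<ge>0. \<forall>y\<in>topspace TX. norm (conv w F y - conv w F (act s y)) \<le> C * dev s S y"
      unfolding dominated_def by auto
    have peak: "\<exists>F\<in>cfun TX. (\<forall>x. norm (F x) \<le> 1) \<and> c / 2 \<le> norm (conv w F y - conv w F (act s y))"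
      if y: "y \<in> topspace TX" "y \<notin> ?N" for y
    proof -
      have sy: "act s y \<in> topspace TX" using y s by simp
      define A where "A z = (\<lambda>r. act (inv r) z) ` C" for z
      have cA: "closedin TX (A z)" if "z \<in> topspace TX" for z
        unfolding A_def
        by (intro compactin_imp_closedin[OF hausdorff_TX] image_compactin[OF C(1)] act_cont' continuous_inv)
           (use that in simp)
      \<comment> \<open>A common point of the two smeared sets would put some
        \<open>a \<otimes> inv b \<otimes> s\<close> with \<open>a\<close>, \<open>b\<close> in
        \<open>C\<close> into the stabilizer of \<open>y\<close>; by the choice of \<open>C\<close>
        it lies in \<open>U\<close>, contrary to \<open>y \<notin> ?N\<close>.\<close>
      have dj: "disjnt (A (act s y)) (A y)"
      proof (rule ccontr)
        assume "\<not> disjnt (A (act s y)) (A y)"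
        then obtain z where z: "z \<in> A (act s y)" "z \<in> A y" unfolding disjnt_def by blast
        obtain b where b: "b \<in> C" "z = act (inv b) (act s y)" using z(1) unfolding A_def by blast
        obtain a where a: "a \<in> C" "z = act (inv a) y" using z(2) unfolding A_def by blast
        have ab: "a \<in> C" "b \<in> C" "act (inv a) y = act (inv b) (act s y)" using a b by simp_all
        have abG: "a \<in> carrier G" "b \<in> carrier G" using ab CG by auto
        have "act (a \<otimes> inv b \<otimes> s) y = act a (act (inv b) (act s y))"
          using abG s y by (simp add: act_mult)
        also have "\<dots> = y" using abG y by (simp flip: ab(3))
        finally have "a \<otimes> inv b \<otimes> s \<in> stabilizer G act y" using abG s by (simp add: stabilizer_def)
        then show False using y C(3)[OF ab(1,2)] by blast
      qed
      obtain F where F: "F \<in> cfun TX" "\<And>x. \<exists>r. 0 \<le> r \<and> r \<le> 1 \<and> F x = complex_of_real r"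
        "\<And>x. x \<in> A (act s y) \<Longrightarrow> F x = 0" "\<And>x. x \<in> A y \<Longrightarrow> F x = 1"
        by (rule cfun_urysohn[OF compact_TX hausdorff_TX cA[OF sy] cA[OF y(1)] dj]) blast
      have F1: "norm (F x) \<le> 1" for x using F(2)[of x] by auto
      have k1: "conv \<kappa> F y = haar \<kappa>"
      proof -
        have "(\<lambda>r. \<kappa> r * F (act (inv r) y)) = \<kappa>"
        proof
          fix r show "\<kappa> r * F (act (inv r) y) = \<kappa> r"
            using C(2)[of r] F(4)[of "act (inv r) y"] by (cases "r \<in> C") (auto simp: \<kappa>_def A_def)
        qed
        then show ?thesis using y(1) by (simp only: conv_def if_True)
      qed
      have k2: "conv \<kappa> F (act s y) = 0"
      proof -
        have "(\<lambda>r. \<kappa> r * F (act (inv r) (act s y))) = (\<lambda>r. 0)"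
        proof
          fix r show "\<kappa> r * F (act (inv r) (act s y)) = 0"
            using C(2)[of r] F(3)[of "act (inv r) (act s y)"] by (cases "r \<in> C") (auto simp: \<kappa>_def A_def)
        qed
        then show ?thesis using sy by (simp only: conv_def if_True haar_const)
      qed
      have close: "norm (conv \<kappa> F z - conv w F z) \<le> c / 4" if z: "z \<in> topspace TX" for z
      proof -
        have km: "\<kappa> - w \<in> cfun T" by (rule cfun_diff[OF \<kappa>m wm])
        have "conv \<kappa> F z - conv w F z = conv (\<kappa> - w) F z"
          using conv_add_left[OF cfunT[OF km] cfunT[OF wm] F(1)] by simp
        then show ?thesis using norm_conv_le_nrm_X[OF km F(1) F1 z] wk by simp
      qed
      have "c = norm ((conv \<kappa> F y - conv w F y) - (conv \<kappa> F (act s y) - conv w F (act s y)) + (conv w F y - conv w F (act s y)))"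
        by (simp add: k1 k2 c_def)
      also have "\<dots> \<le> c / 4 + c / 4 + norm (conv w F y - conv w F (act s y))"
        by (rule order_trans[OF norm_triangle_ineq add_mono[OF order_trans[OF norm_triangle_ineq4 add_mono[OF close close]]]])
           (use y sy in auto)
      finally show ?thesis using F(1) F1 by (intro bexI[of _ F]) auto
    qed
    \<comment> \<open>Because \<open>s\<close> fixes \<open>x\<close>, the weight vanishes at
      \<open>x\<close>; by continuity, bad points are found where it is as small as desired.\<close>
    have D0: "dev s S x = 0" by (simp add: dev_def s)
    have cD: "continuous_map TX euclideanreal (dev s S)"
      unfolding dev_def[abs_def]
      by (intro continuous_map_sum continuous_map_norm continuous_map_diff cfun_act_cont)
         (use S s topspace_eq in \<open>auto intro: cfun_cont\<close>)
    show False
    proof (rule gliding_hump[where Y = "topspace TX" and TX = TX and D = "dev s S" and \<delta> = "c / 2"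
        and \<Delta> = "\<lambda>y F. conv w F y - conv w F (act s y)" and K = "2 * Re (haar (\<lambda>r. of_real (norm (w r)))) + 1"])
      show "conv w (F + H) y - conv w (F + H) (act s y) =
          conv w F y - conv w F (act s y) + (conv w H y - conv w H (act s y))"
        if "F \<in> cfun TX" "H \<in> cfun TX" for y F H
        using conv_add_right[OF cfunT[OF wm] that] by simp
      show "conv w (fscale k F) y - conv w (fscale k F) (act s y) = k * (conv w F y - conv w F (act s y))"
        if "F \<in> cfun TX" for y k F
        using conv_fscale_right[OF cfunT[OF wm] that] by (simp add: fscale_def right_diff_distrib)
      have I0: "0 \<le> Re (haar (\<lambda>r. of_real (norm (w r))))"
      proof -
        have "norm (haar w) \<le> Re (haar (\<lambda>r. of_real (norm (w r))))"
          by (intro haar_norm_le continuous_map_of_real continuous_map_norm cfunT wm) simp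
        then show ?thesis using norm_ge_zero order_trans by blast
      qed
      then show "0 < 2 * Re (haar (\<lambda>r. of_real (norm (w r)))) + 1" by simp
      show "norm (conv w F y - conv w F (act s y)) \<le> (2 * Re (haar (\<lambda>r. of_real (norm (w r)))) + 1) * M"
        if y: "y \<in> topspace TX" and F: "F \<in> cfun TX" and M: "\<And>x. norm (F x) \<le> M" for y F M
      proof -
        have "M \<ge> 0" using M[of y] norm_ge_zero order_trans by blast
        have "norm (conv w F y - conv w F (act s y)) \<le> norm (conv w F y) + norm (conv w F (act s y))"
          by (rule norm_triangle_ineq4)
        also have "\<dots> \<le> M * Re (haar (\<lambda>r. of_real (norm (w r)))) + M * Re (haar (\<lambda>r. of_real (norm (w r))))"
          using y s by (intro add_mono norm_conv_le cfunT wm F M) auto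
        also have "\<dots> \<le> (2 * Re (haar (\<lambda>r. of_real (norm (w r)))) + 1) * M"
          using \<open>M \<ge> 0\<close> by (simp add: algebra_simps)
        finally show ?thesis .
      qed
      show "\<exists>C. \<forall>y\<in>topspace TX. norm (conv w F y - conv w F (act s y)) \<le> C * dev s S y"
        if "F \<in> cfun TX" for F using S(3)[OF that] by blast
      show "dev s S y \<ge> 0" for y by (rule dev_nonneg)
      show "c / 2 > 0" using c by simp
      show "\<exists>y\<in>topspace TX. dev s S y < \<eta> \<and>
          (\<exists>F\<in>cfun TX. (\<forall>x. norm (F x) \<le> 1) \<and> c / 2 \<le> norm (conv w F y - conv w F (act s y)))"
        if \<eta>: "\<eta> > 0" for \<eta>
      proof -
        let ?W = "{y \<in> topspace TX. dev s S y \<in> {..<\<eta>}}"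
        have "openin TX ?W" by (rule openin_continuous_map_preimage[OF cD]) simp
        moreover have "x \<in> ?W" using x D0 \<eta> by simp
        ultimately have "\<not> ?W \<subseteq> ?N" using not unfolding neighborhood_of_def by blast
        then obtain y where "y \<in> topspace TX" "dev s S y < \<eta>" "y \<notin> ?N" by auto
        then show ?thesis using peak[of y] by blast
      qed
    qed
  qed
qed

end

section \<open>Continuity of stabilizers implies finite generation\<close>

lemma cfun_suminf:
  assumes f: "\<And>k. f k \<in> cfun TX" and bound: "\<And>k x. norm (f k x) \<le> M * r ^ k" and r: "0 \<le> r" "r < 1"
  shows "(\<lambda>x. \<Sum>k. f k x) \<in> cfun TX"
proof -
  have geo: "summable (\<lambda>k. M * r ^ (k + n))" for n
    using summable_mult[OF summable_ignore_initial_segment[OF summable_geometric[of r]]] r by simp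
  have summ: "summable (\<lambda>k. f k x)" for x
    by (rule summable_comparison_test'[OF geo[of 0], of 0]) (use bound in simp)
  have tail: "norm ((\<Sum>k. f k x) - (\<Sum>k<n. f k x)) \<le> M / (1 - r) * r ^ n" for n x
  proof -
    have "(\<Sum>k. f k x) - (\<Sum>k<n. f k x) = (\<Sum>k. f (k + n) x)"
      using suminf_minus_initial_segment[OF summ[of x], of n] by simp
    also have "norm \<dots> \<le> (\<Sum>k. M * r ^ (k + n))"
      by (rule norm_suminf_le[OF _ geo]) (rule bound)
    also have "\<dots> = M / (1 - r) * r ^ n"
    proof -
      have s: "summable (\<lambda>k. r ^ k)" using r by (intro summable_geometric) simp
      have "(\<Sum>k. M * r ^ (k + n)) = (\<Sum>k. r ^ k * (M * r ^ n))" by (simp add: power_add mult_ac)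
      also have "\<dots> = (\<Sum>k. r ^ k) * (M * r ^ n)" by (rule suminf_mult2[OF s, symmetric])
      also have "(\<Sum>k. r ^ k) = 1 / (1 - r)" using r by (intro suminf_geometric) simp
      finally show ?thesis by simp
    qed
    finally show ?thesis .
  qed
  have lim: "(\<lambda>n. M / (1 - r) * r ^ n) \<longlonglongrightarrow> 0"
    using tendsto_mult_right_zero[OF LIMSEQ_realpow_zero[of r]] r by simp
  have "continuous_map TX euclidean (\<lambda>x. \<Sum>k. f k x)"
  proof (rule continuous_map_uniform)
    fix e :: real assume "e > 0"
    then obtain n where n: "M / (1 - r) * r ^ n < e"
      using order_tendstoD(2)[OF lim, of e] by (auto simp: eventually_sequentially)
    have "continuous_map TX euclidean (\<lambda>x. \<Sum>k<n. f k x)"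
      using f by (intro continuous_map_sum) (auto simp: cfun_def)
    moreover have "\<forall>x\<in>topspace TX. norm ((\<Sum>k<n. f k x) - (\<Sum>k. f k x)) \<le> e"
    proof
      fix x
      show "norm ((\<Sum>k<n. f k x) - (\<Sum>k. f k x)) \<le> e"
        using tail[of x n] n by (subst norm_minus_commute) linarith
    qed
    ultimately show "\<exists>g. continuous_map TX euclidean g \<and> (\<forall>x\<in>topspace TX. norm (g x - (\<Sum>k. f k x)) \<le> e)"
      by blast
  qed
  then show ?thesis using f by (simp add: cfun_def)
qed

section \<open>An invariant inner product and the values of equivariant maps\<close>

locale compact_action_rep = compact_action G T TX act
  for G (structure) and T :: "'a topology" and TX :: "'x topology" and act :: "'a \<Rightarrow> 'x \<Rightarrow> 'x" +
  fixes d :: nat and \<alpha> :: "'a \<Rightarrow> complex mat"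
  assumes rep: "representation G T d \<alpha>"
begin

text \<open>The value of an element of \<open>mor\<close> at \<open>x\<close> is a vector; moving \<open>x\<close> by the inverse
  of \<open>s\<close> applies the transpose of \<open>\<alpha> s\<close> to it.\<close>

definition ract :: "'a \<Rightarrow> (nat \<Rightarrow> complex) \<Rightarrow> nat \<Rightarrow> complex" where
  "ract s v i = (if i < d then \<Sum>j<d. \<alpha> s $$ (j, i) * v j else 0)"

text \<open>The matrices \<open>\<alpha> s\<close> need not be unitary. Averaging the standard inner
  product along \<open>ract\<close> gives an invariant one, and this is its Gram matrix;
  \<open>B\<close> is the resulting form.\<close>

definition gram :: "nat \<Rightarrow> nat \<Rightarrow> complex" where
  "gram j k = haar (\<lambda>s. \<Sum>i<d. \<alpha> s $$ (j, i) * cnj (\<alpha> s $$ (k, i)))"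

definition B :: "(nat \<Rightarrow> complex) \<Rightarrow> (nat \<Rightarrow> complex) \<Rightarrow> complex" where
  "B v w = (\<Sum>j<d. \<Sum>k<d. gram j k * (v j * cnj (w k)))"

text \<open>Cut off at \<open>d\<close> because members of \<open>mor\<close> are arbitrary there,
  whereas vectors are compared as functions on all of \<open>nat\<close>.\<close>

definition eval_at :: "(nat \<Rightarrow> 'x \<Rightarrow> complex) \<Rightarrow> 'x \<Rightarrow> nat \<Rightarrow> complex" where
  "eval_at e x i = (if i < d then e i x else 0)"

lemma alpha_mult: "s \<in> carrier G \<Longrightarrow> t \<in> carrier G \<Longrightarrow> j < d \<Longrightarrow> i < d \<Longrightarrow>
    \<alpha> (s \<otimes> t) $$ (j, i) = (\<Sum>k<d. \<alpha> s $$ (j, k) * \<alpha> t $$ (k, i))"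
proof -
  assume s: "s \<in> carrier G" and t: "t \<in> carrier G" and ji: "j < d" "i < d"
  have c: "\<alpha> s \<in> carrier_mat d d" "\<alpha> t \<in> carrier_mat d d" and m: "\<alpha> (s \<otimes> t) = \<alpha> s * \<alpha> t"
    using rep s t by (auto simp: representation_def)
  show ?thesis using c ji unfolding m by (simp add: scalar_prod_def lessThan_atLeast0)
qed

lemma alpha_cont: "i < d \<Longrightarrow> j < d \<Longrightarrow> cfunG (\<lambda>s. \<alpha> s $$ (i, j))"
  using rep by (simp add: representation_def)

lemma ract_one: "(\<And>i. i \<ge> d \<Longrightarrow> v i = 0) \<Longrightarrow> ract \<one> v = v"
proof
  fix i assume v: "\<And>i. i \<ge> d \<Longrightarrow> v i = 0"
  have "\<alpha> \<one> = 1\<^sub>m d" using rep by (simp add: representation_def)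
  then have "(\<Sum>j<d. \<alpha> \<one> $$ (j, i) * v j) = (\<Sum>j<d. if j = i then v j else 0)" if "i < d"
    using that by (intro sum.cong) auto
  then show "ract \<one> v i = v i" using v[of i] by (auto simp: ract_def)
qed

lemma ract_mult:
  assumes "s \<in> carrier G" "t \<in> carrier G"
  shows "ract (s \<otimes> t) v = ract t (ract s v)"
proof
  fix i
  have "(\<Sum>j<d. \<alpha> (s \<otimes> t) $$ (j, i) * v j) = (\<Sum>k<d. \<alpha> t $$ (k, i) * ract s v k)" if i: "i < d"
  proof -
    have "(\<Sum>j<d. \<alpha> (s \<otimes> t) $$ (j, i) * v j) = (\<Sum>j<d. \<Sum>k<d. \<alpha> t $$ (k, i) * (\<alpha> s $$ (j, k) * v j))"
      using alpha_mult[OF assms _ i] by (intro sum.cong) (auto simp: sum_distrib_left mult_ac)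
    also have "\<dots> = (\<Sum>k<d. \<Sum>j<d. \<alpha> t $$ (k, i) * (\<alpha> s $$ (j, k) * v j))" by (rule sum.swap)
    also have "\<dots> = (\<Sum>k<d. \<alpha> t $$ (k, i) * ract s v k)"
      by (intro sum.cong) (auto simp: ract_def sum_distrib_left)
    finally show ?thesis .
  qed
  then show "ract (s \<otimes> t) v i = ract t (ract s v) i" by (simp add: ract_def)
qed

lemma ract_cont: "cfunG (\<lambda>s. ract s v i)"
proof (cases "i < d")
  case True
  have "cfunG (\<lambda>s. \<Sum>j<d. \<alpha> s $$ (j, i) * v j)"
    using alpha_cont True by (intro continuous_map_sum continuous_map_cmult continuous_map_canonical_const) auto
  then show ?thesis using True by (simp add: ract_def)
qed (simp add: ract_def)

lemma B_haar: "B v w = haar (\<lambda>s. \<Sum>i<d. ract s v i * cnj (ract s w i))"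
proof -
  have c: "cfunG (\<lambda>s. \<Sum>i<d. \<alpha> s $$ (j, i) * cnj (\<alpha> s $$ (k, i)))" if "j < d" "k < d" for j k
    using alpha_cont that by (intro continuous_map_sum continuous_map_cmult continuous_map_cnj) auto
  have cc: "cfunG (\<lambda>s. (\<Sum>i<d. \<alpha> s $$ (j, i) * cnj (\<alpha> s $$ (k, i))) * (v j * cnj (w k)))"
    if "j < d" "k < d" for j k
    by (rule continuous_map_cmult[OF c[OF that] continuous_map_canonical_const])
  have e: "(\<Sum>i<d. ract s v i * cnj (ract s w i)) =
     (\<Sum>j<d. \<Sum>k<d. (\<Sum>i<d. \<alpha> s $$ (j, i) * cnj (\<alpha> s $$ (k, i))) * (v j * cnj (w k)))" for s
  proof -
    have "(\<Sum>i<d. ract s v i * cnj (ract s w i)) =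
       (\<Sum>i<d. \<Sum>j<d. \<Sum>k<d. \<alpha> s $$ (j, i) * cnj (\<alpha> s $$ (k, i)) * (v j * cnj (w k)))"
      by (intro sum.cong) (auto simp: ract_def sum_product mult_ac)
    also have "\<dots> = (\<Sum>j<d. \<Sum>i<d. \<Sum>k<d. \<alpha> s $$ (j, i) * cnj (\<alpha> s $$ (k, i)) * (v j * cnj (w k)))"
      by (rule sum.swap)
    also have "\<dots> = (\<Sum>j<d. \<Sum>k<d. \<Sum>i<d. \<alpha> s $$ (j, i) * cnj (\<alpha> s $$ (k, i)) * (v j * cnj (w k)))"
      by (intro sum.cong refl sum.swap)
    finally show ?thesis by (simp add: sum_distrib_right)
  qed
  have "haar (\<lambda>s. \<Sum>i<d. ract s v i * cnj (ract s w i)) =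
    (\<Sum>j<d. haar (\<lambda>s. \<Sum>k<d. (\<Sum>i<d. \<alpha> s $$ (j, i) * cnj (\<alpha> s $$ (k, i))) * (v j * cnj (w k))))"
    unfolding e by (rule haar_sum) (use cc in \<open>auto intro!: continuous_map_sum\<close>)
  also have "\<dots> = (\<Sum>j<d. \<Sum>k<d. haar (\<lambda>s. (\<Sum>i<d. \<alpha> s $$ (j, i) * cnj (\<alpha> s $$ (k, i))) * (v j * cnj (w k))))"
    by (rule sum.cong[OF refl], rule haar_sum) (use cc in auto)
  also have "\<dots> = B v w"
    unfolding B_def gram_def using c by (intro sum.cong refl haar_mult_right) auto
  finally show ?thesis by simp
qed

lemma B_cont: "cfunG (\<lambda>s. \<Sum>i<d. ract s v i * cnj (ract s w i))"
  by (intro continuous_map_sum continuous_map_cmult continuous_map_cnj ract_cont) auto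

lemma B_ract: "t \<in> carrier G \<Longrightarrow> B (ract t v) (ract t w) = B v w"
proof -
  assume t: "t \<in> carrier G"
  have "B (ract t v) (ract t w) = haar (\<lambda>s. \<Sum>i<d. ract (t \<otimes> s) v i * cnj (ract (t \<otimes> s) w i))"
    unfolding B_haar using t by (intro haar_cong) (simp add: ract_mult)
  also have "\<dots> = B v w" unfolding B_haar by (rule haar_left[OF B_cont t])
  finally show ?thesis .
qed

lemma B_sym: "B w v = cnj (B v w)"
proof -
  have "cnj (B v w) = haar (\<lambda>s. cnj (\<Sum>i<d. ract s v i * cnj (ract s w i)))"
    unfolding B_haar by (rule haar_cnj[OF B_cont, symmetric])
  also have "\<dots> = B w v" unfolding B_haar by (simp add: mult.commute)
  finally show ?thesis by simp
qed

lemma B_sum_left: "B (\<lambda>i. \<Sum>k\<in>I. c k * f k i) w = (\<Sum>k\<in>I. c k * B (f k) w)"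
proof -
  have "B (\<lambda>i. \<Sum>k\<in>I. c k * f k i) w = (\<Sum>j<d. \<Sum>l<d. \<Sum>k\<in>I. c k * (gram j l * (f k j * cnj (w l))))"
    unfolding B_def by (simp add: sum_distrib_left sum_distrib_right mult_ac)
  also have "\<dots> = (\<Sum>j<d. \<Sum>k\<in>I. \<Sum>l<d. c k * (gram j l * (f k j * cnj (w l))))"
    by (intro sum.cong refl sum.swap)
  also have "\<dots> = (\<Sum>k\<in>I. \<Sum>j<d. \<Sum>l<d. c k * (gram j l * (f k j * cnj (w l))))"
    by (rule sum.swap)
  finally show ?thesis by (simp add: B_def sum_distrib_left)
qed

lemma B_scale_left: "B (\<lambda>i. c * v i) w = c * B v w"
  using B_sum_left[of "\<lambda>_. c" "\<lambda>_. v" "{()}" w] by simp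

lemma B_scale_right: "B v (\<lambda>i. c * w i) = cnj c * B v w"
  unfolding B_sym[of v] B_scale_left by simp

lemma B_diff_left: "B (\<lambda>i. v i - u i) w = B v w - B u w"
  by (simp add: B_def left_diff_distrib right_diff_distrib sum_subtractf)

lemma B_diff_right: "B w (\<lambda>i. v i - u i) = B w v - B w u"
  by (simp add: B_def left_diff_distrib right_diff_distrib sum_subtractf)

lemma B_pos:
  assumes "i < d" "v i \<noteq> 0"
  shows "Re (B v v) > 0"
proof -
  have sq: "(\<Sum>i<d. ract s v i * cnj (ract s v i)) = of_real (\<Sum>i<d. (norm (ract s v i))\<^sup>2)" for s
    by (simp only: of_real_sum complex_norm_square)
  show ?thesis
    unfolding B_haar
  proof (rule haar_pos[OF B_cont])
    show "0 \<le> Re (\<Sum>i<d. ract t v i * cnj (ract t v i))" for t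
      unfolding sq Re_complex_of_real by (intro sum_nonneg) auto
    have "ract \<one> v i = ract \<one> (\<lambda>i. if i < d then v i else 0) i" by (simp add: ract_def)
    also have "\<dots> = v i" using ract_one[of "\<lambda>i. if i < d then v i else 0"] assms(1) by simp
    finally have "ract \<one> v i \<noteq> 0" using assms(2) by simp
    then have "0 < (norm (ract \<one> v i))\<^sup>2" by simp
    also have "\<dots> \<le> (\<Sum>i<d. (norm (ract \<one> v i))\<^sup>2)"
      by (rule member_le_sum) (use assms in auto)
    finally show "Re (\<Sum>i<d. ract \<one> v i * cnj (ract \<one> v i)) > 0"
      unfolding sq Re_complex_of_real .
  qed simp
qed

lemma mor_at_act:
  assumes "e \<in> mor d \<alpha>" "s \<in> carrier G" "x \<in> topspace TX"
  shows "eval_at e (act (inv s) x) = ract s (eval_at e x)"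
proof
  fix i
  show "eval_at e (act (inv s) x) i = ract s (eval_at e x) i"
  proof (cases "i < d")
    case True
    have "e i (act (inv s) x) = trans s (e i) x" using assms by (simp add: trans_apply)
    also have "\<dots> = (\<Sum>j<d. \<alpha> s $$ (j, i) * e j x)"
      unfolding mor_trans[OF assms(1,2) True]
      by (induction d) (auto simp: fscale_def)
    finally show ?thesis using True by (simp add: eval_at_def ract_def)
  qed (simp add: eval_at_def ract_def)
qed

lemma morI:
  assumes "\<And>i. i < d \<Longrightarrow> e i \<in> cfun TX"
    and "\<And>s x i. s \<in> carrier G \<Longrightarrow> x \<in> topspace TX \<Longrightarrow> i < d \<Longrightarrow> e i (act (inv s) x) = (\<Sum>j<d. \<alpha> s $$ (j, i) * e j x)"
  shows "e \<in> mor d \<alpha>"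
  unfolding mor_def
proof (intro CollectI conjI allI impI ballI)
  fix s i assume s: "s \<in> carrier G" and i: "i < d"
  have a: "(\<Sum>j<n. fscale (\<alpha> s $$ (j, i)) (e j)) x = (\<Sum>j<n. \<alpha> s $$ (j, i) * e j x)" for n x
    by (induction n) (auto simp: fscale_def)
  show "trans s (e i) = (\<Sum>j<d. fscale (\<alpha> s $$ (j, i)) (e j))"
  proof
    fix x
    show "trans s (e i) x = (\<Sum>j<d. fscale (\<alpha> s $$ (j, i)) (e j)) x"
    proof (cases "x \<in> topspace TX")
      case True
      then show ?thesis unfolding a using assms(2)[OF s _ i] by (simp add: translate_def)
    next
      case False
      have "(\<Sum>j<d. \<alpha> s $$ (j, i) * e j x) = 0"
        using cfun_zero[OF assms(1) False] by (intro sum.neutral ballI) simp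
      then show ?thesis unfolding a using False by (simp add: translate_def)
    qed
  qed
qed (use assms in auto)

lemma mor_value: "e \<in> mor d \<alpha> \<Longrightarrow> s \<in> carrier G \<Longrightarrow> x \<in> topspace TX \<Longrightarrow> i < d \<Longrightarrow>
    e i (act (inv s) x) = (\<Sum>j<d. \<alpha> s $$ (j, i) * e j x)"
  using fun_cong[OF mor_at_act[of e s x], of i] by (simp add: eval_at_def ract_def)

lemma invariant_cfunI:
  assumes "a \<in> cfun TX" "\<And>s x. s \<in> carrier G \<Longrightarrow> x \<in> topspace TX \<Longrightarrow> a (act (inv s) x) = a x"
  shows "a \<in> invariant_cfun G TX act"
  using assms cfun_zero by (auto simp: invariant_cfun_def translate_def fun_eq_iff)

lemma subspace_invariant_cfun: "fun_space.subspace (invariant_cfun G TX act)"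
  using fun_space.subspace_0[OF subspace_cfun] fun_space.subspace_add[OF subspace_cfun]
    fun_space.subspace_scale[OF subspace_cfun]
  unfolding fun_space.subspace_def invariant_cfun_def
  by (simp add: trans_0 trans_add trans_fscale)

lemma mor_invariant_mult:
  assumes a: "a \<in> invariant_cfun G TX act" and e: "e \<in> mor d \<alpha>"
  shows "(\<lambda>i. a * e i) \<in> mor d \<alpha>"
proof (rule morI)
  show "a * e i \<in> cfun TX" if "i < d" for i
    using a mor_cfun[OF e that]
    by (auto simp: invariant_cfun_def cfun_def times_fun_def intro!: continuous_map_cmult)
  fix s x i assume s: "s \<in> carrier G" and x: "x \<in> topspace TX" and i: "i < d"
  have "a (act (inv s) x) = a x" using invariant_cfun_act[OF a _ x, of "inv s"] s by simp
  then show "(a * e i) (act (inv s) x) = (\<Sum>j<d. \<alpha> s $$ (j, i) * (a * e j) x)"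
    using mor_value[OF e s x i] by (simp add: sum_distrib_left mult_ac)
qed

text \<open>The source of invariant coefficients: moving the point applies \<open>ract\<close> to
  both values, and \<open>B\<close> does not notice.\<close>

lemma B_at_invariant:
  assumes e: "e \<in> mor d \<alpha>" and f: "f \<in> mor d \<alpha>"
  shows "(\<lambda>x. B (eval_at e x) (eval_at f x)) \<in> invariant_cfun G TX act"
proof (rule invariant_cfunI)
  have "continuous_map TX euclidean (\<lambda>x. eval_at e x i)" if "e \<in> mor d \<alpha>" for e i
    using mor_cfun[OF that] by (cases "i < d") (auto simp: eval_at_def intro: cfun_cont)
  then have "continuous_map TX euclidean (\<lambda>x. B (eval_at e x) (eval_at f x))"
    unfolding B_def using e f
    by (intro continuous_map_sum continuous_map_cmult continuous_map_cnj continuous_map_canonical_const) auto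
  moreover have "B (eval_at e x) (eval_at f x) = 0" if "x \<notin> topspace TX" for x
    unfolding B_def using mor_cfun[OF e] cfun_zero[OF _ that] by (intro sum.neutral ballI) (auto simp: eval_at_def)
  ultimately show "(\<lambda>x. B (eval_at e x) (eval_at f x)) \<in> cfun TX" by (simp add: cfun_def)
  fix s x assume "s \<in> carrier G" "x \<in> topspace TX"
  then show "B (eval_at e (act (inv s) x)) (eval_at f (act (inv s) x)) = B (eval_at e x) (eval_at f x)"
    using mor_at_act[OF e] mor_at_act[OF f] by (simp add: B_ract)
qed

definition fixed :: "'x \<Rightarrow> (nat \<Rightarrow> complex) \<Rightarrow> bool" where
  "fixed x v \<longleftrightarrow> (\<forall>k\<in>stabilizer G act x. ract k v = v)"

lemma mor_at_fixed:
  assumes e: "e \<in> mor d \<alpha>" and x: "x \<in> topspace TX"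
  shows "fixed x (eval_at e x)"
  unfolding fixed_def
proof
  fix k assume "k \<in> stabilizer G act x"
  then have k: "k \<in> carrier G" "act k x = x" by (auto simp: stabilizer_def)
  have "act (inv k) x = x" using act_inv_cancel(1)[OF k(1) x] k(2) by simp
  then show "ract k (eval_at e x) = eval_at e x" using mor_at_act[OF e k(1) x] by simp
qed

text \<open>Averaging a bump function around \<open>x\<close> against the orbit of a vector fixed by the stabilizer.\<close>

lemma mor_through_fixed_vector:
  assumes x: "x \<in> topspace TX" and v: "\<And>i. i \<ge> d \<Longrightarrow> v i = 0" "i < d" "v i \<noteq> 0" and fx: "fixed x v"
  obtains e where "e \<in> mor d \<alpha>" "B v (eval_at e x) \<noteq> 0"
proof -
  define c where "c = Re (B v v)"
  have c: "c > 0" unfolding c_def by (rule B_pos[of i v, OF v(2,3)])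
  define b where "b t = B (ract t v) v" for t
  have bc: "cfunG b"
    unfolding b_def B_def
    by (intro continuous_map_sum continuous_map_cmult ract_cont continuous_map_canonical_const) auto
  \<comment> \<open>Outside \<open>D\<close> the moved vector still has inner product with
    \<open>v\<close> of real part above \<open>c / 2\<close>. Letting \<open>F\<close> vanish on the
    \<open>D\<close>-part of the orbit makes the averaged integrand nonnegative in real part;
    \<open>x\<close> itself is not in that part because \<open>v\<close> is fixed by the
    stabilizer.\<close>
  define D where "D = {t \<in> topspace T. Re (b t) \<in> {..c / 2}}"
  have "closedin T D"
    unfolding D_def by (rule closedin_continuous_map_preimage[OF continuous_map_Re[OF bc]]) simp
  then have "compactin T D" by (rule closedin_compact_space[OF compact_T])
  then have "compactin TX ((\<lambda>t. act t x) ` D)"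
    by (rule image_compactin) (use x in \<open>auto intro!: act_cont'\<close>)
  then have cl: "closedin TX ((\<lambda>t. act t x) ` D)" by (rule compactin_imp_closedin[OF hausdorff_TX])
  have clx: "closedin TX {x}" by (rule closedin_Hausdorff_singleton[OF hausdorff_TX x])
  have "x \<notin> (\<lambda>t. act t x) ` D"
  proof
    assume "x \<in> (\<lambda>t. act t x) ` D"
    then obtain t where t: "t \<in> D" "act t x = x" by force
    then have "t \<in> stabilizer G act x" by (simp add: D_def stabilizer_def topspace_eq)
    then have "b t = B v v" using fx by (simp add: fixed_def b_def)
    then show False using t(1) c by (simp add: D_def c_def)
  qed
  then have dj: "disjnt ((\<lambda>t. act t x) ` D) {x}" by (auto simp: disjnt_def)
  obtain F where F: "F \<in> cfun TX" "\<And>y. \<exists>r. 0 \<le> r \<and> r \<le> 1 \<and> F y = complex_of_real r"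
    "\<And>y. y \<in> (\<lambda>t. act t x) ` D \<Longrightarrow> F y = 0" "\<And>y. y \<in> {x} \<Longrightarrow> F y = 1"
    by (rule cfun_urysohn[OF compact_TX hausdorff_TX cl clx dj]) blast
  define e where "e i y = (if y \<in> topspace TX then haar (\<lambda>t. F (act t y) * ract t v i) else 0)" for i y
  have cont: "continuous_map (prod_topology TX T) euclidean (\<lambda>(y, t). F (act t y) * ract t v i)" for i
    unfolding split_beta
    by (intro continuous_map_cmult cfun_act_cont[OF F(1)] continuous_map_snd continuous_map_fst
        continuous_map_compose[OF continuous_map_snd ract_cont, unfolded o_def])
  have cs: "cfunG (\<lambda>t. F (act t y) * ract t v i)" if "y \<in> topspace TX" for y i
    using cfunG_slice[OF cont that] .
  have em: "e \<in> mor d \<alpha>"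
  proof (rule morI)
    show "e i \<in> cfun TX" if "i < d" for i
    proof -
      have "continuous_map TX euclidean (e i)"
        by (rule continuous_map_eq[OF haar_continuous[OF compact_TX cont[of i]]]) (simp add: e_def)
      then show ?thesis by (simp add: cfun_def e_def)
    qed
    fix s y i assume s: "s \<in> carrier G" and y: "y \<in> topspace TX" and i: "i < d"
    have sy: "act (inv s) y \<in> topspace TX" using s y by simp
    have "e i (act (inv s) y) = haar (\<lambda>t. F (act t (act (inv s) y)) * ract t v i)"
      using sy by (simp add: e_def)
    \<comment> \<open>Right translation of the integration variable cancels \<open>inv s\<close>
      inside \<open>F\<close> and moves \<open>s\<close> into \<open>ract\<close>.\<close>
    also have "\<dots> = haar (\<lambda>t. F (act (t \<otimes> s) (act (inv s) y)) * ract (t \<otimes> s) v i)"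
      by (rule haar_right[OF cs[OF sy] s, symmetric])
    also have "\<dots> = haar (\<lambda>t. \<Sum>j<d. \<alpha> s $$ (j, i) * (F (act t y) * ract t v j))"
    proof (rule haar_cong)
      fix t assume t: "t \<in> carrier G"
      have "ract (t \<otimes> s) v i = (\<Sum>j<d. \<alpha> s $$ (j, i) * ract t v j)"
        unfolding ract_mult[OF t s] by (subst ract_def) (use i in simp)
      then show "F (act (t \<otimes> s) (act (inv s) y)) * ract (t \<otimes> s) v i = (\<Sum>j<d. \<alpha> s $$ (j, i) * (F (act t y) * ract t v j))"
        using t s y by (simp add: act_mult sum_distrib_left mult_ac)
    qed
    also have "\<dots> = (\<Sum>j<d. haar (\<lambda>t. \<alpha> s $$ (j, i) * (F (act t y) * ract t v j)))"
      by (intro haar_sum continuous_map_cmult[OF continuous_map_canonical_const] cs y) auto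
    also have "\<dots> = (\<Sum>j<d. \<alpha> s $$ (j, i) * e j y)"
      using y by (intro sum.cong refl) (simp add: e_def haar_cmult[OF cs])
    finally show "e i (act (inv s) y) = (\<Sum>j<d. \<alpha> s $$ (j, i) * e j y)" .
  qed
  have "B (eval_at e x) v = haar (\<lambda>t. F (act t x) * b t)"
  proof -
    have "B (eval_at e x) v = (\<Sum>j<d. \<Sum>k<d. gram j k * (e j x * cnj (v k)))"
      unfolding B_def by (intro sum.cong refl) (simp add: eval_at_def)
    also have "\<dots> = (\<Sum>j<d. \<Sum>k<d. haar (\<lambda>t. gram j k * cnj (v k) * (F (act t x) * ract t v j)))"
      unfolding haar_cmult[OF cs[OF x]] using x by (intro sum.cong refl) (simp add: e_def mult_ac)
    also have "\<dots> = haar (\<lambda>t. \<Sum>j<d. \<Sum>k<d. gram j k * cnj (v k) * (F (act t x) * ract t v j))"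
      using cs[OF x] by (simp add: haar_sum continuous_map_sum continuous_map_cmult)
    also have "(\<lambda>t. \<Sum>j<d. \<Sum>k<d. gram j k * cnj (v k) * (F (act t x) * ract t v j)) = (\<lambda>t. F (act t x) * b t)"
      by (simp add: b_def B_def sum_distrib_left mult_ac fun_eq_iff)
    finally show ?thesis .
  qed
  moreover have "Re (haar (\<lambda>t. F (act t x) * b t)) > 0"
  proof (rule haar_pos)
    show "cfunG (\<lambda>t. F (act t x) * b t)"
      by (intro continuous_map_cmult bc cfun_act_cont[OF F(1)]) (use x in auto)
    show "0 \<le> Re (F (act t x) * b t)" if t: "t \<in> carrier G" for t
    proof (cases "t \<in> D")
      case True
      then show ?thesis using F(3)[of "act t x"] by simp
    next
      case False
      then have "Re (b t) > c / 2" using t by (simp add: D_def topspace_eq)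
      moreover obtain r where "0 \<le> r" "F (act t x) = complex_of_real r" using F(2) by blast
      ultimately show ?thesis using c by simp
    qed
    show "Re (F (act \<one> x) * b \<one>) > 0"
      using x F(4)[of x] c ract_one[OF v(1)] by (simp add: b_def c_def)
  qed simp
  ultimately have "B (eval_at e x) v \<noteq> 0" by auto
  then have "B v (eval_at e x) \<noteq> 0" using B_sym[of v "eval_at e x"] by simp
  then show ?thesis using em that by blast
qed

section \<open>Compactness of the unit vectors fixed by stabilizers\<close>

definition sphere_d :: "(nat \<Rightarrow> complex) set" where
  "sphere_d = {v. (\<forall>i\<ge>d. v i = 0) \<and> (\<Sum>i<d. (norm (v i))\<^sup>2) = 1}"

lemma coord_cont: "continuous_map (euclidean :: (nat \<Rightarrow> complex) topology) euclidean (\<lambda>v. v i)"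
  by simp

text \<open>The ambient space consists of all sequences; pinning the coordinates from
  \<open>d\<close> on to zero places the sphere in a product of compact sets.\<close>

lemma compact_sphere: "compactin euclidean sphere_d"
proof -
  define S where "S i = (if i < d then cball 0 1 else {0 :: complex})" for i :: nat
  have "compactin (product_topology (\<lambda>_. euclidean) UNIV) (PiE UNIV S)"
    unfolding compactin_PiE by (auto simp: S_def)
  then have cS: "compactin euclidean (PiE UNIV S)" by (simp add: euclidean_product_topology)
  let ?C = "{v \<in> topspace (euclidean :: (nat \<Rightarrow> complex) topology). (\<Sum>i<d. (norm (v i))\<^sup>2) \<in> {1}}"
  have "continuous_map (euclidean :: (nat \<Rightarrow> complex) topology) euclideanreal (\<lambda>v. \<Sum>i<d. (norm (v i))\<^sup>2)"
    by (intro continuous_map_sum continuous_map_real_pow continuous_map_norm coord_cont) simp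
  then have "closedin euclidean ?C"
    by (rule closedin_continuous_map_preimage) simp
  then have "compactin euclidean (PiE UNIV S \<inter> ?C)" using cS compact_Int_closedin by blast
  moreover have "sphere_d = PiE UNIV S \<inter> ?C"
  proof (intro equalityI subsetI)
    fix v assume v: "v \<in> sphere_d"
    have "norm (v i) \<le> 1" if "i < d" for i
    proof -
      have "(norm (v i))\<^sup>2 \<le> (\<Sum>i<d. (norm (v i))\<^sup>2)" by (rule member_le_sum) (use that in auto)
      then have "(norm (v i))\<^sup>2 \<le> 1\<^sup>2" using v by (simp add: sphere_d_def)
      then show ?thesis by (rule power2_le_imp_le) simp
    qed
    then show "v \<in> PiE UNIV S \<inter> ?C" using v by (auto simp: sphere_d_def S_def)
  qed (auto simp: sphere_d_def S_def PiE_def Pi_def not_less[symmetric] split: if_splits)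
  ultimately show ?thesis by simp
qed

lemma scale_to_sphere:
  assumes v: "\<And>i. i \<ge> d \<Longrightarrow> v i = 0" and "v \<noteq> (\<lambda>_. 0)"
  obtains r u where "r > 0" "u \<in> sphere_d" "v = (\<lambda>i. of_real r * u i)"
proof -
  define q where "q = (\<Sum>i<d. (norm (v i))\<^sup>2)"
  obtain i where i: "v i \<noteq> 0" using assms(2) by auto
  then have id: "i < d" using v not_less by blast
  have "0 < (norm (v i))\<^sup>2" using i by simp
  also have "\<dots> \<le> q" unfolding q_def by (rule member_le_sum) (use id in auto)
  finally have q: "q > 0" .
  define u where "u i = v i / of_real (sqrt q)" for i
  have "(\<Sum>i<d. (norm (u i))\<^sup>2) = (\<Sum>i<d. (norm (v i))\<^sup>2 / q)"
    using q by (intro sum.cong refl) (simp add: u_def norm_divide power_divide)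
  also have "\<dots> = q / q" unfolding sum_divide_distrib[symmetric] q_def[symmetric] ..
  finally have "u \<in> sphere_d" using v q by (simp add: sphere_d_def u_def)
  moreover have "v = (\<lambda>i. of_real (sqrt q) * u i)" using q by (simp add: u_def)
  ultimately show ?thesis using that[of "sqrt q" u] q by simp
qed

definition fixed_vectors :: "('x \<times> (nat \<Rightarrow> complex)) set" where
  "fixed_vectors = {(x, v). x \<in> topspace TX \<and> v \<in> sphere_d \<and> fixed x v}"

text \<open>If some \<open>k\<close> in the stabilizer of \<open>x\<close> moves \<open>v\<close>,
  then all pairs near \<open>(k, v)\<close> still move. Lower semicontinuity supplies, at every
  \<open>x'\<close> near \<open>x\<close>, a stabilizer element near \<open>k\<close>, so being
  fixed is a closed condition on pairs.\<close>

lemma compact_fixed_vectors: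
  assumes lsc: "lower_semicontinuous_map TX T (\<lambda>x. stabilizer G act x)"
  shows "compactin (prod_topology TX euclidean) fixed_vectors"
proof -
  let ?P = "prod_topology TX (euclidean :: (nat \<Rightarrow> complex) topology)"
  let ?C = "{z \<in> topspace ?P. fixed (fst z) (snd z)}"
  have "openin ?P (topspace ?P - ?C)"
  proof (subst openin_subopen, intro ballI)
    fix z assume z: "z \<in> topspace ?P - ?C"
    obtain x v where zxv: "z = (x, v)" by (cases z)
    have x: "x \<in> topspace TX" using z zxv by simp
    obtain k where k: "k \<in> stabilizer G act x" "ract k v \<noteq> v" using z zxv x by (auto simp: fixed_def)
    then obtain i where i: "ract k v i \<noteq> v i" by (auto simp: fun_eq_iff)
    have kG: "k \<in> carrier G" using k by (simp add: stabilizer_def)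
    let ?Q = "prod_topology T (euclidean :: (nat \<Rightarrow> complex) topology)"
    have cv: "continuous_map ?Q euclidean (\<lambda>w. snd w j)" for j
      by (rule continuous_map_compose[OF continuous_map_snd coord_cont, unfolded o_def])
    have "continuous_map ?Q euclidean (\<lambda>w. ract (fst w) (snd w) i)"
    proof (cases "i < d")
      case True
      have "continuous_map ?Q euclidean (\<lambda>w. \<Sum>j<d. \<alpha> (fst w) $$ (j, i) * snd w j)"
        by (intro continuous_map_sum continuous_map_cmult cv
            continuous_map_compose[OF continuous_map_fst alpha_cont, unfolded o_def]) (use True in auto)
      then show ?thesis using True by (simp add: ract_def)
    qed (simp add: ract_def)
    then have "continuous_map ?Q euclidean (\<lambda>w. ract (fst w) (snd w) i - snd w i)"
      using cv by (intro continuous_map_diff)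
    then have op: "openin ?Q {w \<in> topspace ?Q. ract (fst w) (snd w) i - snd w i \<in> - {0}}"
      by (rule openin_continuous_map_preimage) auto
    have mem: "(k, v) \<in> {w \<in> topspace ?Q. ract (fst w) (snd w) i - snd w i \<in> - {0}}"
      using kG i by (simp add: topspace_eq)
    obtain U V where UV: "openin T U" "openin euclidean V" "k \<in> U" "v \<in> V"
      "U \<times> V \<subseteq> {w \<in> topspace ?Q. ract (fst w) (snd w) i - snd w i \<in> - {0}}"
      using openin_prod_topology_alt[THEN iffD1, OF op, rule_format, OF mem] by (elim exE conjE)
    have "neighborhood_of TX {x} {x' \<in> topspace TX. stabilizer G act x' \<inter> U \<noteq> {}}"
      using lsc x UV(1,3) k(1) unfolding lower_semicontinuous_map_def by blast
    then obtain W where W: "openin TX W" "x \<in> W" "W \<subseteq> {x' \<in> topspace TX. stabilizer G act x' \<inter> U \<noteq> {}}"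
      unfolding neighborhood_of_def by blast
    have "W \<times> V \<subseteq> topspace ?P - ?C"
    proof
      fix w assume "w \<in> W \<times> V"
      then obtain x' v' where w: "w = (x', v')" "x' \<in> W" "v' \<in> V" by blast
      obtain k' where k': "k' \<in> stabilizer G act x'" "k' \<in> U" using W(3) w(2) by blast
      have "(k', v') \<in> U \<times> V" using k' w by simp
      then have "ract k' v' i - v' i \<noteq> 0" using UV(5) by fastforce
      then have "ract k' v' \<noteq> v'" by auto
      then show "w \<in> topspace ?P - ?C" using k'(1) w W by (auto simp: fixed_def)
    qed
    then show "\<exists>T. openin ?P T \<and> z \<in> T \<and> T \<subseteq> topspace ?P - ?C"
      using W(1,2) UV(2,4) zxv by (intro exI[of _ "W \<times> V"]) (simp add: openin_prod_Times_iff)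
  qed
  then have cl: "closedin ?P ?C" by (subst closedin_def) auto
  have "compactin ?P (topspace TX \<times> sphere_d)"
    using compact_sphere compact_TX by (simp add: compactin_Times compact_space_def)
  then have "compactin ?P ((topspace TX \<times> sphere_d) \<inter> ?C)" using cl by (rule compact_Int_closedin)
  moreover have "(topspace TX \<times> sphere_d) \<inter> ?C = fixed_vectors"
    by (auto simp: fixed_vectors_def)
  ultimately show ?thesis by simp
qed

lemma compactin_bounds:
  assumes "compactin Z K" "continuous_map Z euclideanreal f"
  obtains m M where "\<And>z. z \<in> K \<Longrightarrow> m \<le> f z \<and> f z \<le> M" "(\<And>z. z \<in> K \<Longrightarrow> f z > 0) \<Longrightarrow> m > 0" "M > 0"
proof (cases "K = {}")
  case True
  \<comment> \<open>The default 1 keeps both positivity claims true for empty \<open>K\<close>, a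
    case that arises when no stabilizer fixes a unit vector.\<close>
  then show ?thesis using that[of 1 1] by auto
next
  case False
  have c: "compact (f ` K)" using image_compactin[OF assms] by simp
  obtain m where m: "m \<in> f ` K" "\<And>y. y \<in> f ` K \<Longrightarrow> m \<le> y" using compact_attains_inf[OF c] False by auto
  obtain M where M: "\<And>y. y \<in> f ` K \<Longrightarrow> y \<le> M" using compact_attains_sup[OF c] False by auto
  have "m \<le> f z \<and> f z \<le> max M 1" if "z \<in> K" for z
    using m(2)[of "f z"] M[of "f z"] that by auto
  then show ?thesis using that[of m "max M 1"] m(1) by auto
qed

lemma B_cont_pair:
  assumes "\<And>i. i < d \<Longrightarrow> continuous_map Z euclidean (\<lambda>z. f z i)" "\<And>i. i < d \<Longrightarrow> continuous_map Z euclidean (\<lambda>z. g z i)"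
  shows "continuous_map Z euclidean (\<lambda>z. B (f z) (g z))"
  unfolding B_def using assms
  by (intro continuous_map_sum continuous_map_cmult continuous_map_cnj continuous_map_canonical_const) auto

text \<open>By compactness finitely many \<open>p\<close> detect every fixed unit vector. At
  \<open>x\<close>, \<open>S x\<close> is the frame operator of their values and \<open>Q x\<close>
  its quadratic form. The bound \<open>Q \<ge> \<delta>\<close> makes
  \<open>v - \<tau> * S x v\<close> a strict contraction of fixed vectors. Iterating this on
  \<open>e\<close> tends to zero geometrically, and what is subtracted along the way is a
  combination of the \<open>p\<close> with invariant coefficients, whose sum recovers
  \<open>e\<close>.\<close>

lemma mor_finitely_generated:
  assumes lsc: "lower_semicontinuous_map TX T (\<lambda>x. stabilizer G act x)"
  obtains P where "finite P" "P \<subseteq> mor d \<alpha>"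
    "\<And>e. e \<in> mor d \<alpha> \<Longrightarrow> \<exists>a. (\<forall>p\<in>P. a p \<in> invariant_cfun G TX act) \<and> (\<forall>i<d. e i = (\<Sum>p\<in>P. a p * p i))"
proof -
  let ?X = "prod_topology TX (euclidean :: (nat \<Rightarrow> complex) topology)"
  note Zc = compact_fixed_vectors[OF lsc]
  have c1: "continuous_map ?X euclidean (\<lambda>z. snd z i)" for i
    by (rule continuous_map_compose[OF continuous_map_snd coord_cont, unfolded o_def])
  have c2: "continuous_map ?X euclidean (\<lambda>z. eval_at p (fst z) i)" if "p \<in> mor d \<alpha>" for p i
  proof (cases "i < d")
    case True
    then show ?thesis
      using continuous_map_compose[OF continuous_map_fst cfun_cont[OF mor_cfun[OF that True]], of euclidean]
      by (simp add: eval_at_def o_def)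
  qed (simp add: eval_at_def)
  have c3: "continuous_map ?X euclidean (\<lambda>z. B (snd z) (eval_at p (fst z)))" if "p \<in> mor d \<alpha>" for p
    by (rule B_cont_pair[OF c1 c2[OF that]])
  define W where "W p = {z \<in> topspace ?X. B (snd z) (eval_at p (fst z)) \<in> - {0}}" for p
  have Wo: "openin ?X (W p)" if "p \<in> mor d \<alpha>" for p
    unfolding W_def by (rule openin_continuous_map_preimage[OF c3[OF that]]) auto
  have cover: "fixed_vectors \<subseteq> \<Union>(W ` mor d \<alpha>)"
  proof
    fix z assume z: "z \<in> fixed_vectors"
    obtain x v where zxv: "z = (x, v)" by (cases z)
    have xv: "x \<in> topspace TX" "v \<in> sphere_d" "fixed x v" using z zxv by (auto simp: fixed_vectors_def)
    have "\<exists>i<d. v i \<noteq> 0"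
    proof (rule ccontr)
      assume "\<not> (\<exists>i<d. v i \<noteq> 0)"
      then have "(\<Sum>i<d. (norm (v i))\<^sup>2) = 0" by (intro sum.neutral) auto
      then show False using xv(2) by (simp add: sphere_d_def)
    qed
    then obtain i where i: "i < d" "v i \<noteq> 0" by blast
    have v0: "\<And>i. i \<ge> d \<Longrightarrow> v i = 0" using xv(2) by (simp add: sphere_d_def)
    obtain e where "e \<in> mor d \<alpha>" "B v (eval_at e x) \<noteq> 0"
      using mor_through_fixed_vector[OF xv(1) v0 i xv(3)] by metis
    then show "z \<in> \<Union>(W ` mor d \<alpha>)" using xv(1) zxv by (auto simp: W_def)
  qed
  obtain \<U> where U: "finite \<U>" "\<U> \<subseteq> W ` mor d \<alpha>" "fixed_vectors \<subseteq> \<Union>\<U>"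
    using compactinD[OF Zc, of "W ` mor d \<alpha>"] Wo cover by auto
  obtain P where P: "P \<subseteq> mor d \<alpha>" "finite P" "\<U> = W ` P" using finite_subset_image[OF U(1,2)] by metis
  have Pm: "p \<in> mor d \<alpha>" if "p \<in> P" for p using P(1) that by blast
  define Q where "Q x v = (\<Sum>p\<in>P. (norm (B v (eval_at p x)))\<^sup>2)" for x v
  define S where "S x v i = (\<Sum>p\<in>P. B v (eval_at p x) * eval_at p x i)" for x v i
  have BS: "B (S x v) v = of_real (Q x v)" for x v
  proof -
    have "B (S x v) v = (\<Sum>p\<in>P. B v (eval_at p x) * B (eval_at p x) v)"
      unfolding S_def by (rule B_sum_left)
    also have "\<dots> = (\<Sum>p\<in>P. B v (eval_at p x) * cnj (B v (eval_at p x)))"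
      by (intro sum.cong refl) (simp only: B_sym[of "eval_at _ x" v])
    finally show ?thesis unfolding Q_def by (simp only: of_real_sum complex_norm_square)
  qed
  have cQ: "continuous_map ?X euclideanreal (\<lambda>z. Q (fst z) (snd z))"
    unfolding Q_def using c3[OF Pm] P(2)
    by (intro continuous_map_sum continuous_map_real_pow continuous_map_norm) auto
  have cS: "continuous_map ?X euclidean (\<lambda>z. S (fst z) (snd z) i)" for i
    unfolding S_def using c3[OF Pm] c2[OF Pm] P(2)
    by (intro continuous_map_sum continuous_map_cmult) auto
  have cNS: "continuous_map ?X euclideanreal (\<lambda>z. Re (B (S (fst z) (snd z)) (S (fst z) (snd z))))"
    by (intro continuous_map_Re B_cont_pair cS)
  have cN: "continuous_map ?X euclideanreal (\<lambda>z. Re (B (snd z) (snd z)))"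
    by (intro continuous_map_Re B_cont_pair c1)
  have XK: "compactin ?X (topspace TX \<times> sphere_d)"
    using compact_sphere compact_TX by (simp add: compactin_Times compact_space_def)
  have Bpos: "Re (B v v) > 0" if v: "v \<in> sphere_d" for v
  proof -
    have "\<exists>i<d. v i \<noteq> 0"
    proof (rule ccontr)
      assume "\<not> (\<exists>i<d. v i \<noteq> 0)"
      then have "(\<Sum>i<d. (norm (v i))\<^sup>2) = 0" by (intro sum.neutral) auto
      then show False using v by (simp add: sphere_d_def)
    qed
    then show ?thesis using B_pos by blast
  qed
  obtain \<delta> :: real where "\<And>z. z \<in> fixed_vectors \<Longrightarrow> \<delta> \<le> Q (fst z) (snd z)" and \<delta>: "\<delta> > 0"
  proof (rule compactin_bounds[OF Zc cQ])
    fix m M :: real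
    assume m: "\<And>z. z \<in> fixed_vectors \<Longrightarrow> m \<le> Q (fst z) (snd z) \<and> Q (fst z) (snd z) \<le> M"
      and pos: "(\<And>z. z \<in> fixed_vectors \<Longrightarrow> Q (fst z) (snd z) > 0) \<Longrightarrow> m > 0"
    have "Q (fst z) (snd z) > 0" if zf: "z \<in> fixed_vectors" for z
    proof -
      obtain p where p: "p \<in> P" "z \<in> W p" using U(3) P(3) zf by blast
      have "0 < (norm (B (snd z) (eval_at p (fst z))))\<^sup>2" using p(2) by (simp add: W_def)
      also have "\<dots> \<le> Q (fst z) (snd z)"
        unfolding Q_def by (rule member_le_sum[OF p(1)]) (use P(2) in auto)
      finally show ?thesis .
    qed
    from pos[OF this] m show thesis by (intro that[of m]) auto
  qed
  then have Q\<delta>: "\<delta> \<le> Q x u" if "x \<in> topspace TX" "u \<in> sphere_d" "fixed x u" for x u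
    using that by (force simp: fixed_vectors_def)
  obtain C2 where C2: "C2 > 0" "\<And>x u. x \<in> topspace TX \<Longrightarrow> u \<in> sphere_d \<Longrightarrow> Re (B (S x u) (S x u)) \<le> C2"
    by (rule compactin_bounds[OF XK cNS]) force
  obtain C3 where C3: "C3 > 0" "\<And>x u. x \<in> topspace TX \<Longrightarrow> u \<in> sphere_d \<Longrightarrow> Q x u \<le> C3"
    by (rule compactin_bounds[OF XK cQ]) force
  have cN': "continuous_map euclidean euclideanreal (\<lambda>u. Re (B u u))"
    by (intro continuous_map_Re B_cont_pair coord_cont)
  obtain c0 C1 where c0: "c0 > 0" and C1: "C1 > 0"
    and NC: "\<And>u. u \<in> sphere_d \<Longrightarrow> c0 \<le> Re (B u u) \<and> Re (B u u) \<le> C1"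
    by (rule compactin_bounds[OF compact_sphere cN']) (use Bpos in blast)
  \<comment> \<open>The minimizer of \<open>- 2 * \<tau> * \<delta> + \<tau>\<^sup>2 * C2\<close>;
    the minimum is \<open>- \<delta>\<^sup>2 / C2 = - g * C1\<close>. As
    \<open>Re (B u u) \<le> C1\<close>, at least the fraction \<open>g\<close> of
    \<open>Re (B u u)\<close> is lost.\<close>
  define \<tau> where "\<tau> = \<delta> / C2"
  define g where "g = \<delta>\<^sup>2 / (C2 * C1)"
  have \<tau>: "\<tau> > 0" and g: "g > 0" using \<delta> C2 C1 by (simp_all add: \<tau>_def g_def)
  \<comment> \<open>The maximum keeps the ratio nonnegative: its square root \<open>\<sigma>\<close>
    later serves as the ratio for norms, since \<open>\<rho>\<close> governs a quadratic
    form.\<close>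
  define \<rho> where "\<rho> = max 0 (1 - g)"
  have \<rho>: "0 \<le> \<rho>" "\<rho> < 1" using g by (auto simp: \<rho>_def)
  have expand: "Re (B (\<lambda>i. v i - of_real \<tau> * S x v i) (\<lambda>i. v i - of_real \<tau> * S x v i)) =
     Re (B v v) - 2 * \<tau> * Q x v + \<tau>\<^sup>2 * Re (B (S x v) (S x v))" for x v
  proof -
    have "B v (S x v) = of_real (Q x v)" using B_sym[of v "S x v"] BS[of x v] by simp
    then show ?thesis
      by (simp add: B_diff_left B_diff_right B_scale_left B_scale_right BS power2_eq_square algebra_simps)
  qed
  \<comment> \<open>Homogeneity reduces the estimates for arbitrary vectors to the compact
    sphere.\<close>
  have hom: "S x (\<lambda>i. c * v i) = (\<lambda>i. c * S x v i)" for x c v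
    by (simp add: S_def B_scale_left sum_distrib_left mult_ac fun_eq_iff)
  have contr: "Re (B (\<lambda>i. v i - of_real \<tau> * S x v i) (\<lambda>i. v i - of_real \<tau> * S x v i)) \<le> \<rho> * Re (B v v)"
    if x: "x \<in> topspace TX" and v: "\<And>i. i \<ge> d \<Longrightarrow> v i = 0" and fx: "fixed x v" for x v
  proof (cases "v = (\<lambda>_. 0)")
    case True
    then show ?thesis by (simp add: S_def B_def)
  next
    case False
    obtain r u where r: "r > 0" and u: "u \<in> sphere_d" and vu: "v = (\<lambda>i. of_real r * u i)"
      by (rule scale_to_sphere[OF v False])
    have fu: "fixed x u"
    proof -
      have "ract k v = (\<lambda>i. of_real r * ract k u i)" for k
        by (simp add: vu ract_def fun_eq_iff sum_distrib_left mult_ac)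
      then show ?thesis using fx r unfolding fixed_def vu by (auto simp: fun_eq_iff)
    qed
    have "Re (B (\<lambda>i. u i - of_real \<tau> * S x u i) (\<lambda>i. u i - of_real \<tau> * S x u i)) \<le>
      Re (B u u) - 2 * \<tau> * \<delta> + \<tau>\<^sup>2 * C2"
      unfolding expand using Q\<delta>[OF x u fu] C2(2)[OF x u] \<tau>
      by (intro add_mono diff_mono mult_left_mono) auto
    also have "\<dots> = Re (B u u) - g * C1"
      using C1 C2(1) by (simp add: \<tau>_def g_def power2_eq_square field_simps)
    also have "\<dots> \<le> (1 - g) * Re (B u u)"
      using mult_left_mono[of "Re (B u u)" C1 g] NC[OF u] g by (simp add: algebra_simps)
    also have "\<dots> \<le> \<rho> * Re (B u u)"
      using Bpos[OF u] by (intro mult_right_mono) (auto simp: \<rho>_def)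
    finally have le: "Re (B (\<lambda>i. u i - of_real \<tau> * S x u i) (\<lambda>i. u i - of_real \<tau> * S x u i)) \<le> \<rho> * Re (B u u)" .
    have e1: "(\<lambda>i. v i - of_real \<tau> * S x v i) = (\<lambda>i. of_real r * (u i - of_real \<tau> * S x u i))"
      unfolding vu hom by (simp add: right_diff_distrib mult_ac)
    have h2: "Re (B (\<lambda>i. of_real r * w i) (\<lambda>i. of_real r * w i)) = r\<^sup>2 * Re (B w w)" for w
      by (simp add: B_scale_left B_scale_right power2_eq_square)
    show ?thesis
      unfolding e1 h2 unfolding vu h2 using mult_left_mono[OF le, of "r\<^sup>2"] by (simp add: mult_ac)
  qed
  \<comment> \<open>The quadratic form controls coefficients and coordinates, so its geometric decay
    makes the coefficient series converge uniformly and the remainders vanish.\<close>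
  have coef: "(norm (B v (eval_at p x)))\<^sup>2 \<le> C3 / c0 * Re (B v v)" and coord: "(norm (v i))\<^sup>2 \<le> 1 / c0 * Re (B v v)"
    if x: "x \<in> topspace TX" and v: "\<And>i. i \<ge> d \<Longrightarrow> v i = 0" and p: "p \<in> P" for x v p i
  proof -
    have "(norm (B v (eval_at p x)))\<^sup>2 \<le> C3 / c0 * Re (B v v) \<and> (norm (v i))\<^sup>2 \<le> 1 / c0 * Re (B v v)"
    proof (cases "v = (\<lambda>_. 0)")
      case True
      then show ?thesis by (simp add: B_def)
    next
      case False
      obtain r u where r: "r > 0" and u: "u \<in> sphere_d" and vu: "v = (\<lambda>i. of_real r * u i)"
        by (rule scale_to_sphere[OF v False])
      have N: "1 \<le> Re (B u u) / c0" using NC[OF u] c0 by (simp add: le_divide_eq)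
      have "(norm (B u (eval_at p x)))\<^sup>2 \<le> Q x u"
        unfolding Q_def by (rule member_le_sum[OF p]) (use P(2) in auto)
      also have "\<dots> \<le> C3 * 1" using C3(2)[OF x u] by simp
      also have "\<dots> \<le> C3 * (Re (B u u) / c0)" using N C3(1) by (intro mult_left_mono) auto
      finally have 1: "(norm (B u (eval_at p x)))\<^sup>2 \<le> C3 / c0 * Re (B u u)" by simp
      have "(norm (u i))\<^sup>2 \<le> 1"
      proof (cases "i < d")
        case True
        have "(norm (u i))\<^sup>2 \<le> (\<Sum>i<d. (norm (u i))\<^sup>2)" by (rule member_le_sum) (use True in auto)
        then show ?thesis using u by (simp add: sphere_d_def)
      qed (use u in \<open>auto simp: sphere_d_def\<close>)
      then have 2: "(norm (u i))\<^sup>2 \<le> 1 / c0 * Re (B u u)" using N by simp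
      have h: "Re (B v v) = r\<^sup>2 * Re (B u u)"
        unfolding vu by (simp add: B_scale_left B_scale_right power2_eq_square)
      have h1: "(norm (B v (eval_at p x)))\<^sup>2 = r\<^sup>2 * (norm (B u (eval_at p x)))\<^sup>2"
        unfolding vu B_scale_left using r by (simp add: norm_mult power_mult_distrib)
      have h2: "(norm (v i))\<^sup>2 = r\<^sup>2 * (norm (u i))\<^sup>2"
        unfolding vu using r by (simp add: norm_mult power_mult_distrib)
      show ?thesis
        unfolding h h1 h2 using mult_left_mono[OF 1, of "r\<^sup>2"] mult_left_mono[OF 2, of "r\<^sup>2"]
        by (simp add: mult_ac)
    qed
    then show "(norm (B v (eval_at p x)))\<^sup>2 \<le> C3 / c0 * Re (B v v)" "(norm (v i))\<^sup>2 \<le> 1 / c0 * Re (B v v)"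
      by blast+
  qed
  have main: "\<exists>a. (\<forall>p\<in>P. a p \<in> invariant_cfun G TX act) \<and> (\<forall>i<d. e i = (\<Sum>p\<in>P. a p * p i))"
    if e: "e \<in> mor d \<alpha>" for e
  proof -
    \<comment> \<open>Pointwise this is \<open>v - \<tau> * S x v\<close>. Its coefficients are
      invariant, so iteration stays inside \<open>mor\<close> and the values stay among the fixed
      vectors, where \<open>contr\<close> applies.\<close>
    define step where "step f i x = f i x - of_real \<tau> * (\<Sum>p\<in>P. B (eval_at f x) (eval_at p x) * p i x)"
      for f :: "nat \<Rightarrow> 'x \<Rightarrow> complex" and i x
    define E where "E k = (step ^^ k) e" for k
    have E0: "E 0 = e" and ES: "E (Suc k) = step (E k)" for k by (simp_all add: E_def)
    have stepm: "step f \<in> mor d \<alpha>" if f: "f \<in> mor d \<alpha>" for f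
    proof (rule morI)
      have Binv: "(\<lambda>x. B (eval_at f x) (eval_at p x)) \<in> invariant_cfun G TX act" if "p \<in> P" for p
        by (rule B_at_invariant[OF f Pm[OF that]])
      show "step f i \<in> cfun TX" if i: "i < d" for i
      proof -
        have "continuous_map TX euclidean (step f i)"
          unfolding step_def[abs_def]
        proof (intro continuous_map_diff continuous_map_cmult continuous_map_sum continuous_map_canonical_const)
          show "continuous_map TX euclidean (f i)" by (rule cfun_cont[OF mor_cfun[OF f i]])
          fix p assume p: "p \<in> P"
          show "continuous_map TX euclidean (\<lambda>x. B (eval_at f x) (eval_at p x))"
            using Binv[OF p] by (auto simp: invariant_cfun_def cfun_def)
          show "continuous_map TX euclidean (p i)" by (rule cfun_cont[OF mor_cfun[OF Pm[OF p] i]])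
        qed (rule P(2))
        moreover have "step f i x = 0" if "x \<notin> topspace TX" for x
        proof -
          have "(\<Sum>p\<in>P. B (eval_at f x) (eval_at p x) * p i x) = 0"
            using cfun_zero[OF mor_cfun[OF Pm i] that] by (intro sum.neutral ballI) simp
          then show ?thesis unfolding step_def using cfun_zero[OF mor_cfun[OF f i] that] by simp
        qed
        ultimately show ?thesis by (simp add: cfun_def)
      qed
      fix s x i assume s: "s \<in> carrier G" and x: "x \<in> topspace TX" and i: "i < d"
      have inv: "B (eval_at f (act (inv s) x)) (eval_at p (act (inv s) x)) = B (eval_at f x) (eval_at p x)" if "p \<in> P" for p
        using mor_at_act[OF f s x] mor_at_act[OF Pm[OF that] s x] s by (simp add: B_ract)
      have pe: "(\<Sum>p\<in>P. B (eval_at f (act (inv s) x)) (eval_at p (act (inv s) x)) * p i (act (inv s) x)) =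
          (\<Sum>p\<in>P. \<Sum>j<d. \<alpha> s $$ (j, i) * (B (eval_at f x) (eval_at p x) * p j x))"
        by (intro sum.cong refl) (simp add: inv mor_value[OF Pm s x i] sum_distrib_left mult_ac)
      have "step f i (act (inv s) x) = (\<Sum>j<d. \<alpha> s $$ (j, i) * f j x) -
          of_real \<tau> * (\<Sum>p\<in>P. \<Sum>j<d. \<alpha> s $$ (j, i) * (B (eval_at f x) (eval_at p x) * p j x))"
        unfolding step_def mor_value[OF f s x i] pe ..
      also have "(\<Sum>p\<in>P. \<Sum>j<d. \<alpha> s $$ (j, i) * (B (eval_at f x) (eval_at p x) * p j x)) =
          (\<Sum>j<d. \<Sum>p\<in>P. \<alpha> s $$ (j, i) * (B (eval_at f x) (eval_at p x) * p j x))"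
        by (rule sum.swap)
      also have "(\<Sum>j<d. \<alpha> s $$ (j, i) * f j x) - of_real \<tau> * \<dots> = (\<Sum>j<d. \<alpha> s $$ (j, i) * step f j x)"
        unfolding step_def by (simp add: sum_distrib_left right_diff_distrib sum_subtractf mult_ac)
      finally show "step f i (act (inv s) x) = (\<Sum>j<d. \<alpha> s $$ (j, i) * step f j x)" .
    qed
    have Em: "E k \<in> mor d \<alpha>" for k
      by (induction k) (simp_all add: E0 ES e stepm)
    have at_step: "eval_at (step f) x = (\<lambda>i. eval_at f x i - of_real \<tau> * S x (eval_at f x) i)" for f x
      by (auto simp: eval_at_def step_def S_def fun_eq_iff)
    define N where "N k x = Re (B (eval_at (E k) x) (eval_at (E k) x))" for k x
    have N0: "N k x \<ge> 0" for k x
    proof (cases "\<exists>i<d. eval_at (E k) x i \<noteq> 0")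
      case True
      then show ?thesis unfolding N_def using B_pos less_imp_le by blast
    next
      case False
      then have "B (eval_at (E k) x) (eval_at (E k) x) = 0" unfolding B_def by (intro sum.neutral ballI) auto
      then show ?thesis by (simp add: N_def)
    qed
    have Nk: "N k x \<le> \<rho> ^ k * N 0 x" if x: "x \<in> topspace TX" for k x
    proof (induction k)
      case (Suc k)
      have "N (Suc k) x \<le> \<rho> * N k x"
        unfolding N_def ES at_step
        by (rule contr[OF x _ mor_at_fixed[OF Em x]]) (simp add: eval_at_def)
      also have "\<dots> \<le> \<rho> * (\<rho> ^ k * N 0 x)" using Suc \<rho> by (intro mult_left_mono) auto
      finally show ?case by simp
    qed simp
    obtain M where M: "M \<ge> 0" "\<And>x. N 0 x \<le> M"
    proof -
      have "(\<lambda>x. B (eval_at e x) (eval_at e x)) \<in> cfun TX"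
        using B_at_invariant[OF e e] by (simp add: invariant_cfun_def)
      then obtain M where M: "M \<ge> 0" "\<And>x. norm (B (eval_at e x) (eval_at e x)) \<le> M"
        by (rule cfun_bounded[OF compact_TX]) blast
      have "N 0 x \<le> M" for x
        unfolding N_def E0 using complex_Re_le_cmod order_trans M(2) by blast
      then show ?thesis using that M(1) by blast
    qed
    define \<sigma> where "\<sigma> = sqrt \<rho>"
    have \<sigma>: "0 \<le> \<sigma>" "\<sigma> < 1" and \<sigma>2: "\<rho> = \<sigma>\<^sup>2" using \<rho> by (simp_all add: \<sigma>_def real_sqrt_lt_1_iff)
    have root: "a \<le> sqrt (K * M) * \<sigma> ^ k" if "a\<^sup>2 \<le> K * N k x" "K > 0" "x \<in> topspace TX" for a K k x
    proof (rule power2_le_imp_le)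
      have "a\<^sup>2 \<le> K * N k x" by fact
      also have "\<dots> \<le> K * (\<rho> ^ k * M)"
      proof (intro mult_left_mono)
        show "N k x \<le> \<rho> ^ k * M"
          using Nk[OF that(3), of k] mult_left_mono[OF M(2)[of x], of "\<rho> ^ k"] \<rho> by simp
      qed (use that in simp)
      also have "\<dots> = (sqrt (K * M) * \<sigma> ^ k)\<^sup>2"
        using that(2) M(1) by (simp add: power_mult_distrib \<sigma>2 power_mult[symmetric] mult.commute)
      finally show "a\<^sup>2 \<le> (sqrt (K * M) * \<sigma> ^ k)\<^sup>2" .
      show "0 \<le> sqrt (K * M) * \<sigma> ^ k" using \<sigma> M(1) that(2) by simp
    qed
    define t where "t p k x = of_real \<tau> * B (eval_at (E k) x) (eval_at p x)" for p k x
    have tinv: "t p k \<in> invariant_cfun G TX act" if "p \<in> P" for p k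
    proof -
      have "fscale (of_real \<tau>) (\<lambda>x. B (eval_at (E k) x) (eval_at p x)) \<in> invariant_cfun G TX act"
        by (rule fun_space.subspace_scale[OF subspace_invariant_cfun B_at_invariant[OF Em Pm[OF that]]])
      then show ?thesis by (simp add: t_def[abs_def] fscale_def)
    qed
    have tb: "norm (t p k x) \<le> (\<tau> * sqrt (C3 / c0 * M)) * \<sigma> ^ k" if p: "p \<in> P" for p k x
    proof (cases "x \<in> topspace TX")
      case True
      have "norm (B (eval_at (E k) x) (eval_at p x)) \<le> sqrt (C3 / c0 * M) * \<sigma> ^ k"
        by (rule root[OF _ _ True]) (use coef[OF True _ p, of "eval_at (E k) x"] C3 c0 in \<open>auto simp: N_def eval_at_def\<close>)
      then show ?thesis using \<tau> by (simp add: t_def norm_mult)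
    next
      case False
      then have "t p k x = 0" using tinv[OF p] by (simp add: invariant_cfun_def cfun_def)
      then show ?thesis using \<tau> \<sigma> C3 c0 M by simp
    qed
    have ts: "summable (\<lambda>k. t p k x)" if p: "p \<in> P" for p x
    proof (rule summable_comparison_test'[where N = 0])
      show "summable (\<lambda>k. (\<tau> * sqrt (C3 / c0 * M)) * \<sigma> ^ k)"
        using \<sigma> by (intro summable_mult summable_geometric) simp
    qed (rule tb[OF p])
    define a where "a p x = (\<Sum>k. t p k x)" for p x
    have ainv: "a p \<in> invariant_cfun G TX act" if p: "p \<in> P" for p
    proof (rule invariant_cfunI)
      have "(\<lambda>x. \<Sum>k. t p k x) \<in> cfun TX"
        by (rule cfun_suminf[OF _ tb[OF p] \<sigma>]) (use tinv[OF p] in \<open>simp add: invariant_cfun_def\<close>)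
      then show "a p \<in> cfun TX" by (simp add: a_def[abs_def])
      fix s x assume "s \<in> carrier G" "x \<in> topspace TX"
      then show "a p (act (inv s) x) = a p x"
        unfolding a_def using invariant_cfun_act[OF tinv[OF p]] by simp
    qed
    have "e i x = (\<Sum>p\<in>P. a p x * p i x)" if i: "i < d" for i x
    proof (cases "x \<in> topspace TX")
      case False
      have "(\<Sum>p\<in>P. a p x * p i x) = 0"
        using cfun_zero[OF mor_cfun[OF Pm i] False] by (intro sum.neutral ballI) simp
      then show ?thesis using cfun_zero[OF mor_cfun[OF e i] False] by simp
    next
      case x: True
      show ?thesis
      \<comment> \<open>Without generators \<open>Q\<close> is zero, so its bound
        \<open>\<delta>\<close> leaves no fixed unit vector and \<open>e\<close> vanishes at
        \<open>x\<close>. The other case has a member of \<open>P\<close> to feed to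
        \<open>coord\<close>.\<close>
      proof (cases "P = {}")
        case True
        have "e i x = 0"
        proof (rule ccontr)
          assume ne: "e i x \<noteq> 0"
          have "eval_at e x i \<noteq> 0" using ne i by (simp add: eval_at_def)
          then have "eval_at e x \<noteq> (\<lambda>_. 0)" by auto
          then obtain r u where u: "u \<in> sphere_d" "r > 0" "eval_at e x = (\<lambda>i. of_real r * u i)"
            by (rule scale_to_sphere[rotated]) (auto simp: eval_at_def)
          have "fixed x u"
          proof -
            have "ract k (eval_at e x) = (\<lambda>i. of_real r * ract k u i)" for k
              by (simp add: u(3) ract_def fun_eq_iff sum_distrib_left mult_ac)
            then show ?thesis using mor_at_fixed[OF e x] u(2) unfolding fixed_def u(3) by (auto simp: fun_eq_iff)
          qed
          then show False using Q\<delta>[OF x u(1)] \<delta> True by (simp add: Q_def)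
        qed
        then show ?thesis using True by simp
      next
        case False
        then obtain p0 where p0: "p0 \<in> P" by blast
        have dif: "E k i x - E (Suc k) i x = (\<Sum>p\<in>P. t p k x * p i x)" for k
          unfolding ES step_def t_def by (simp add: sum_distrib_left mult_ac)
        have lim: "(\<lambda>k. E k i x) \<longlonglongrightarrow> 0"
        proof (rule Lim_null_comparison[OF always_eventually[OF allI]])
          show "norm (E k i x) \<le> sqrt (1 / c0 * M) * \<sigma> ^ k" for k
            by (rule root[OF _ _ x]) (use coord[OF x _ p0, of "eval_at (E k) x" i] c0 i in \<open>auto simp: N_def eval_at_def\<close>)
          show "(\<lambda>k. sqrt (1 / c0 * M) * \<sigma> ^ k) \<longlonglongrightarrow> 0"
            using tendsto_mult_right_zero[OF LIMSEQ_realpow_zero[of \<sigma>]] \<sigma> by simp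
        qed
        \<comment> \<open>The differences telescope to \<open>e i x\<close>, and each of them is a
          combination of the \<open>p i x\<close> with coefficients \<open>t p k x\<close>.\<close>
        have "(\<lambda>k. E k i x - E (Suc k) i x) sums (E 0 i x - 0)"
          by (rule telescope_sums'[OF lim])
        moreover have "(\<lambda>k. \<Sum>p\<in>P. t p k x * p i x) sums (\<Sum>p\<in>P. a p x * p i x)"
          unfolding a_def by (intro sums_sum sums_mult2 summable_sums ts)
        ultimately show ?thesis unfolding dif E0 using sums_unique2 by fastforce
      qed
    qed
    then have "e i = (\<Sum>p\<in>P. a p * p i)" if "i < d" for i
    proof -
      have "(\<Sum>p\<in>P. a p * p i) x = (\<Sum>p\<in>P. a p x * p i x)" for x
        using P(2) by (induction P rule: finite_induct) auto
      then show ?thesis using \<open>\<And>x i. i < d \<Longrightarrow> e i x = (\<Sum>p\<in>P. a p x * p i x)\<close> that by (auto simp: fun_eq_iff)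
    qed
    then show ?thesis using ainv by blast
  qed
  then show ?thesis using that[OF P(2,1)] by blast
qed

end

context compact_action
begin

text \<open>The module generators are the coordinates \<open>p i\<close> of the finitely many
  intertwiners found above. Their combinations stay in the component because an invariant multiple
  of an intertwiner is again one.\<close>

lemma isotypic_finitely_generated:
  assumes lsc: "lower_semicontinuous_map TX T (\<lambda>x. stabilizer G act x)"
    and irr: "irreducible_representation G T d \<alpha>"
  shows "finitely_generated_over (invariant_cfun G TX act) (isotypic_component G TX act d \<alpha>)"
proof -
  interpret R: compact_action_rep G T TX act d \<alpha>
    by unfold_locales (use irr in \<open>simp add: irreducible_representation_def\<close>)
  obtain P where P: "finite P" "P \<subseteq> mor d \<alpha>"
    "\<And>e. e \<in> mor d \<alpha> \<Longrightarrow> \<exists>a. (\<forall>p\<in>P. a p \<in> invariant_cfun G TX act) \<and> (\<forall>i<d. e i = (\<Sum>p\<in>P. a p * p i))"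
    by (rule R.mor_finitely_generated[OF lsc]) blast
  define S where "S = (\<lambda>(p, i). p i) ` (P \<times> {..<d})"
  let ?A = "invariant_cfun G TX act"
  let ?N = "{(\<Sum>h\<in>S. a h * h) | a. \<forall>h\<in>S. a h \<in> ?A}"
  note As = R.subspace_invariant_cfun
  have finS: "finite S" using P(1) by (simp add: S_def)
  have SM: "S \<subseteq> comps d \<alpha>" using P(2) by (auto simp: S_def comps_def)
  have "fun_space.span (comps d \<alpha>) \<subseteq> ?N"
  proof (rule fun_space.span_minimal)
    show "fun_space.subspace ?N"
      unfolding fun_space.subspace_def
    proof (intro conjI ballI allI)
      show "0 \<in> ?N" using fun_space.subspace_0[OF As] by (intro CollectI exI[of _ "\<lambda>_. 0"]) simp
      fix x assume "x \<in> ?N"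
      then obtain a where a: "x = (\<Sum>h\<in>S. a h * h)" "\<forall>h\<in>S. a h \<in> ?A" by blast
      have "fscale c x = (\<Sum>h\<in>S. fscale c (a h) * h)" for c
      proof -
        have "fscale c (a h) * h = fscale c (a h * h)" for h by (simp add: fscale_def fun_eq_iff)
        then show ?thesis unfolding a(1) by (simp add: fun_space.scale_sum_right)
      qed
      then show "fscale c x \<in> ?N" for c
        using a(2) fun_space.subspace_scale[OF As] by (intro CollectI exI[of _ "\<lambda>h. fscale c (a h)"]) auto
      fix y assume "y \<in> ?N"
      then obtain b where b: "y = (\<Sum>h\<in>S. b h * h)" "\<forall>h\<in>S. b h \<in> ?A" by blast
      have "x + y = (\<Sum>h\<in>S. (a h + b h) * h)"
        unfolding a(1) b(1) by (simp only: sum.distrib distrib_right)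
      then show "x + y \<in> ?N"
        using a(2) b(2) fun_space.subspace_add[OF As] by (intro CollectI exI[of _ "\<lambda>h. a h + b h"]) auto
    qed
    show "comps d \<alpha> \<subseteq> ?N"
    proof
      fix f assume "f \<in> comps d \<alpha>"
      then obtain e i where e: "e \<in> mor d \<alpha>" "i < d" "f = e i" by (auto simp: comps_def)
      obtain a where a: "\<forall>p\<in>P. a p \<in> ?A" "e i = (\<Sum>p\<in>P. a p * p i)" using P(3)[OF e(1)] e(2) by blast
      \<comment> \<open>Different \<open>p\<close> may have the same function as coordinate
        \<open>i\<close>, while \<open>S\<close> is a set; the coefficients belonging to one
        function are therefore added up.\<close>
      define c where "c h = (\<Sum>p\<in>P. if p i = h then a p else 0)" for h
      have "(\<Sum>h\<in>S. c h * h) = (\<Sum>h\<in>S. \<Sum>p\<in>P. if p i = h then a p * p i else 0)"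
        unfolding c_def sum_distrib_right by (intro sum.cong refl) auto
      also have "\<dots> = (\<Sum>p\<in>P. \<Sum>h\<in>S. if p i = h then a p * p i else 0)" by (rule sum.swap)
      also have "\<dots> = (\<Sum>p\<in>P. a p * p i)"
      proof (rule sum.cong[OF refl])
        fix p assume "p \<in> P"
        then have "p i \<in> S" using e(2) by (force simp: S_def)
        then show "(\<Sum>h\<in>S. if p i = h then a p * p i else 0) = a p * p i"
          using finS by (simp only: sum.delta' if_True)
      qed
      finally have "f = (\<Sum>h\<in>S. c h * h)" using e(3) a(2) by simp
      moreover have "c h \<in> ?A" for h
        unfolding c_def using a(1) fun_space.subspace_0[OF As] by (intro fun_space.subspace_sum[OF As]) auto
      ultimately show "f \<in> ?N" by blast
    qed
  qed
  moreover have "?N \<subseteq> fun_space.span (comps d \<alpha>)"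
  proof
    fix f assume "f \<in> ?N"
    then obtain a where a: "f = (\<Sum>h\<in>S. a h * h)" "\<forall>h\<in>S. a h \<in> ?A" by blast
    have "a h * h \<in> comps d \<alpha>" if h: "h \<in> S" for h
    proof -
      obtain e i where e: "e \<in> mor d \<alpha>" "i < d" "h = e i" using SM h by (auto simp: comps_def)
      then show ?thesis using R.mor_invariant_mult[of "a h" e] a(2) h by (auto simp: comps_def)
    qed
    then show "f \<in> fun_space.span (comps d \<alpha>)"
      unfolding a(1) by (intro fun_space.span_sum fun_space.span_base)
  qed
  ultimately have "isotypic_component G TX act d \<alpha> = ?N"
    using isotypic_component_eq_span[OF irr] by blast
  moreover have "S \<subseteq> isotypic_component G TX act d \<alpha>"
    using SM fun_space.span_superset isotypic_component_eq_span[OF irr] by blast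
  ultimately show ?thesis unfolding finitely_generated_over_def using finS by (intro exI[of _ S]) auto
qed

end

theorem corollary1p6:
  fixes G :: "('g, 'b) monoid_scheme"
    and TG :: "'g topology"
    and TX :: "'x topology"
    and act :: "'g \<Rightarrow> 'x \<Rightarrow> 'x"
  assumes "compact_space TG" and "Hausdorff_space TG"
    and "compact_space TX" and "Hausdorff_space TX"
    and "continuous_group_action G TG TX act"
  shows "(\<forall>d \<alpha>. irreducible_representation G TG d \<alpha> \<longrightarrow>
            finitely_generated_over (invariant_cfun G TX act) (isotypic_component G TX act d \<alpha>))
         \<longleftrightarrow> vietoris_continuous_map TX TG (\<lambda>x. stabilizer G act x)"
proof -
  interpret A: continuous_group_action G TG TX act by (rule assms(5))
  \<comment> \<open>\<open>group_action\<close> encodes an action as a homomorphism into extensional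
    bijections; the pointwise laws are read off on the space.\<close>
  interpret compact_action G TG TX act
  proof unfold_locales
    show "act s x \<in> topspace TX" if "s \<in> carrier G" "x \<in> topspace TX" for s x
      using A.element_image[OF that refl] .
    show "act \<one>\<^bsub>G\<^esub> x = x" if "x \<in> topspace TX" for x
      using A.id_eq_one that by (metis restrict_apply')
    show "act (s \<otimes>\<^bsub>G\<^esub> t) x = act s (act t x)" if "s \<in> carrier G" "t \<in> carrier G" "x \<in> topspace TX" for s t x
      using A.composition_rule[OF that(3,1,2)] .
  qed (use assms A.continuous_act in auto)
  show ?thesis
    unfolding vietoris_continuous_map_def
    using upper_semicontinuous_stabilizer lower_semicontinuous_stabilizer isotypic_finitely_generated by blast
qed

end
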